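(* Let $\mathbb{T}$ be a time scale, and let $A:\mathbb{T}\to M^n(\mathbb{R})$ and $f:\mathbb{T}\to\mathbb{R}^n$ be bounded and rd-continuous, with $A$ regressive (i.e. $E+\mu(t)A(t)$ is invertible for all $t\in\mathbb{T}$). Let $s:\mathbb{R}\to\mathbb{R}$ be the renormalization function of $\mathbb{T}$ (see context). Define $B$ and $g$ on $\mathbb{R}$ as follows. 1. $B(s(t))=A(t)$ and $g(s(t))=f(t)$ for all $t\in\mathbb{T}$. 2. For $t\notin\mathbb{T}$, let $\theta=\sup\{\tau\in\mathbb{T}:\tau\le t\}$ and $$B(s(t))=\frac{\mathrm{Ln}\,(E+\mu(\theta)A(\theta))}{\ln(1+\mu(\theta))},\qquad g(s(t))=\frac{A^{-1}(\theta)\,\mathrm{Ln}\,(E+\mu(\theta)A(\theta))}{\ln(1+\mu(\theta))}\,f(\theta).$$ Then the system of ordinary differential equations $\dot x=B(t)x+g(t)$ is equivalent to the time scale system $x^\Delta=A(t)x+f(t)$ in the following sense: $\Phi_A(t,\tau)=\Phi_B(s(t),s(\tau))$ for all $t,\tau\in\mathbb{T}$, where $\Phi_A$ and $\Phi_B$ are the fundamental (Cauchy) matrices of $x^\Delta=A(t)x$ and $\dot x=B(t)x$ respectively; and for any solution $\varphi$ of $x^\Delta=A(t)x+f(t)$ there exists a solution $\psi$ of $\dot x=B(t)x+g(t)$ such that $\varphi(t)=\psi(s(t))$ for all $t\in\mathbb{T}$.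
   Context: A time scale is a closed set $\mathbb{T}\subset\mathbb{R}$ with $\inf\mathbb{T}=-\infty$, $\sup\mathbb{T}=+\infty$; it is assumed that $0\in\mathbb{T}$. Put $\sigma(t)=\inf\{r\in\mathbb{T}:r>t\}$ and $\mu(t)=\sigma(t)-t$. A point $t$ is right-dense if $\mu(t)=0$; it is left-dense if $\sigma(r)=t$ implies $r=t$. A function on $\mathbb{T}$ is rd-continuous if it is continuous at right-dense points and has finite left-sided limits at left-dense points. The derivative $x^\Delta(t)$ is the value $\gamma$ such that for each $\varepsilon>0$ there is a neighborhood $W$ of $t$ with $|x(\sigma(t))-x(r)-\gamma(\sigma(t)-r)|\le\varepsilon|\sigma(t)-r|$ for all $r\in W\cap\mathbb{T}$. $E$ is the identity matrix. Renormalization. Let $\mathbf{m}$ be Lebesgue measure and $t_0=\inf(\mathbb{T}\cap[0,\infty))$ (so $t_0=0$). Define $s:\mathbb{R}\to\mathbb{R}$ by: - $s(t)=\mathbf{m}([t_0,t]\cap\mathbb{T})+\sum_{\tau\in[t_0,t)\cap\mathbb{T},\,\mu(\tau)>0}\ln(1+\mu(\tau))$ for $t\in\mathbb{T}$, $t\ge t_0$; - $s(t)=-\mathbf{m}([t,t_0]\cap\mathbb{T})-\sum_{\tau\in[t,t_0)\cap\mathbb{T},\,\mu(\tau)>0}\ln(1+\mu(\tau))$ for $t\in\mathbb{T}$, $t<t_0$; - $s(t)=s(t_1)+\ln(1+t-t_1)$ for $t\notin\mathbb{T}$, $t\ge t_0$, where $t_1=\max(\mathbb{T}\cap(-\infty,t])$;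 - $s(t)=s(t_2)-\ln(1+t_2-t)$ for $t\notin\mathbb{T}$, $t<t_0$, where $t_2=\min(\mathbb{T}\cap[t,\infty))$. The function $s$ is a strictly increasing homeomorphism of $\mathbb{R}$. Matrix logarithm. $\mathrm{Ln}(E+\mu A)$ is obtained by continuation in $\mu$ from $\mathrm{Ln}\,E=0$ (for small $\mu$ it is the usual power series); when $A$ has negative eigenvalues, the continuation goes along a contour following the real axis and bypassing, always from the same fixed side, the values of $\mu$ where $E+\mu A$ is singular. The values may be complex, in which case the ODE is considered in $\mathbb{C}^n$. When $A$ is not invertible, $A^{-1}\mathrm{Ln}(E+\mu A)$ denotes the value at $A$ of the function $x\mapsto\ln(1+\mu x)/x$, extended holomorphically to $x=0$ by the value $\mu$ (with the same branch of the logarithm). Since $B$ and $g$ may be discontinuous, solutions of the ODE are absolutely continuous functions satisfying the equation almost everywhere (equivalently, the integral equation). *)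

theory Defs
  imports "HOL-Complex_Analysis.Complex_Analysis"
begin

text \<open>Functions on a time scale \<open>T\<close> are represented by functions on \<open>real\<close>; only their values
  on \<open>T\<close> enter the definitions.\<close>

definition time_scale :: "real set \<Rightarrow> bool" where
  "time_scale T \<longleftrightarrow> closed T \<and> \<not> bdd_below T \<and> \<not> bdd_above T \<and> 0 \<in> T"

definition sigma :: "real set \<Rightarrow> real \<Rightarrow> real" where
  "sigma T t = Inf {r \<in> T. r > t}"

definition mu :: "real set \<Rightarrow> real \<Rightarrow> real" where
  "mu T t = sigma T t - t"

definition right_dense :: "real set \<Rightarrow> real \<Rightarrow> bool" where
  "right_dense T t \<longleftrightarrow> mu T t = 0"

definition left_dense :: "real set \<Rightarrow> real \<Rightarrow> bool" where
  "left_dense T t \<longleftrightarrow> (\<forall>r\<in>T. sigma T r = t \<longrightarrow> r = t)"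

definition rd_continuous :: "real set \<Rightarrow> (real \<Rightarrow> 'a::topological_space) \<Rightarrow> bool" where
  "rd_continuous T x \<longleftrightarrow>
     (\<forall>t\<in>T. right_dense T t \<longrightarrow> continuous (at t within T) x) \<and>
     (\<forall>t\<in>T. left_dense T t \<longrightarrow> (\<exists>l. (x \<longlongrightarrow> l) (at t within T \<inter> {..<t})))"

definition has_delta_derivative ::
    "real set \<Rightarrow> (real \<Rightarrow> 'a::real_normed_vector) \<Rightarrow> 'a \<Rightarrow> real \<Rightarrow> bool" where
  "has_delta_derivative T x \<gamma> t \<longleftrightarrow>
     (\<forall>\<epsilon>>0. \<exists>W. open W \<and> t \<in> W \<and>
        (\<forall>r \<in> W \<inter> T.
           norm (x (sigma T t) - x r - (sigma T t - r) *\<^sub>R \<gamma>) \<le> \<epsilon> * \<bar>sigma T t - r\<bar>))"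

definition regressive :: "real set \<Rightarrow> (real \<Rightarrow> real^'n^'n) \<Rightarrow> bool" where
  "regressive T A \<longleftrightarrow> (\<forall>t\<in>T. invertible (mat 1 + mu T t *\<^sub>R A t))"

definition ts_solution ::
    "real set \<Rightarrow> (real \<Rightarrow> 'a \<Rightarrow> 'a) \<Rightarrow> (real \<Rightarrow> 'a::real_normed_vector) \<Rightarrow> bool" where
  "ts_solution T F x \<longleftrightarrow> (\<forall>t\<in>T. has_delta_derivative T x (F t (x t)) t)"

text \<open>The solution \<open>X\<close> is unique only on \<open>T\<close>, so the description picks its value at \<open>t\<close>, not \<open>X\<close>.\<close>

definition ts_cauchy_matrix ::
    "real set \<Rightarrow> (real \<Rightarrow> real^'n^'n) \<Rightarrow> real \<Rightarrow> real \<Rightarrow> real^'n^'n" where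
  "ts_cauchy_matrix T A t \<tau> =
     (THE M. \<exists>X. ts_solution T (\<lambda>u Y. A u ** Y) X \<and> X \<tau> = mat 1 \<and> M = X t)"

text \<open>The integral equation, with Lebesgue integrals: its solutions are exactly the absolutely
  continuous functions satisfying the differential equation almost everywhere.\<close>

definition ode_solution ::
    "(real \<Rightarrow> 'a \<Rightarrow> 'a) \<Rightarrow> (real \<Rightarrow> 'a::euclidean_space) \<Rightarrow> bool" where
  "ode_solution F x \<longleftrightarrow>
     (\<forall>a b. a \<le> b \<longrightarrow>
        (\<lambda>u. F u (x u)) absolutely_integrable_on {a..b} \<and>
        x b - x a = integral {a..b} (\<lambda>u. F u (x u)))"

definition ode_cauchy_matrix ::
    "(real \<Rightarrow> complex^'n^'n) \<Rightarrow> real \<Rightarrow> real \<Rightarrow> complex^'n^'n" where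
  "ode_cauchy_matrix B t \<tau> =
     (THE M. \<exists>X. ode_solution (\<lambda>u Y. B u ** Y) X \<and> X \<tau> = mat 1 \<and> M = X t)"

definition origin :: "real set \<Rightarrow> real" where
  "origin T = Inf (T \<inter> {0..})"

definition renorm_on :: "real set \<Rightarrow> real \<Rightarrow> real" where
  "renorm_on T t =
     (if origin T \<le> t
      then measure lebesgue ({origin T..t} \<inter> T)
           + infsum (\<lambda>\<tau>. ln (1 + mu T \<tau>)) {\<tau> \<in> {origin T..<t} \<inter> T. mu T \<tau> > 0}
      else - measure lebesgue ({t..origin T} \<inter> T)
           - infsum (\<lambda>\<tau>. ln (1 + mu T \<tau>)) {\<tau> \<in> {t..<origin T} \<inter> T. mu T \<tau> > 0})"

definition renorm :: "real set \<Rightarrow> real \<Rightarrow> real" where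
  "renorm T t =
     (if t \<in> T then renorm_on T t
      else if origin T \<le> t
      then (let t1 = Sup (T \<inter> {..t}) in renorm_on T t1 + ln (1 + t - t1))
      else (let t2 = Inf (T \<inter> {t..}) in renorm_on T t2 - ln (1 + t2 - t)))"

text \<open>\<open>continues_to \<gamma> \<phi> w\<close>: the germ of \<open>\<phi>\<close> at \<open>\<gamma> 0\<close> can be continued analytically along the
  path \<open>\<gamma>\<close>, and \<open>w\<close> is the value at \<open>\<gamma> 1\<close> of the resulting germ.  The function \<open>F t\<close> is the
  function element on the disc about \<open>\<gamma> t\<close>; by compactness of \<open>{0..1}\<close> a common radius is no
  restriction.\<close>

definition continues_to :: "(real \<Rightarrow> complex) \<Rightarrow> (complex \<Rightarrow> complex) \<Rightarrow> complex \<Rightarrow> bool" where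
  "continues_to \<gamma> \<phi> w \<longleftrightarrow>
     path \<gamma> \<and>
     (\<exists>F. \<exists>r>0.
        (\<forall>t\<in>{0..1}. F t holomorphic_on ball (\<gamma> t) r) \<and>
        (\<forall>t\<in>{0..1}. \<exists>\<delta>>0. \<forall>t'\<in>{0..1}. \<bar>t' - t\<bar> < \<delta> \<longrightarrow>
            (\<forall>z \<in> ball (\<gamma> t) r \<inter> ball (\<gamma> t') r. F t' z = F t z)) \<and>
        (\<forall>\<^sub>F z in nhds (\<gamma> 0). F 0 z = \<phi> z) \<and>
        w = F 1 (\<gamma> 1))"

text \<open>The side of the real axis on which the singular values are bypassed.\<close>

datatype side = Above | Below

fun side_sign :: "side \<Rightarrow> real" where
  "side_sign Above = 1"
| "side_sign Below = -1"

definition singular_values :: "complex^'n^'n \<Rightarrow> real \<Rightarrow> real set" where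
  "singular_values A m = {p. 0 < p \<and> p < m \<and> \<not> invertible (mat 1 + p *\<^sub>R A)}"

text \<open>For small \<open>\<epsilon>\<close> the contour runs from \<open>0\<close> to \<open>m\<close> along the real axis, except for a
  triangular detour of height \<open>\<epsilon>\<close> over \<open>[p - \<epsilon>, p + \<epsilon>]\<close> for each singular value \<open>p\<close>.\<close>

definition bypass_contour :: "side \<Rightarrow> complex^'n^'n \<Rightarrow> real \<Rightarrow> real \<Rightarrow> real \<Rightarrow> complex" where
  "bypass_contour d A m \<epsilon> v =
     Complex (m * v)
       (if singular_values A m = {} then 0
        else side_sign d * max 0 (\<epsilon> - infdist (m * v) (singular_values A m)))"

primrec matrix_power :: "'a::semiring_1^'n^'n \<Rightarrow> nat \<Rightarrow> 'a^'n^'n" where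
  "matrix_power A 0 = mat 1"
| "matrix_power A (Suc k) = A ** matrix_power A k"

text \<open>\<open>matrix_Ln d m A\<close> is \<open>Ln (E + m A)\<close>: each entry of the power series of \<open>Ln (E + z A)\<close>
  in \<open>z\<close> is continued from \<open>0\<close> to \<open>m\<close>.  The result does not depend on \<open>\<epsilon>\<close> once \<open>\<epsilon>\<close> is so small
  that the detours do not reach \<open>0\<close>, \<open>m\<close> or the nonreal singular values.\<close>

definition matrix_Ln :: "side \<Rightarrow> real \<Rightarrow> complex^'n^'n \<Rightarrow> complex^'n^'n" where
  "matrix_Ln d m A =
     (THE L. \<forall>\<^sub>F \<epsilon> in at_right 0. \<forall>i j.
        continues_to (bypass_contour d A m \<epsilon>)
          (\<lambda>z. \<Sum>k. (-1) ^ k * z ^ Suc k / of_nat (Suc k) * matrix_power A (Suc k) $ i $ j)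
          (L $ i $ j))"

definition spectrum_of :: "complex^'n^'n \<Rightarrow> complex set" where
  "spectrum_of A = {x. \<not> invertible (A - mat x)}"

definition poly_matrix :: "complex poly \<Rightarrow> complex^'n^'n \<Rightarrow> complex^'n^'n" where
  "poly_matrix p A = (\<Sum>k\<le>degree p. mat (coeff p k) ** matrix_power A k)"

text \<open>The value \<open>h(A)\<close> of a function \<open>h\<close> holomorphic near the spectrum of \<open>A\<close>: it is \<open>p(A)\<close> for
  any polynomial \<open>p\<close> whose derivatives of order less than the algebraic multiplicity agree with those
  of \<open>h\<close> at each eigenvalue.  Requiring agreement up to order \<open>CARD('n) - 1\<close> bounds all
  multiplicities at once and yields the same matrix.\<close>

definition matrix_fun_value ::
    "(complex \<Rightarrow> complex) \<Rightarrow> complex^'n^'n \<Rightarrow> complex^'n^'n \<Rightarrow> bool" where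
  "matrix_fun_value h A M \<longleftrightarrow>
     h analytic_on spectrum_of A \<and>
     (\<exists>p. (\<forall>x \<in> spectrum_of A. \<forall>j < CARD('n).
              poly ((pderiv ^^ j) p) x = (deriv ^^ j) h x) \<and>
          M = poly_matrix p A)"

text \<open>The branch of \<open>ln (1 + m x)\<close>, \<open>m = \<gamma> 1\<close>, continued along \<open>\<gamma>\<close> from the value \<open>0\<close>.\<close>

definition ln_along :: "(real \<Rightarrow> complex) \<Rightarrow> complex \<Rightarrow> complex" where
  "ln_along \<gamma> x = (THE w. continues_to \<gamma> (\<lambda>z. Ln (1 + z * x)) w)"

text \<open>\<open>inverse_matrix_Ln d m A\<close> is \<open>A\<inverse> Ln (E + m A)\<close>, also for singular \<open>A\<close>.\<close>

definition inverse_matrix_Ln :: "side \<Rightarrow> real \<Rightarrow> complex^'n^'n \<Rightarrow> complex^'n^'n" where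
  "inverse_matrix_Ln d m A =
     (THE M. \<forall>\<^sub>F \<epsilon> in at_right 0.
        matrix_fun_value
          (\<lambda>x. if x = 0 then of_real m else ln_along (bypass_contour d A m \<epsilon>) x / x) A M)"

definition cmat :: "real^'n^'m \<Rightarrow> complex^'n^'m" where
  "cmat = map_matrix complex_of_real"

definition cvec :: "real^'n \<Rightarrow> complex^'n" where
  "cvec x = (\<chi> i. complex_of_real (x $ i))"

end

theory Submission
  imports Defs
begin

text \<open>Along a gap of length \<open>\<mu>\<close> after \<open>\<theta>\<close>, with the time rescaled to \<open>[0, 1]\<close>, the equation reads
  \<open>y' = L y + M f\<close> with \<open>L = Ln (E + \<mu> A)\<close> and \<open>M A = L\<close>. The matrix \<open>G v\<close> that solves \<open>G' = L G + M\<close>,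
  \<open>G 0 = 0\<close>, ends at \<open>G 1 = \<mu> E\<close>: hence crossing the gap takes \<open>x\<close> to \<open>x + \<mu> (A x + f)\<close>, which is the
  dynamic equation at \<open>\<theta>\<close>. Short gaps have \<open>L / ln (1 + \<mu>)\<close> close to \<open>A\<close> uniformly, and \<open>s\<close> has slope
  close to one near a right-dense point, so the restriction to \<open>T\<close> of a solution of the differential
  equation solves the dynamic equation at right-dense points as well. Both initial value problems
  are uniquely solvable (the dynamic one because \<open>A\<close> is regressive), so the fundamental matrices
  agree and every solution on \<open>T\<close> arises by restriction.

  The identities for \<open>G\<close>, \<open>L\<close> and \<open>M\<close> are polynomial identities in \<open>A\<close>: continuation along the contour
  gives the logarithm cut along a vertical ray that the contour does not meet, and a function of
  \<open>A\<close> depends only on the jets of that branch at the eigenvalues.\<close>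

subsection \<open>Polynomials in a matrix\<close>

text \<open>The logarithm and its quotient by \<open>A\<close> are defined in different ways: the
  former by continuing a power series in \<open>z\<close>, entry by entry; the latter by functional
  calculus in \<open>x\<close>. Polynomials that interpolate one choice of branch of
  \<open>ln (1 + m x)\<close> are the common ground: both matrices are values at \<open>A\<close> of
  such polynomials, and relations between them become divisibility by powers of \<open>X - x\<close>
  at the eigenvalues \<open>x\<close>. The branch may change from eigenvalue to eigenvalue, so jets
  of separate germs are glued by the Chinese remainder theorem. A singular \<open>A\<close> rules
  out defining \<open>G\<close> as a quotient; it is built from integrals of exponentials instead.
  No existence theorem is proved on \<open>T\<close> directly: solutions there are restrictions of
  Caratheodory solutions, and real ones are recovered from complex ones as real parts. The equations
  for vectors and for fundamental matrices are two instances of one equation in which matrices act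
  on a Euclidean space.\<close>

lemma mat_mult_mult: "mat a ** (mat b ** M) = mat (a * b) ** (M::'a::comm_semiring_1^'m^'n)"
  by (simp add: matrix_matrix_mult_def mat_def vec_eq_iff if_distrib if_distribR sum.delta mult.assoc cong: if_cong)

lemma mat_add: "mat (a + b) = mat a + (mat b::'a::monoid_add^'n^'n)"
  by (simp add: mat_def vec_eq_iff)

lemma mat_mult_nth: "(mat c ** M) $ i $ j = c * (M $ i $ j :: 'a::semiring_1)"
  by (simp add: matrix_matrix_mult_def mat_def if_distrib if_distribR sum.delta cong: if_cong)

lemma mat_mult_commute: "mat c ** M = M ** mat (c::'a::comm_semiring_1)"
  by (simp add: vec_eq_iff mat_mult_nth) (simp add: matrix_matrix_mult_def mat_def if_distrib if_distribR sum.delta mult.commute cong: if_cong)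

lemma mat_vec: "mat c *v v = c *s (v::'a::semiring_1^'n)"
  by (simp add: vec_eq_iff matrix_vector_mult_def mat_def if_distrib if_distribR sum.delta cong: if_cong)

lemma matrix_add_rdistrib: "(A + B) ** C = A ** C + B ** (C::'a::semiring_1^'p^'m)"
  by (simp add: matrix_matrix_mult_def vec_eq_iff distrib_right sum.distrib)

lemma matrix_mul_mat_left: "A ** (mat c ** M) = mat c ** (A ** (M::'a::comm_semiring_1^'p^'m))"
  by (metis mat_mult_commute matrix_mul_assoc)

lemma matrix_mul_sum_right: "A ** (\<Sum>i\<in>I. f i) = (\<Sum>i\<in>I. A ** f i)"
  by (induction I rule: infinite_finite_induct) (simp_all add: matrix_add_ldistrib)

lemma poly_matrix_altdef:
  assumes "degree p \<le> N"
  shows "poly_matrix p A = (\<Sum>k\<le>N. mat (coeff p k) ** matrix_power A k)"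
  unfolding poly_matrix_def
  by (rule sum.mono_neutral_left) (use assms in \<open>auto simp: coeff_eq_0\<close>)

lemma poly_matrix_0 [simp]: "poly_matrix 0 A = 0"
  by (simp add: poly_matrix_def)

lemma poly_matrix_pCons: "poly_matrix (pCons a p) A = mat a + A ** poly_matrix p A"
proof -
  have "poly_matrix (pCons a p) A
      = (\<Sum>k\<le>Suc (degree p). mat (coeff (pCons a p) k) ** matrix_power A k)"
    by (rule poly_matrix_altdef) (simp add: degree_pCons_le)
  also have "\<dots> = mat a + (\<Sum>k\<le>degree p. mat (coeff p k) ** (A ** matrix_power A k))"
    by (subst sum.atMost_Suc_shift) simp
  also have "\<dots> = mat a + (\<Sum>k\<le>degree p. A ** (mat (coeff p k) ** matrix_power A k))"
    by (simp add: matrix_mul_mat_left)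
  finally show ?thesis
    by (simp add: poly_matrix_def matrix_mul_sum_right)
qed

lemma poly_matrix_add: "poly_matrix (p + q) A = poly_matrix p A + poly_matrix q A"
  by (induction p q rule: poly_induct2) (simp_all add: poly_matrix_pCons mat_add matrix_add_ldistrib)

lemma poly_matrix_smult: "poly_matrix (smult c p) A = mat c ** poly_matrix p A"
  by (induction p) (simp_all add: poly_matrix_pCons matrix_add_ldistrib matrix_mul_mat_left
      mat_mult_mult[of c _ "mat 1", simplified])

lemma poly_matrix_diff: "poly_matrix (p - q) A = poly_matrix p A - poly_matrix q A"
  using poly_matrix_add[of "p - q" q A] by simp

lemma poly_matrix_mult: "poly_matrix (p * q) A = poly_matrix p A ** poly_matrix q A"
  by (induction p) (simp_all add: poly_matrix_pCons poly_matrix_add poly_matrix_smult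
      matrix_add_rdistrib matrix_mul_assoc)

lemma poly_matrix_const [simp]: "poly_matrix [:c:] A = mat c"
  by (simp add: poly_matrix_pCons)

lemma poly_matrix_linear [simp]: "poly_matrix [:a, 1:] A = mat a + A"
  by (simp add: poly_matrix_pCons)

lemma poly_matrix_monom: "poly_matrix (monom c k) A = mat c ** matrix_power A k"
  by (induction k) (simp_all add: monom_0 monom_Suc poly_matrix_pCons matrix_mul_mat_left)

lemma poly_matrix_sum: "poly_matrix (\<Sum>i\<in>I. f i) A = (\<Sum>i\<in>I. poly_matrix (f i) A)"
  by (induction I rule: infinite_finite_induct) (simp_all add: poly_matrix_add)

lemma poly_matrix_commute: "poly_matrix p A ** poly_matrix q A = poly_matrix q A ** poly_matrix p A"
  by (metis poly_matrix_mult mult.commute)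

lemma poly_matrix_commute_self: "poly_matrix p A ** A = A ** poly_matrix p A"
  using poly_matrix_commute[of p A "[:0, 1:]"] by simp

lemma poly_matrix_mult_vec: "poly_matrix (p * q) A *v u = poly_matrix p A *v (poly_matrix q A *v u)"
  by (simp add: poly_matrix_mult matrix_vector_mul_assoc)

text \<open>The \<open>n + 1\<close> vectors \<open>u\<close>, \<open>A u\<close>, ...,
  \<open>A^n u\<close> lie in an \<open>n\<close>-dimensional space and hence satisfy a linear
  relation, whose coefficients are those of \<open>q\<close>.\<close>

lemma ex_annihilating_poly_vec:
  fixes A :: "complex^'n^'n"
  shows "\<exists>q. q \<noteq> 0 \<and> degree q \<le> CARD('n) \<and> poly_matrix q A *v u = 0"
proof -
  let ?n = "CARD('n)"
  define b where "b k = matrix_power A k *v u" for k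
  have pm: "poly_matrix (monom c k) A *v u = c *s b k" for c k
    by (simp add: poly_matrix_monom b_def vec_eq_iff matrix_vector_mul_assoc[symmetric])
       (simp add: matrix_vector_mult_def mat_def if_distrib if_distribR sum.delta cong: if_cong)
  \<comment> \<open>Linear dependence is a property of the set of these vectors, so a repetition
    \<open>A^i u = A^j u\<close> is treated apart; it gives \<open>X^i - X^j\<close>.\<close>
  show ?thesis
  proof (cases "inj_on b {..?n}")
    case False
    then obtain i j where ij: "i \<le> ?n" "j \<le> ?n" "i \<noteq> j" "b i = b j"
      by (auto simp: inj_on_def)
    let ?q = "monom 1 i - monom 1 j :: complex poly"
    have "monom (1::complex) i \<noteq> monom 1 j" using ij(3) by (metis degree_monom_eq one_neq_zero)
    then have "?q \<noteq> 0" by auto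
    moreover have "degree ?q \<le> ?n"
      using ij by (intro degree_diff_le) (auto intro: order_trans[OF degree_monom_le])
    moreover have "poly_matrix ?q A *v u = 0"
      using ij by (simp add: poly_matrix_diff matrix_vector_mult_diff_rdistrib pm)
    ultimately show ?thesis by blast
  next
    case True
    have "vec.dependent (b ` {..?n})"
    proof (rule ccontr)
      assume "vec.independent (b ` {..?n})"
      from vec.independent_card_le_dim[OF subset_UNIV this]
      show False using card_image[OF True] by (simp add: vec_dim_card[unfolded vec.dimension_def] card_cart_basis)
    qed
    then obtain r where r: "\<exists>v\<in>b ` {..?n}. r v \<noteq> 0" "(\<Sum>v\<in>b ` {..?n}. r v *s v) = 0"
      unfolding vec.dependent_finite[OF finite_imageI[OF finite_atMost]] by auto
    define q where "q = (\<Sum>k\<le>?n. monom (r (b k)) k)"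
    have co: "coeff q k = (if k \<le> ?n then r (b k) else 0)" for k
      by (simp add: q_def coeff_sum if_distrib cong: if_cong)
    obtain k where "k \<le> ?n" "r (b k) \<noteq> 0" using r(1) by auto
    then have "q \<noteq> 0" using co[of k] by auto
    moreover have "degree q \<le> ?n" by (rule degree_le) (simp add: co)
    moreover have "poly_matrix q A *v u = 0"
    proof -
      have "poly_matrix q A *v u = (\<Sum>k\<le>?n. poly_matrix (monom (r (b k)) k) A *v u)"
        unfolding q_def poly_matrix_sum
        by (induction rule: finite_induct[OF finite_atMost]) (simp_all add: matrix_vector_mult_add_rdistrib)
      also have "\<dots> = (\<Sum>v\<in>b ` {..?n}. r v *s v)"
        by (simp add: pm sum.reindex[OF True])
      finally show ?thesis using r(2) by simp
    qed
    ultimately show ?thesis by blast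
  qed
qed

lemma spectrum_eigenvector:
  assumes "x \<in> spectrum_of A"
  obtains v where "v \<noteq> 0" "A *v v = x *s v"
proof -
  have "\<not> invertible (A - mat x)" using assms by (simp add: spectrum_of_def)
  then obtain v where "v \<noteq> 0" "(A - mat x) *v v = 0"
    unfolding invertible_left_inverse matrix_left_invertible_ker by auto
  moreover have "mat x *v v = x *s v" by (rule mat_vec)
  ultimately show ?thesis by (intro that[of v]) (simp_all add: matrix_vector_mult_diff_rdistrib)
qed

lemma poly_matrix_eigenvector:
  assumes "A *v v = x *s v"
  shows "poly_matrix p A *v v = poly p x *s v"
proof (induction p)
  case (pCons a p)
  have "mat a *v v = a *s v" by (rule mat_vec)
  moreover have "A *v (poly p x *s v) = (poly p x * x) *s v"
    using assms by (metis vec.scale vec.scale_scale)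
  ultimately show ?case
    by (simp add: poly_matrix_pCons matrix_vector_mult_add_rdistrib matrix_vector_mul_assoc[symmetric] pCons
        vec.scale_left_distrib mult.commute)
qed auto

lemma matrix_eqI_axis:
  assumes "\<And>i. M *v axis i 1 = N *v axis i (1::'a::comm_semiring_1)"
  shows "M = N"
proof -
  have "column i M = column i N" for i
    using assms[of i] by (simp add: column_def vec_eq_iff matrix_vector_mult_def axis_def if_distrib sum.delta cong: if_cong)
  then show ?thesis by (simp add: vec_eq_iff column_def)
qed

text \<open>The product of annihilators of the basis vectors kills all of them. Its degree is not
  controlled; its purpose is the finiteness of the spectrum.\<close>

lemma ex_annihilating_poly:
  fixes A :: "complex^'n^'n"
  shows "\<exists>q. q \<noteq> 0 \<and> poly_matrix q A = 0"
proof -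
  obtain q where q: "\<And>u. q u \<noteq> 0 \<and> poly_matrix (q u) A *v u = 0"
    using ex_annihilating_poly_vec[of A] by metis
  define P where "P = (\<Prod>i\<in>UNIV. q (axis (i::'n) 1))"
  have "P \<noteq> 0" unfolding P_def using q by simp
  moreover have "poly_matrix P A = 0"
  proof (rule matrix_eqI_axis)
    fix i :: 'n
    have "P = (\<Prod>j\<in>UNIV-{i}. q (axis j 1)) * q (axis i 1)"
      unfolding P_def by (subst prod.remove[of _ i]) (simp_all add: mult.commute)
    then show "poly_matrix P A *v axis i 1 = 0 *v axis i 1"
      using q by (simp add: poly_matrix_mult_vec)
  qed
  ultimately show ?thesis by blast
qed

text \<open>Eigenvalues are roots of any annihilating polynomial.\<close>

lemma finite_spectrum_of: "finite (spectrum_of A)"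
proof -
  obtain q where q: "q \<noteq> 0" "poly_matrix q A = 0" using ex_annihilating_poly by blast
  have "poly q x = 0" if x: "x \<in> spectrum_of A" for x
  proof -
    obtain v where "v \<noteq> 0" "A *v v = x *s v" by (rule spectrum_eigenvector[OF x])
    then show ?thesis using poly_matrix_eigenvector[of A v x q] q(2) by simp
  qed
  then have "spectrum_of A \<subseteq> {x. poly q x = 0}" by auto
  then show ?thesis using poly_roots_finite[OF q(1)] by (rule finite_subset)
qed

text \<open>\<open>A - x\<close> is invertible off the spectrum, so an annihilator of a vector can
  be freed of every root that is not an eigenvalue.\<close>

lemma poly_matrix_factor_cancel:
  assumes "x \<notin> spectrum_of A" and "poly_matrix ([:-x, 1:] * q) A *v u = 0"
  shows "poly_matrix q A *v u = 0"
proof -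
  have "invertible (A - mat x)" using assms(1) by (simp add: spectrum_of_def)
  then obtain R where R: "R ** (A - mat x) = mat 1" by (auto simp: invertible_def)
  have "mat (-x) + A = A - mat x" by (simp add: vec_eq_iff mat_def)
  then have "(A - mat x) *v (poly_matrix q A *v u) = 0"
    using assms(2) by (simp add: poly_matrix_mult_vec del: mult_pCons_left)
  then have "(R ** (A - mat x)) *v (poly_matrix q A *v u) = 0"
    by (metis matrix_vector_mul_assoc matrix_vector_mult_0_right)
  then show ?thesis using R by simp
qed

text \<open>The roots form a multiset so that those outside the spectrum can be filtered out later
  while multiplicities stay counted.\<close>

lemma poly_complex_factorization:
  fixes p :: "complex poly"
  assumes "p \<noteq> 0"
  shows "\<exists>X. size X = degree p \<and> p = smult (lead_coeff p) (\<Prod>x\<in>#X. [:-x, 1:])"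
  using assms
proof (induction "degree p" arbitrary: p)
  case 0
  then obtain c where "p = [:c:]" by (metis degree_eq_zeroE)
  then show ?case by (intro exI[of _ "{#}"]) simp
next
  case (Suc n)
  have "coeff p (degree p) \<noteq> 0" "degree p \<in> {1..degree p}"
    using Suc.prems Suc.hyps(2) by auto
  then obtain z where "(\<Sum>i\<le>degree p. coeff p i * z ^ i) = 0"
    using fundamental_theorem_of_algebra[of "coeff p" "degree p"] by blast
  then have "poly p z = 0" by (simp add: poly_altdef)
  then obtain q where q: "p = [:-z, 1:] * q" by (metis poly_eq_0_iff_dvd dvdE)
  have "q \<noteq> 0" using q Suc.prems by auto
  then have dq: "degree p = Suc (degree q)" unfolding q by (subst degree_mult_eq) auto
  have lq: "lead_coeff p = lead_coeff q" unfolding q by (simp only: lead_coeff_mult) simp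
  have "n = degree q" using dq Suc.hyps(2) by simp
  from Suc.hyps(1)[OF this \<open>q \<noteq> 0\<close>] obtain X
    where X: "size X = degree q" "q = smult (lead_coeff q) (\<Prod>x\<in>#X. [:-x, 1:])" by blast
  have "p = [:-z, 1:] * smult (lead_coeff p) (\<Prod>x\<in>#X. [:-x, 1:])"
    using q X(2) lq by metis
  also have "\<dots> = smult (lead_coeff p) (\<Prod>x\<in>#add_mset z X. [:-x, 1:])"
    by (simp only: mult_smult_right image_mset_add_mset prod_mset.add_mset)
  finally show ?case using X(1) dq by (metis size_add_mset)
qed

text \<open>Only degree \<open>CARD('n)\<close> annihilators of single vectors enter, so every exponent is at most
  \<open>CARD('n)\<close> and no characteristic polynomial is needed.\<close>

lemma poly_matrix_spectrum_prod:
  fixes A :: "complex^'n^'n"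
  shows "poly_matrix (\<Prod>x\<in>spectrum_of A. [:-x, 1:] ^ CARD('n)) A = 0"
proof (rule matrix_eqI_axis)
  fix i :: 'n
  let ?u = "axis i 1 :: complex^'n"
  let ?J = "\<Prod>x\<in>spectrum_of A. [:-x, 1:] ^ CARD('n)"
  \<comment> \<open>The spare factor \<open>r\<close> collects the eigenvalue factors already split
    off, so the induction can treat the roots in any order.\<close>
  have key: "poly_matrix ((\<Prod>x\<in>#filter_mset (\<lambda>x. x \<in> spectrum_of A) X. [:-x, 1:]) * r) A *v ?u = 0"
    if "poly_matrix ((\<Prod>x\<in>#X. [:-x, 1:]) * r) A *v ?u = 0" for X r
    using that
  proof (induction X arbitrary: r)
    case (add x X)
    show ?case
    proof (cases "x \<in> spectrum_of A")
      case True
      have "poly_matrix ((\<Prod>x\<in>#X. [:-x, 1:]) * ([:-x, 1:] * r)) A *v ?u = 0"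
        using add.prems by (simp only: image_mset_add_mset prod_mset.add_mset mult_ac)
      from add.IH[OF this] show ?thesis using True
        by (simp only: filter_mset_add_mset if_True image_mset_add_mset prod_mset.add_mset mult_ac)
    next
      case False
      have "poly_matrix ([:-x, 1:] * ((\<Prod>x\<in>#X. [:-x, 1:]) * r)) A *v ?u = 0"
        using add.prems by (simp only: image_mset_add_mset prod_mset.add_mset mult_ac)
      from poly_matrix_factor_cancel[OF False this] show ?thesis using False add.IH by simp
    qed
  qed simp
  obtain q where q: "q \<noteq> 0" "degree q \<le> CARD('n)" "poly_matrix q A *v ?u = 0"
    using ex_annihilating_poly_vec by blast
  obtain X where X: "size X = degree q" "q = smult (lead_coeff q) (\<Prod>x\<in>#X. [:-x, 1:])"
    using poly_complex_factorization[OF q(1)] by blast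
  have "poly_matrix (smult (inverse (lead_coeff q)) q) A *v ?u = 0"
    using q(3) by (simp add: poly_matrix_smult matrix_vector_mul_assoc[symmetric])
  also have "smult (inverse (lead_coeff q)) q = (\<Prod>x\<in>#X. [:-x, 1:])"
    using arg_cong[OF X(2), of "smult (inverse (lead_coeff q))"] q(1) by simp
  finally have z: "poly_matrix ((\<Prod>x\<in>#filter_mset (\<lambda>x. x \<in> spectrum_of A) X. [:-x, 1:])) A *v ?u = 0"
    using key[of X 1] by simp
  let ?Y = "filter_mset (\<lambda>x. x \<in> spectrum_of A) X"
  have "(\<Prod>x\<in>#?Y. [:-x, 1:]) = (\<Prod>x\<in>set_mset ?Y. [:-x, 1:] ^ count ?Y x)"
    by (rule image_prod_mset_multiplicity)
  also have "\<dots> = (\<Prod>x\<in>spectrum_of A. [:-x, 1:] ^ count ?Y x)"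
  proof (rule prod.mono_neutral_left)
    show "\<forall>x\<in>spectrum_of A - set_mset ?Y. [:-x, 1:] ^ count ?Y x = 1"
      by (metis DiffD2 count_eq_zero_iff power_0)
  qed (auto simp: finite_spectrum_of)
  \<comment> \<open>A root occurs at most \<open>degree q\<close> times, and \<open>degree q\<close>
    is at most \<open>CARD('n)\<close>.\<close>
  also have "\<dots> dvd ?J"
  proof (rule prod_dvd_prod)
    fix x
    have "count ?Y x \<le> size X"
      by (meson count_le_size le_trans size_filter_mset_lesseq)
    then show "[:-x, 1:] ^ count ?Y x dvd [:-x, 1:] ^ CARD('n)"
      using X(1) q(2) by (intro le_imp_power_dvd) simp
  qed
  finally obtain r where "?J = (\<Prod>x\<in>#?Y. [:-x, 1:]) * r" by (rule dvdE)
  then have "?J = r * (\<Prod>x\<in>#?Y. [:-x, 1:])" by (simp only: mult.commute)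
  then have "poly_matrix ?J A *v ?u = 0" using z by (simp only: poly_matrix_mult_vec matrix_vector_mult_0_right)
  then show "poly_matrix ?J A *v ?u = 0 *v ?u" by simp
qed

section \<open>Bezout identities and the Chinese remainder theorem for polynomials\<close>

definition comaximal :: "'a::comm_ring_1 \<Rightarrow> 'a \<Rightarrow> bool" where
  "comaximal p q \<longleftrightarrow> (\<exists>a b. a * p + b * q = 1)"

text \<open>The product of the two Bezout identities is one for \<open>p\<close> and
  \<open>q * r\<close>.\<close>

lemma comaximal_mult_right:
  assumes "comaximal p q" "comaximal p r"
  shows "comaximal p (q * r)"
proof -
  obtain a b c d where "a * p + b * q = 1" "c * p + d * r = 1"
    using assms by (auto simp: comaximal_def)
  then have "(a * p + b * q) * (c * p + d * r) = 1" by simp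
  then have "(a * c * p + a * d * r + b * q * c) * p + (b * d) * (q * r) = 1"
    by (simp add: algebra_simps)
  then show ?thesis by (auto simp: comaximal_def)
qed

lemma comaximal_sym: "comaximal p q \<Longrightarrow> comaximal q p"
  by (metis add.commute comaximal_def)

lemma comaximal_1: "comaximal p 1"
  unfolding comaximal_def by (rule exI[of _ 0], rule exI[of _ 1]) simp

lemma comaximal_power_right: "comaximal p q \<Longrightarrow> comaximal p (q ^ n)"
  by (induction n) (simp_all add: comaximal_1 comaximal_mult_right)

lemma comaximal_prod_right: "(\<And>x. x \<in> S \<Longrightarrow> comaximal p (f x)) \<Longrightarrow> comaximal p (prod f S)"
  by (induction S rule: infinite_finite_induct) (simp_all add: comaximal_1 comaximal_mult_right)

lemma comaximal_linear_power:
  assumes "x \<noteq> (y::'a::field)"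
  shows "comaximal ([:-x, 1:] ^ m) ([:-y, 1:] ^ n)"
proof -
  \<comment> \<open>The difference \<open>(X - x) - (X - y)\<close> is the constant
    \<open>y - x\<close>.\<close>
  have "[:1 / (y - x):] * [:-x, 1:] + [:-1 / (y - x):] * [:-y, 1:] = 1"
  proof -
    have "1 / (y - x) * (- x) + (-1 / (y - x)) * (- y) = (y - x) / (y - x)"
      by (simp only: diff_divide_distrib) simp
    also have "(y - x) / (y - x) = 1" using assms by simp
    finally have "1 / (y - x) * (- x) + (-1 / (y - x)) * (- y) = 1" .
    then show ?thesis by (simp del: divide_minus_left) (simp add: one_pCons)
  qed
  then have "comaximal [:-x, 1:] [:-y, 1:]" unfolding comaximal_def by blast
  then show ?thesis by (intro comaximal_power_right comaximal_sym[OF comaximal_power_right] comaximal_sym[of "[:-x, 1:]"])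
qed

text \<open>Multiplying the Bezout identity by \<open>r\<close> gives
  \<open>r = a p r + b q r\<close>; in each summand one factor is visible and the other divides
  \<open>r\<close>.\<close>

lemma comaximal_mult_dvd:
  assumes "comaximal p q" "p dvd r" "q dvd r"
  shows "p * q dvd r"
proof -
  obtain a b where "a * p + b * q = 1" using assms(1) by (auto simp: comaximal_def)
  then have "r = r * (a * p + b * q)" by simp
  also have "\<dots> = a * (p * r) + b * (r * q)" by (simp add: algebra_simps)
  also have "p * q dvd \<dots>" using assms(2,3) by (intro dvd_add dvd_mult mult_dvd_mono) auto
  finally show ?thesis .
qed

lemma comaximal_prod_dvd:
  assumes "finite S" "\<And>x y. x \<in> S \<Longrightarrow> y \<in> S \<Longrightarrow> x \<noteq> y \<Longrightarrow> comaximal (f x) (f y)"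
    and "\<And>x. x \<in> S \<Longrightarrow> f x dvd r"
  shows "prod f S dvd r"
  using assms
proof (induction S rule: finite_induct)
  case (insert x S)
  then have "comaximal (f x) (prod f S)" by (intro comaximal_prod_right) auto
  then show ?case using insert by (simp add: comaximal_mult_dvd)
qed simp

text \<open>The moduli \<open>(X - x)^n\<close> at the eigenvalues are pairwise comaximal, and their
  product annihilates \<open>A\<close>. This turns identities between matrices into local
  divisibility statements.\<close>

lemma poly_matrix_cong:
  fixes A :: "complex^'n^'n"
  assumes "\<And>x. x \<in> spectrum_of A \<Longrightarrow> [:-x, 1:] ^ CARD('n) dvd p - q"
  shows "poly_matrix p A = poly_matrix q A"
proof -
  have "(\<Prod>x\<in>spectrum_of A. [:-x, 1:] ^ CARD('n)) dvd p - q"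
    by (intro comaximal_prod_dvd finite_spectrum_of assms comaximal_linear_power) auto
  then obtain r where "p - q = (\<Prod>x\<in>spectrum_of A. [:-x, 1:] ^ CARD('n)) * r" by (elim dvdE)
  then have "poly_matrix (p - q) A = 0"
    by (simp add: poly_matrix_mult poly_matrix_spectrum_prod)
  then show ?thesis by (simp add: poly_matrix_diff)
qed

text \<open>Chinese remainder theorem, by induction on the points; \<open>t x\<close> is the
  prescribed residue at \<open>x\<close>.\<close>

lemma poly_interpolate_jets:
  assumes "finite S"
  shows "\<exists>p. \<forall>x\<in>S. [:-x, 1:] ^ N dvd p - (t x :: 'a::field poly)"
  using assms
proof (induction S rule: finite_induct)
  case (insert y S)
  then obtain p where p: "\<And>x. x \<in> S \<Longrightarrow> [:-x, 1:] ^ N dvd p - t x" by blast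
  define J where "J = (\<Prod>x\<in>S. [:-x, 1:] ^ N)"
  have "comaximal J ([:-y, 1:] ^ N)"
    unfolding J_def using insert.hyps
    by (intro comaximal_sym[OF comaximal_prod_right] comaximal_linear_power) auto
  then obtain a b where ab: "a * J + b * [:-y, 1:] ^ N = 1" by (auto simp: comaximal_def)
  \<comment> \<open>By the Bezout identity \<open>a * J\<close> is \<open>1\<close> modulo the new
    modulus and \<open>0\<close> modulo the old ones, so the correction changes the residue at
    \<open>y\<close> only.\<close>
  define p' where "p' = p + (t y - p) * a * J"
  have "[:-x, 1:] ^ N dvd p' - t x" if "x \<in> S" for x
  proof -
    have "[:-x, 1:] ^ N dvd J" unfolding J_def using insert.hyps(1) that by (rule dvd_prodI)
    then have "[:-x, 1:] ^ N dvd (p - t x) + (t y - p) * a * J" using p[OF that] by simp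
    then show ?thesis by (simp add: p'_def algebra_simps)
  qed
  moreover have "p' - t y = [:-y, 1:] ^ N * (- (t y - p) * b)"
  proof -
    have "a * J = 1 - b * [:-y, 1:] ^ N" using ab by (simp add: algebra_simps)
    then have "p' - t y = p + (t y - p) * (1 - b * [:-y, 1:] ^ N) - t y"
      unfolding p'_def by (simp add: mult.assoc)
    then show ?thesis by (simp add: algebra_simps)
  qed
  ultimately have "\<forall>x\<in>insert y S. [:-x, 1:] ^ N dvd p' - t x" by auto
  then show ?case by blast
qed simp

subsection \<open>Jets at the eigenvalues\<close>

text \<open>The value at \<open>x\<close> is \<open>0\<close>, a linear factor splits off, and the
  quotient satisfies the estimate of one order less. This brings analytic estimates into the algebra
  of \<open>poly_matrix\<close>.\<close>

lemma bigo_poly_imp_dvd: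
  fixes r :: "complex poly"
  assumes "poly r \<in> O[at x](\<lambda>z. (z - x) ^ N)"
  shows "[:-x, 1:] ^ N dvd r"
  using assms
proof (induction N arbitrary: r)
  case (Suc N)
  obtain c where c: "eventually (\<lambda>z. norm (poly r z) \<le> c * norm ((z - x) ^ Suc N)) (at x)"
    using Suc.prems by (elim landau_o.bigE)
  have "((\<lambda>z. c * norm ((z - x) ^ Suc N)) \<longlongrightarrow> c * norm ((x - x) ^ Suc N)) (at x)"
    by (intro tendsto_intros)
  then have "(poly r \<longlongrightarrow> 0) (at x)"
    by (intro Lim_null_comparison[OF c]) (simp only: diff_self power_Suc mult_zero_left norm_zero mult_zero_right)
  moreover have "(poly r \<longlongrightarrow> poly r x) (at x)"
    by (intro tendsto_intros)
  ultimately have "poly r x = 0" by (rule LIM_unique[symmetric])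
  then obtain q where q: "r = [:-x, 1:] * q" unfolding poly_eq_0_iff_dvd by (elim dvdE)
  have "eventually (\<lambda>z. norm (poly q z) \<le> c * norm ((z - x) ^ N)) (at x)"
    using c eventually_neq_at_within[of x x UNIV]
  proof eventually_elim
    case (elim z)
    have "norm (z - x) * norm (poly q z) \<le> norm (z - x) * (c * norm ((z - x) ^ N))"
    proof -
      have "poly r z = (z - x) * poly q z" unfolding q poly_mult by simp
      then have "norm (poly r z) = norm (z - x) * norm (poly q z)" by (simp only: norm_mult)
      moreover have "c * norm ((z - x) ^ Suc N) = norm (z - x) * (c * norm ((z - x) ^ N))"
        unfolding power_Suc norm_mult by (rule mult.left_commute)
      ultimately show ?thesis using elim(1) by metis
    qed
    then show ?case using elim(2) by simp
  qed
  then have "[:-x, 1:] ^ N dvd q" by (intro Suc.IH bigoI)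
  then show ?case unfolding q power_Suc by (rule mult_dvd_mono[OF dvd_refl])
qed (simp only: power_0 one_dvd)

lemma deriv_funpow_poly: "(deriv ^^ j) (poly p) = poly ((pderiv ^^ j) (p::complex poly))"
proof (induction j)
  case (Suc j)
  have "deriv (poly q) = poly (pderiv q)" for q :: "complex poly"
    by (rule ext) (rule DERIV_imp_deriv[OF poly_DERIV])
  then show ?case using Suc by simp
qed simp

lemma analytic_on_poly: "poly p analytic_on (S :: complex set)"
proof -
  have "poly p holomorphic_on UNIV" by (intro holomorphic_intros)
  then show ?thesis by (meson analytic_on_open analytic_on_subset open_UNIV subset_UNIV)
qed

lemma taylor_bigo:
  fixes h :: "complex \<Rightarrow> complex"
  assumes "h analytic_on {x}"
  shows "(\<lambda>z. h z - poly (\<Sum>j<N. smult ((deriv ^^ j) h x / fact j) ([:-x, 1:] ^ j)) z) \<in> O[at x](\<lambda>z. (z - x) ^ N)"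
proof (cases N)
  case 0
  have "isCont h x" using assms analytic_at_imp_isCont by blast
  then show ?thesis using 0 by (simp add: isCont_def continuous_imp_bigo_1 continuous_at_imp_continuous_within)
next
  case (Suc n)
  obtain e where e: "e > 0" "h holomorphic_on ball x e"
    using assms by (auto simp: analytic_on_def)
  \<comment> \<open>On a closed disc inside the disc of holomorphy the derivative in the Taylor
    remainder is bounded.\<close>
  define S where "S = cball x (e/2)"
  have SB: "S \<subseteq> ball x e" using e(1) by (auto simp: S_def)
  have hol: "(deriv ^^ i) h holomorphic_on ball x e" for i
    using e(2) by (rule holomorphic_higher_deriv) simp
  have "compact ((deriv ^^ Suc n) h ` S)"
    by (intro compact_continuous_image continuous_on_subset[OF holomorphic_on_imp_continuous_on[OF hol] SB]) (simp add: S_def)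
  then obtain B where B: "\<And>z. z \<in> S \<Longrightarrow> cmod ((deriv ^^ Suc n) h z) \<le> B"
    by (meson compact_imp_bounded bounded_iff imageI)
  have *: "cmod (h z - (\<Sum>i\<le>n. (deriv ^^ i) h x * (z - x) ^ i / fact i)) \<le> B * cmod (z - x) ^ Suc n / fact n"
    if "z \<in> S" for z
  proof -
    have "((deriv ^^ i) h has_field_derivative (deriv ^^ Suc i) h w) (at w within S)" if "w \<in> S" for i w
      using holomorphic_derivI[OF hol[of i], of w] SB that
      by (auto intro: has_field_derivative_at_within)
    from complex_Taylor[of S n "\<lambda>i. (deriv ^^ i) h", OF _ this B _ that, of x]
    show ?thesis using e(1) by (simp add: S_def)
  qed
  have "poly (\<Sum>j<N. smult ((deriv ^^ j) h x / fact j) ([:-x, 1:] ^ j)) z = (\<Sum>i\<le>n. (deriv ^^ i) h x * (z - x) ^ i / fact i)" for z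
    by (simp add: poly_sum Suc lessThan_Suc_atMost)
  moreover have "eventually (\<lambda>z. z \<in> S) (at x)"
    unfolding S_def by (rule eventually_mono[OF eventually_at_in_open'[of "ball x (e/2)"]]) (use e(1) in auto)
  ultimately show ?thesis
    using * by (intro bigoI[of _ "B / fact n"]) (auto elim!: eventually_mono simp: Suc norm_power norm_mult)
qed

text \<open>The Taylor polynomial of \<open>k\<close> of degree below \<open>N\<close> is itself
  \<open>O((z - x)^N)\<close>, hence divisible by \<open>(X - x)^N\<close>; its degree leaves only
  zero.\<close>

lemma taylor_bigo_imp_deriv_eq_0:
  assumes k: "k analytic_on {x}" and "k \<in> O[at x](\<lambda>z. (z - x) ^ N)" and "j < N"
  shows "(deriv ^^ j) k x = 0"
proof -
  define c where "c j = (deriv ^^ j) k x / fact j" for j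
  define D where "D = (\<Sum>j<N. smult (c j) ([:-x, 1:] ^ j))"
  have "(\<lambda>z. k z - (k z - poly D z)) \<in> O[at x](\<lambda>z. (z - x) ^ N)"
    using sum_in_bigo(2)[OF assms(2) taylor_bigo[OF k, of N]] unfolding D_def c_def .
  then have "[:-x, 1:] ^ N dvd D" by (intro bigo_poly_imp_dvd) simp
  moreover have "D = 0 \<or> degree D < N"
  proof (cases "N = 0")
    case False
    have "degree D \<le> N - 1" unfolding D_def
    proof (rule degree_sum_le)
      fix j assume "j \<in> {..<N}"
      then show "degree (smult (c j) ([:-x, 1:] ^ j)) \<le> N - 1"
        by (intro order_trans[OF degree_smult_le] order_trans[OF degree_power_le]) auto
    qed simp
    then show ?thesis using False by linarith
  qed (simp add: D_def)
  ultimately have "D = 0"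
    using divides_degree[of "[:-x, 1:] ^ N" D] by (auto simp: degree_linear_power)
  \<comment> \<open>Evaluating at \<open>x + w\<close> turns powers of \<open>X - x\<close> into
    powers of \<open>w\<close>, so that coefficients can be compared.\<close>
  have "(\<Sum>j<N. monom (c j) j) = 0"
  proof (rule poly_all_0_iff_0[THEN iffD1], rule allI)
    fix w
    have "poly (\<Sum>j<N. monom (c j) j) w = poly D (x + w)" by (simp add: D_def poly_sum poly_monom)
    then show "poly (\<Sum>j<N. monom (c j) j) w = 0" using \<open>D = 0\<close> by simp
  qed
  then have "coeff (\<Sum>j<N. monom (c j) j) j = 0" by simp
  then show ?thesis using \<open>j < N\<close> by (simp add: coeff_sum c_def)
qed

lemma higher_deriv_diff_poly:
  assumes "h analytic_on {x}"
  shows "(deriv ^^ j) (\<lambda>z. h z - poly p z) x = (deriv ^^ j) h x - poly ((pderiv ^^ j) p) x"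
proof -
  obtain e where "e > 0" "h holomorphic_on ball x e"
    using assms by (auto simp: analytic_on_def)
  then show ?thesis
    using higher_deriv_diff[of h "ball x e" "poly p" x j] by (simp add: deriv_funpow_poly holomorphic_intros)
qed

text \<open>Order of contact replaces the list of derivatives: products and compositions with
  \<open>exp\<close> are then handled by estimates instead of a Leibniz rule.\<close>

lemma jets_eq_iff_bigo:
  assumes "h analytic_on {x}"
  shows "(\<forall>j<N. poly ((pderiv ^^ j) p) x = (deriv ^^ j) h x) \<longleftrightarrow>
           (\<lambda>z. h z - poly p z) \<in> O[at x](\<lambda>z. (z - x) ^ N)"
proof -
  have an: "(\<lambda>z. h z - poly p z) analytic_on {x}"
    using assms by (intro analytic_on_diff analytic_on_poly)
  show ?thesis
  proof
    assume *: "\<forall>j<N. poly ((pderiv ^^ j) p) x = (deriv ^^ j) h x"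
    have "(\<Sum>j<N. smult ((deriv ^^ j) (\<lambda>z. h z - poly p z) x / fact j) ([:-x, 1:] ^ j)) = 0"
      using * by (simp add: higher_deriv_diff_poly[OF assms])
    then show "(\<lambda>z. h z - poly p z) \<in> O[at x](\<lambda>z. (z - x) ^ N)"
      using taylor_bigo[OF an, of N] by (simp del: poly_sum)
  next
    assume "(\<lambda>z. h z - poly p z) \<in> O[at x](\<lambda>z. (z - x) ^ N)"
    from taylor_bigo_imp_deriv_eq_0[OF an this]
    show "\<forall>j<N. poly ((pderiv ^^ j) p) x = (deriv ^^ j) h x"
      by (simp add: higher_deriv_diff_poly[OF assms])
  qed
qed

lemma poly_taylor_dvd:
  "[:-x, 1:] ^ N dvd p - (\<Sum>j<N. smult (poly ((pderiv ^^ j) p) x / fact j) ([:-x, 1:] ^ j))" for x :: complex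
proof (rule bigo_poly_imp_dvd)
  have "poly p analytic_on {x}" by (rule analytic_on_poly)
  from taylor_bigo[OF this, of N]
  show "poly (p - (\<Sum>j<N. smult (poly ((pderiv ^^ j) p) x / fact j) ([:-x, 1:] ^ j))) \<in> O[at x](\<lambda>z. (z - x) ^ N)"
    unfolding deriv_funpow_poly poly_diff[symmetric] .
qed

text \<open>The interpolation basis \<open>e x * (X - x)^j\<close>, evaluated at \<open>A\<close>,
  gives the \<open>Q x j\<close>. They do not depend on \<open>p\<close>, so
  \<open>poly_matrix p A\<close> is linear in finitely many Taylor coefficients, and limits or
  holomorphic dependence on a parameter can be checked on these.\<close>

lemma poly_matrix_spectral:
  fixes A :: "complex^'n^'n"
  obtains Q where "\<And>p. poly_matrix p A =
     (\<Sum>x\<in>spectrum_of A. \<Sum>j<CARD('n). mat (poly ((pderiv ^^ j) p) x / fact j) ** Q x j)"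
proof -
  let ?S = "spectrum_of A" and ?n = "CARD('n)"
  \<comment> \<open>At \<open>A\<close> the polynomial \<open>e y\<close> becomes the spectral
    projection belonging to \<open>y\<close>.\<close>
  have "\<exists>e. \<forall>x\<in>?S. [:-x, 1:] ^ ?n dvd e - (if x = y then 1 else 0)" for y
    by (rule poly_interpolate_jets[OF finite_spectrum_of])
  then obtain e where e: "\<And>x y. x \<in> ?S \<Longrightarrow> [:-x, 1:] ^ ?n dvd e y - (if x = y then 1 else 0)" by metis
  define t where "t p x = (\<Sum>j<?n. smult (poly ((pderiv ^^ j) p) x / fact j) ([:-x, 1:] ^ j))" for p and x :: complex
  have "poly_matrix p A = poly_matrix (\<Sum>y\<in>?S. e y * t p y) A" for p
  proof (rule poly_matrix_cong)
    fix x assume x: "x \<in> ?S"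
    have "(\<Sum>y\<in>?S. e y * t p y) - t p x = (\<Sum>y\<in>?S. (e y - (if x = y then 1 else 0)) * t p y)"
    proof -
      have "(\<Sum>y\<in>?S. (if x = y then 1 else 0) * t p y) = (\<Sum>y\<in>?S. if x = y then t p y else 0)"
        by (intro sum.cong) auto
      also have "\<dots> = t p x" using x finite_spectrum_of[of A] by simp
      finally show ?thesis by (simp add: left_diff_distrib sum_subtractf)
    qed
    moreover have "[:-x, 1:] ^ ?n dvd \<dots>" using e[OF x] by (intro dvd_sum dvd_mult2)
    ultimately have "[:-x, 1:] ^ ?n dvd (p - t p x) - ((\<Sum>y\<in>?S. e y * t p y) - t p x)"
      using poly_taylor_dvd[of x ?n p, folded t_def] by (simp only: dvd_diff)
    then show "[:-x, 1:] ^ ?n dvd p - (\<Sum>y\<in>?S. e y * t p y)" by simp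
  qed
  also have "poly_matrix (\<Sum>y\<in>?S. e y * t p y) A =
      (\<Sum>x\<in>?S. \<Sum>j<?n. mat (poly ((pderiv ^^ j) p) x / fact j) ** poly_matrix (e x * [:-x, 1:] ^ j) A)" for p
    unfolding t_def poly_matrix_sum sum_distrib_left mult_smult_right poly_matrix_smult ..
  finally show ?thesis by (rule that)
qed

text \<open>Uniform convergence of holomorphic functions near the spectrum carries over to all
  derivatives, and the value at \<open>A\<close> is a fixed linear combination of derivatives at the
  eigenvalues.\<close>

lemma poly_matrix_limit:
  fixes A :: "complex^'n^'n"
  assumes U: "open U" "spectrum_of A \<subseteq> U" and "uniform_limit U (\<lambda>K. poly (s K)) h sequentially"
    and "\<And>x j. x \<in> spectrum_of A \<Longrightarrow> j < CARD('n) \<Longrightarrow> poly ((pderiv ^^ j) p) x = (deriv ^^ j) h x"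
  shows "(\<lambda>K. poly_matrix (s K) A $ a $ b) \<longlonglongrightarrow> poly_matrix p A $ a $ b"
proof -
  obtain Q where Q: "\<And>p. poly_matrix p A =
     (\<Sum>x\<in>spectrum_of A. \<Sum>j<CARD('n). mat (poly ((pderiv ^^ j) p) x / fact j) ** Q x j)"
    by (rule poly_matrix_spectral[of A]) (rule that)
  have lim: "(\<lambda>K. poly ((pderiv ^^ j) (s K)) x) \<longlonglongrightarrow> poly ((pderiv ^^ j) p) x"
    if "x \<in> spectrum_of A" "j < CARD('n)" for x j
    using higher_deriv_complex_uniform_limit[OF assms(3), of x j] U that assms(4)
    by (auto simp: deriv_funpow_poly holomorphic_intros)
  show ?thesis
    unfolding Q sum_component mat_mult_nth
    by (intro tendsto_sum tendsto_mult tendsto_divide lim tendsto_const) auto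
qed

text \<open>The partial sums are polynomials that converge uniformly on a disc around the spectrum;
  their values at \<open>A\<close> are the partial sums of the matrix series.\<close>

lemma poly_matrix_powser_sums:
  fixes A :: "complex^'n^'n"
  assumes r: "spectrum_of A \<subseteq> ball 0 r" "summable (\<lambda>k. norm (c k) * r ^ k)"
    and jets: "\<And>x j. x \<in> spectrum_of A \<Longrightarrow> j < CARD('n) \<Longrightarrow>
           poly ((pderiv ^^ j) p) x = (deriv ^^ j) (\<lambda>x. \<Sum>k. c k * x ^ k) x"
  shows "(\<lambda>k. c k * matrix_power A k $ a $ b) sums poly_matrix p A $ a $ b"
proof -
  define s where "s K = (\<Sum>k<K. monom (c k) k)" for K
  have "uniform_limit (ball 0 r) (\<lambda>K x. \<Sum>k<K. c k * x ^ k) (\<lambda>x. \<Sum>k. c k * x ^ k) sequentially"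
    by (rule Weierstrass_m_test[OF _ r(2)]) (auto simp: norm_mult norm_power intro!: mult_left_mono power_mono)
  moreover have "(\<lambda>K. poly (s K)) = (\<lambda>K x. \<Sum>k<K. c k * x ^ k)"
    by (intro ext) (simp add: s_def poly_sum poly_monom)
  ultimately have "uniform_limit (ball 0 r) (\<lambda>K. poly (s K)) (\<lambda>x. \<Sum>k. c k * x ^ k) sequentially"
    by simp
  from poly_matrix_limit[OF open_ball r(1) this jets, of a b]
  show ?thesis by (simp add: sums_def s_def poly_matrix_sum poly_matrix_monom mat_mult_nth)
qed

subsection \<open>Analytic continuation along the bypassing contour\<close>

text \<open>The parameters at which both families of function elements agree on a common disc
  include \<open>0\<close>, and by the identity theorem the agreement passes between nearby
  parameters in both directions; connectedness of \<open>{0..1}\<close> takes it to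
  \<open>1\<close>.\<close>

lemma continues_to_unique:
  assumes "continues_to \<gamma> \<phi> w" "continues_to \<gamma> \<phi> w'"
  shows "w = w'"
proof -
  obtain F r where F: "path \<gamma>" "r > 0" "\<And>t. t \<in> {0..1} \<Longrightarrow> F t holomorphic_on ball (\<gamma> t) r"
      "\<And>t. t \<in> {0..1} \<Longrightarrow> \<exists>\<delta>>0. \<forall>t'\<in>{0..1}. \<bar>t' - t\<bar> < \<delta> \<longrightarrow> (\<forall>z \<in> ball (\<gamma> t) r \<inter> ball (\<gamma> t') r. F t' z = F t z)"
      "eventually (\<lambda>z. F 0 z = \<phi> z) (nhds (\<gamma> 0))" "w = F 1 (\<gamma> 1)"
    using assms(1) unfolding continues_to_def by blast
  obtain F' r' where F': "r' > 0" "\<And>t. t \<in> {0..1} \<Longrightarrow> F' t holomorphic_on ball (\<gamma> t) r'"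
      "\<And>t. t \<in> {0..1} \<Longrightarrow> \<exists>\<delta>>0. \<forall>t'\<in>{0..1}. \<bar>t' - t\<bar> < \<delta> \<longrightarrow> (\<forall>z \<in> ball (\<gamma> t) r' \<inter> ball (\<gamma> t') r'. F' t' z = F' t z)"
      "eventually (\<lambda>z. F' 0 z = \<phi> z) (nhds (\<gamma> 0))" "w' = F' 1 (\<gamma> 1)"
    using assms(2) unfolding continues_to_def by blast
  define \<rho> where "\<rho> = min r r'"
  have \<rho>: "\<rho> > 0" using F(2) F'(1) by (simp add: \<rho>_def)
  define P where "P t \<longleftrightarrow> (\<forall>z\<in>ball (\<gamma> t) \<rho>. F t z = F' t z)" for t
  have ident: "P t" if "t \<in> {0..1}" "open V" "V \<noteq> {}" "V \<subseteq> ball (\<gamma> t) \<rho>" "\<And>z. z \<in> V \<Longrightarrow> F t z = F' t z" for t V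
    unfolding P_def
  proof
    fix z assume z: "z \<in> ball (\<gamma> t) \<rho>"
    show "F t z = F' t z"
    proof (rule analytic_continuation_open[of V "ball (\<gamma> t) \<rho>" "F t" "F' t"])
      show "F t holomorphic_on ball (\<gamma> t) \<rho>" "F' t holomorphic_on ball (\<gamma> t) \<rho>"
        using F(3)[OF that(1)] F'(2)[OF that(1)] by (auto elim!: holomorphic_on_subset simp: \<rho>_def)
    qed (use that z in auto)
  qed
  have cont: "continuous_on {0..1} \<gamma>" using F(1) by (simp add: path_def)
  have "P 1"
  proof (rule connected_induction_simple[of "{0..1::real}" 0 1 P])
    obtain V where "open V" "\<gamma> 0 \<in> V" "\<And>z. z \<in> V \<Longrightarrow> F 0 z = F' 0 z"
      using eventually_conj[OF F(5) F'(4)] unfolding eventually_nhds by auto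
    then show "P 0" using \<rho> by (intro ident[of 0 "V \<inter> ball (\<gamma> 0) \<rho>"]) auto
  next
    fix a :: real assume a: "a \<in> {0..1}"
    obtain \<delta>1 where d1: "\<delta>1 > 0" "\<And>t' z. t' \<in> {0..1} \<Longrightarrow> \<bar>t' - a\<bar> < \<delta>1 \<Longrightarrow> z \<in> ball (\<gamma> a) r \<inter> ball (\<gamma> t') r \<Longrightarrow> F t' z = F a z"
      using F(4)[OF a] by blast
    obtain \<delta>2 where d2: "\<delta>2 > 0" "\<And>t' z. t' \<in> {0..1} \<Longrightarrow> \<bar>t' - a\<bar> < \<delta>2 \<Longrightarrow> z \<in> ball (\<gamma> a) r' \<inter> ball (\<gamma> t') r' \<Longrightarrow> F' t' z = F' a z"
      using F'(3)[OF a] by blast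
    obtain \<delta>3 where d3: "\<delta>3 > 0" "\<And>t'. t' \<in> {0..1} \<Longrightarrow> dist t' a < \<delta>3 \<Longrightarrow> dist (\<gamma> t') (\<gamma> a) < \<rho>"
      using cont a \<rho> unfolding continuous_on_iff by metis
    define \<delta> where "\<delta> = min \<delta>1 (min \<delta>2 \<delta>3)"
    have step: "P t \<longleftrightarrow> P a" if t: "t \<in> {0..1}" "dist t a < \<delta>" for t
    proof -
      let ?V = "ball (\<gamma> a) \<rho> \<inter> ball (\<gamma> t) \<rho>"
      have eq: "F t z = F a z" "F' t z = F' a z" if "z \<in> ?V" for z
        using d1(2)[of t z] d2(2)[of t z] t that by (auto simp: \<delta>_def \<rho>_def dist_real_def)
      have "\<gamma> a \<in> ?V" using d3(2)[of t] t \<rho> by (simp add: \<delta>_def)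
      then have ne: "?V \<noteq> {}" by blast
      show ?thesis
      proof
        assume "P t" then show "P a" using eq ne a by (intro ident[of a ?V]) (auto simp: P_def)
      next
        assume "P a" then show "P t" using eq ne t by (intro ident[of t ?V]) (auto simp: P_def)
      qed
    qed
    have "\<delta> > 0" using d1 d2 d3 by (simp add: \<delta>_def)
    then show "\<exists>T. openin (top_of_set {0..1}) T \<and> a \<in> T \<and> (\<forall>x\<in>T. \<forall>y\<in>T. P x \<longrightarrow> P y)"
    proof (intro exI conjI ballI impI)
      show "openin (top_of_set {0..1}) ({0..1} \<inter> ball a \<delta>)" by (intro openin_open_Int open_ball)
      show "a \<in> {0..1} \<inter> ball a \<delta>" using a \<open>\<delta> > 0\<close> by simp
      fix x y assume xy: "x \<in> {0..1} \<inter> ball a \<delta>" "y \<in> {0..1} \<inter> ball a \<delta>" and "P x"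
      then have "P a" using step[of x] by (simp add: dist_commute)
      then show "P y" using step[of y] xy(2) by (simp add: dist_commute)
    qed
  qed auto
  then show ?thesis using F(6) F'(5) \<rho> by (simp add: P_def)
qed

text \<open>One holomorphic function on a neighbourhood of the path serves as function element at
  every parameter; compactness of the path gives the common radius.\<close>

lemma continues_to_holomorphic:
  assumes "path \<gamma>" "G holomorphic_on U" "open U" "path_image \<gamma> \<subseteq> U"
    and "eventually (\<lambda>z. G z = \<phi> z) (nhds (\<gamma> 0))"
  shows "continues_to \<gamma> \<phi> (G (\<gamma> 1))"
proof -
  obtain r where r: "r > 0" "(\<Union>x\<in>path_image \<gamma>. ball x r) \<subseteq> U"
    using compact_subset_open_imp_ball_epsilon_subset[OF compact_path_image[OF assms(1)] assms(3,4)] by blast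
  show ?thesis
    unfolding continues_to_def
  proof (intro conjI exI[of _ "\<lambda>t. G"] exI[of _ r] ballI)
    fix t :: real assume "t \<in> {0..1}"
    then show "G holomorphic_on ball (\<gamma> t) r"
      using r by (intro holomorphic_on_subset[OF assms(2)]) (fastforce simp: path_image_def)
  qed (use assms r in \<open>auto intro: exI[of _ 1]\<close>)
qed

lemma scaleR_matrix_mult_left: "(c *\<^sub>R M) ** N = c *\<^sub>R (M ** (N::'a::real_algebra_1^'p^'m))"
  by (simp add: matrix_matrix_mult_def vec_eq_iff scaleR_sum_right)

lemma scaleR_matrix_mult_right: "M ** (c *\<^sub>R N) = c *\<^sub>R (M ** (N::'a::real_algebra_1^'p^'m))"
  by (simp add: matrix_matrix_mult_def vec_eq_iff scaleR_sum_right)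

text \<open>\<open>E + p A\<close> is \<open>p\<close> times \<open>A + 1 / p\<close>, so the
  singular parameters are negative reciprocals of eigenvalues.\<close>

lemma invertible_mat1_plus_iff:
  fixes A :: "complex^'n^'n"
  assumes "p \<noteq> 0"
  shows "invertible (mat 1 + p *\<^sub>R A) \<longleftrightarrow> - 1 / of_real p \<notin> spectrum_of A"
proof -
  have 1: "mat 1 + p *\<^sub>R A = p *\<^sub>R (A - mat (- 1 / of_real p))"
  proof -
    have "p *\<^sub>R mat (- 1 / of_real p) = (- mat 1 :: complex^'n^'n)"
      using assms by (auto simp: vec_eq_iff mat_def scaleR_conv_of_real[where 'a=complex])
    then show ?thesis by (simp add: scaleR_diff_right)
  qed
  have "invertible (p *\<^sub>R M) \<longleftrightarrow> invertible M" for M :: "complex^'n^'n"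
  proof
    assume "invertible M"
    then obtain N where "M ** N = mat 1" "N ** M = mat 1" by (auto simp: invertible_def)
    then show "invertible (p *\<^sub>R M)" unfolding invertible_def
      using assms by (intro exI[of _ "inverse p *\<^sub>R N"]) (simp add: scaleR_matrix_mult_left scaleR_matrix_mult_right)
  next
    assume "invertible (p *\<^sub>R M)"
    then obtain N where "(p *\<^sub>R M) ** N = mat 1" "N ** (p *\<^sub>R M) = mat 1" by (auto simp: invertible_def)
    then show "invertible M" unfolding invertible_def
      by (intro exI[of _ "p *\<^sub>R N"]) (simp add: scaleR_matrix_mult_left scaleR_matrix_mult_right)
  qed
  then show ?thesis unfolding 1 by (simp add: spectrum_of_def)
qed

lemma singular_values_eq: "singular_values A m = {p. 0 < p \<and> p < m \<and> - 1 / of_real p \<in> spectrum_of A}"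
  unfolding singular_values_def using invertible_mat1_plus_iff[of _ A] by auto

lemma finite_singular_values: "finite (singular_values A m)"
proof -
  have "singular_values A m \<subseteq> (\<lambda>l. - 1 / Re l) ` spectrum_of A"
  proof
    fix p assume "p \<in> singular_values A m"
    then have "p = - 1 / Re (- 1 / of_real p)" "- 1 / of_real p \<in> spectrum_of A"
      by (auto simp: singular_values_eq Re_divide_of_real)
    then show "p \<in> (\<lambda>l. - 1 / Re l) ` spectrum_of A" by blast
  qed
  then show ?thesis using finite_surj[OF finite_spectrum_of] by blast
qed

lemma path_bypass_contour: "path (bypass_contour d A m \<epsilon>)"
  unfolding path_def bypass_contour_def Complex_eq
  by (cases "singular_values A m = {}") (auto intro!: continuous_intros)

text \<open>Neither end is a singular value and there are only finitely many of these, so for small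
  \<open>\<epsilon>\<close> no detour reaches an end.\<close>

lemma bypass_contour_ends:
  assumes "m > 0"
  shows "\<forall>\<^sub>F \<epsilon> in at_right 0. bypass_contour d A m \<epsilon> 0 = 0 \<and> bypass_contour d A m \<epsilon> 1 = of_real m"
proof -
  have "\<exists>e>0. \<forall>x\<in>singular_values A m. e \<le> dist c x" if "c \<notin> singular_values A m" for c
  proof -
    obtain e where "e > 0" "\<forall>x\<in>singular_values A m. x \<noteq> c \<longrightarrow> e \<le> dist c x"
      using finite_set_avoid[OF finite_singular_values[of A m], of c] by blast
    then show ?thesis using that by (intro exI[of _ e]) auto
  qed
  note avoid = this
  have "0 \<notin> singular_values A m" "m \<notin> singular_values A m" by (auto simp: singular_values_def)
  from avoid[OF this(1)] avoid[OF this(2)] obtain e e'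
    where e: "e > 0" "\<And>x. x \<in> singular_values A m \<Longrightarrow> e \<le> dist 0 x"
    and e': "e' > 0" "\<And>x. x \<in> singular_values A m \<Longrightarrow> e' \<le> dist m x" by blast
  have "\<forall>\<^sub>F \<epsilon> in at_right 0. \<epsilon> < min e e'" using e(1) e'(1) by (intro order_tendstoD(2)[OF tendsto_ident_at]) auto
  then show ?thesis
  proof eventually_elim
    case (elim \<epsilon>)
    have "\<epsilon> \<le> infdist 0 (singular_values A m) \<and> \<epsilon> \<le> infdist m (singular_values A m)"
      if ne: "singular_values A m \<noteq> {}"
    proof -
      have "\<epsilon> \<le> (INF a\<in>singular_values A m. dist 0 a)"
        using elim by (intro cINF_greatest ne order_trans[OF _ e(2)]) auto
      moreover have "\<epsilon> \<le> (INF a\<in>singular_values A m. dist m a)"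
        using elim by (intro cINF_greatest ne order_trans[OF _ e'(2)]) auto
      ultimately show ?thesis using ne by (simp add: infdist_def)
    qed
    then show ?case by (auto simp: bypass_contour_def complex_eq_iff)
  qed
qed

text \<open>The branch cut of \<open>ln (1 + z x)\<close> as a function of \<open>z\<close> is the vertical ray that starts at the
  pole \<open>-1 / l\<close> and points away from the bypassing contour; the direction depends on the eigenvalue
  \<open>l\<close> only, so that \<open>x\<close> may vary near \<open>l\<close>.\<close>

definition cut_dir :: "side \<Rightarrow> complex \<Rightarrow> complex" where
  "cut_dir d l = (if side_sign d * Im (- 1 / l) \<le> 0 then \<i> * of_real (side_sign d) else - \<i> * of_real (side_sign d))"

text \<open>Since \<open>1 + z x\<close> is \<open>(z + 1 / x) / (1 / x)\<close>, a logarithm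
  vanishing at \<open>z = 0\<close> is a difference of two; the division by
  \<open>cut_dir d l\<close> turns the principal cut into the ray chosen for \<open>l\<close>. For
  \<open>l = 0\<close> the pole escapes to infinity as \<open>x\<close> approaches \<open>l\<close>,
  and the principal branch serves.\<close>

definition bypass_ln :: "side \<Rightarrow> complex \<Rightarrow> complex \<Rightarrow> complex \<Rightarrow> complex" where
  "bypass_ln d l x z = (if l = 0 then Ln (1 + z * x) else Ln ((z + 1 / x) / cut_dir d l) - Ln (1 / x / cut_dir d l))"

definition bypass_dom :: "side \<Rightarrow> complex \<Rightarrow> complex \<Rightarrow> complex set" where
  "bypass_dom d l x = (if l = 0 then {z. 1 + z * x \<notin> \<real>\<^sub>\<le>\<^sub>0} else {z. (z + 1 / x) / cut_dir d l \<notin> \<real>\<^sub>\<le>\<^sub>0})"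

lemma side_sign_cases: "side_sign d = 1 \<or> side_sign d = -1"
  by (cases d) auto

lemma norm_cut_dir [simp]: "norm (cut_dir d l) = 1"
  using side_sign_cases[of d] by (auto simp: cut_dir_def norm_mult)

lemma cut_dir_nonzero [simp]: "cut_dir d l \<noteq> 0"
  using norm_cut_dir[of d l] by (metis norm_zero zero_neq_one)

lemma open_bypass_dom: "open (bypass_dom d l x)"
proof -
  have "open ((\<lambda>z. 1 + z * x) -` (- \<real>\<^sub>\<le>\<^sub>0))" "open ((\<lambda>z. (z + 1 / x) / cut_dir d l) -` (- \<real>\<^sub>\<le>\<^sub>0))"
    by (intro continuous_open_vimage continuous_intros open_Compl closed_nonpos_Reals_complex; simp)+
  then show ?thesis by (auto simp: bypass_dom_def vimage_def Compl_eq)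
qed

lemma holomorphic_bypass_ln: "bypass_ln d l x holomorphic_on bypass_dom d l x"
  unfolding bypass_ln_def[abs_def] bypass_dom_def by (auto intro!: holomorphic_intros)

lemma exp_bypass_ln:
  assumes "l = 0 \<or> x \<noteq> 0" "z \<in> bypass_dom d l x"
  shows "exp (bypass_ln d l x z) = 1 + z * x"
proof (cases "l = 0")
  case True
  then have "1 + z * x \<noteq> 0" using assms(2) by (auto simp: bypass_dom_def)
  then show ?thesis using True by (simp add: bypass_ln_def)
next
  case False
  then have "x \<noteq> 0" "z + 1 / x \<noteq> 0" using assms by (auto simp: bypass_dom_def)
  then show ?thesis using False by (simp add: bypass_ln_def exp_diff field_simps)
qed

lemma bypass_ln_at_0 [simp]: "bypass_ln d l x 0 = 0"
  by (simp add: bypass_ln_def)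

text \<open>A continuous logarithm that vanishes at \<open>z0\<close> stays, nearby, in the strip
  where \<open>Ln\<close> inverts \<open>exp\<close>.\<close>

lemma eventually_Ln_eqI:
  assumes "isCont b z0" "b z0 = 0" "eventually (\<lambda>z. exp (b z) = c z) (nhds z0)"
  shows "eventually (\<lambda>z. b z = Ln (c z)) (nhds z0)"
proof -
  have "eventually (\<lambda>z. b z \<in> ball 0 1) (nhds z0)"
    using assms(1,2) by (intro topological_tendstoD[of b "b z0"]) (auto simp: isCont_def tendsto_nhds_iff)
  with assms(3) show ?thesis
  proof eventually_elim
    case (elim z)
    have "\<bar>Im (b z)\<bar> < 1" using elim(2) abs_Im_le_cmod[of "b z"] by simp
    then have "Ln (exp (b z)) = b z" using pi_gt3 by (intro Ln_exp) auto
    then show ?case using elim(1) by simp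
  qed
qed

lemma bypass_ln_eq_Ln:
  assumes "l = 0 \<or> x \<noteq> 0" "0 \<in> bypass_dom d l x"
  shows "\<forall>\<^sub>F z in nhds 0. bypass_ln d l x z = Ln (1 + z * x)"
proof (rule eventually_Ln_eqI)
  show "isCont (bypass_ln d l x) 0"
    using holomorphic_on_imp_continuous_on[OF holomorphic_bypass_ln] assms(2) open_bypass_dom
    by (metis continuous_on_eq_continuous_at)
  have "\<forall>\<^sub>F z in nhds 0. z \<in> bypass_dom d l x"
    using assms(2) open_bypass_dom by (rule eventually_nhds_in_open[rotated])
  then show "\<forall>\<^sub>F z in nhds 0. exp (bypass_ln d l x z) = 1 + z * x"
    by eventually_elim (rule exp_bypass_ln[OF assms(1)])
qed simp

text \<open>A common point of contour and cut lies on the vertical line through the pole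
  \<open>p = -1 / l\<close>. Let the side of the contour be up. If \<open>p\<close> is real or below
  the axis, the ray descends from \<open>p\<close> while the contour stays on or above the axis;
  they could meet only at a real \<open>p\<close> passed at height \<open>0\<close>, but such a
  \<open>p\<close> is a singular value and is passed at height \<open>\<epsilon>\<close>. If
  \<open>p\<close> is above the axis, the ray starts higher than \<open>\<epsilon>\<close> and
  rises.\<close>

lemma bypass_contour_avoids_cut:
  assumes m: "m > 0" and l: "l \<in> spectrum_of A" "l \<noteq> 0" "1 + of_real m * l \<noteq> 0"
  shows "\<forall>\<^sub>F \<epsilon> in at_right 0. path_image (bypass_contour d A m \<epsilon>) \<subseteq> bypass_dom d l l"
proof -
  define p where "p = - 1 / l"
  have "Im p = 0 \<or> \<bar>Im p\<bar> > 0" by auto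
  then obtain e where e: "e > 0" "Im p \<noteq> 0 \<longrightarrow> e < \<bar>Im p\<bar>"
    by (cases "Im p = 0") (auto intro: that[of 1] that[of "\<bar>Im p\<bar> / 2"])
  have "\<forall>\<^sub>F \<epsilon> in at_right 0. \<epsilon> < e \<and> 0 < (\<epsilon>::real)"
    using e(1) by (intro eventually_conj order_tendstoD(2)[OF tendsto_ident_at] eventually_at_right_less) auto
  then show ?thesis
  proof eventually_elim
    case (elim \<epsilon>)
    let ?S = "singular_values A m"
    show ?case
    proof
      fix z assume "z \<in> path_image (bypass_contour d A m \<epsilon>)"
      then obtain v where v: "0 \<le> v" "v \<le> 1" "z = bypass_contour d A m \<epsilon> v"
        by (auto simp: path_image_def)
      define h where "h = (if ?S = {} then 0 else max 0 (\<epsilon> - infdist (m * v) ?S))"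
      have z: "z = Complex (m * v) (side_sign d * h)" using v by (simp add: bypass_contour_def h_def)
      have h: "0 \<le> h" "h \<le> \<epsilon>" using elim infdist_nonneg[of "m * v" ?S] by (auto simp: h_def)
      have mv: "0 \<le> m * v" "m * v \<le> m" using v m by (auto simp: mult_left_le)
      have "(z - p) / cut_dir d l \<notin> \<real>\<^sub>\<le>\<^sub>0"
      proof
        assume neg: "(z - p) / cut_dir d l \<in> \<real>\<^sub>\<le>\<^sub>0"
        then obtain r where r: "r \<le> 0" "(z - p) / cut_dir d l = of_real r" by (auto elim!: nonpos_Reals_cases)
        then have zp: "z - p = of_real r * cut_dir d l" by (simp add: field_simps)
        have re: "Re p = m * v"
          using arg_cong[OF zp, of Re] by (auto simp: z cut_dir_def split: if_splits)
        show False
        proof (cases "side_sign d * Im p \<le> 0")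
          case True
          then have "side_sign d * h - Im p = r * side_sign d"
            using arg_cong[OF zp, of Im] by (auto simp: z cut_dir_def p_def)
          then have "h - side_sign d * Im p = r"
            using side_sign_cases[of d] by (auto simp: algebra_simps)
          then have "h = 0" "Im p = 0" using True h(1) r(1) side_sign_cases[of d] by auto
          then have p: "p = of_real (m * v)" using re by (simp add: complex_eq_iff)
          then have l': "l = - 1 / of_real (m * v)" "m * v \<noteq> 0" using l(2) by (auto simp: p_def field_simps)
          then have "m * v \<noteq> m" using l(3) m by (auto simp: field_simps)
          then have "0 < m * v" "m * v < m" using l'(2) mv by linarith+
          then have "m * v \<in> ?S" using l(1) l'(1) unfolding singular_values_eq by blast
          then have "h = \<epsilon>" using elim by (auto simp: h_def)
          then show False using \<open>h = 0\<close> elim by simp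
        next
          case False
          then have "side_sign d * h - Im p = - r * side_sign d"
            using arg_cong[OF zp, of Im] by (auto simp: z cut_dir_def p_def)
          then have "h - side_sign d * Im p = - r"
            using side_sign_cases[of d] by (auto simp: algebra_simps)
          then have "side_sign d * Im p \<le> h" using r(1) by simp
          moreover have "side_sign d * Im p = \<bar>Im p\<bar>" using False side_sign_cases[of d] by auto
          ultimately show False using e(2) h elim False by auto
        qed
      qed
      then show "z \<in> bypass_dom d l l" using l(2) by (simp add: bypass_dom_def p_def)
    qed
  qed
qed

lemma bypass_contour_bounded:
  assumes "m > 0" "0 < \<epsilon>" "\<epsilon> < 1" "z \<in> path_image (bypass_contour d A m \<epsilon>)"
  shows "norm z \<le> m + 1"
proof -
  obtain v where v: "0 \<le> v" "v \<le> 1" "z = bypass_contour d A m \<epsilon> v"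
    using assms(4) by (auto simp: path_image_def)
  have "\<bar>Re z\<bar> \<le> m" using v assms by (simp add: bypass_contour_def abs_mult mult_left_le)
  moreover have "\<bar>Im z\<bar> \<le> 1"
    using v assms infdist_nonneg[of "m * v" "singular_values A m"] side_sign_cases[of d]
    by (auto simp: bypass_contour_def abs_mult)
  ultimately show ?thesis using cmod_le[of z] by linarith
qed

text \<open>All \<open>x\<close> near \<open>l\<close> have to be covered, because jets in
  \<open>x\<close> are to be taken. For \<open>l = 0\<close> the bound on the contour gives
  \<open>norm (z * x) < 1\<close>; otherwise the compact contour keeps a positive distance from the
  cut, whose starting point moves continuously with \<open>x\<close>.\<close>

lemma bypass_contour_in_dom:
  assumes m: "m > 0" and l: "l \<in> spectrum_of A" "1 + of_real m * l \<noteq> 0"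
  shows "\<forall>\<^sub>F \<epsilon> in at_right 0. \<forall>\<^sub>F x in nhds l. (l = 0 \<or> x \<noteq> 0) \<and> path_image (bypass_contour d A m \<epsilon>) \<subseteq> bypass_dom d l x"
proof (cases "l = 0")
  case True
  have "\<forall>\<^sub>F \<epsilon> in at_right 0. \<epsilon> < 1 \<and> 0 < (\<epsilon>::real)"
    by (intro eventually_conj order_tendstoD(2)[OF tendsto_ident_at] eventually_at_right_less) auto
  then show ?thesis
  proof eventually_elim
    case (elim \<epsilon>)
    have "eventually (\<lambda>x. x \<in> ball 0 (1 / (m + 1))) (nhds l)"
      using m True by (intro eventually_nhds_in_open) auto
    then show ?case
    proof eventually_elim
      case (elim x)
      have "z \<in> bypass_dom d l x" if z: "z \<in> path_image (bypass_contour d A m \<epsilon>)" for z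
      proof -
        have "norm (z * x) < 1"
        proof -
          have "norm z \<le> m + 1" using bypass_contour_bounded[OF m _ _ z] \<open>\<epsilon> < 1 \<and> 0 < \<epsilon>\<close> by simp
          then have "norm z * norm x \<le> (m + 1) * norm x" by (intro mult_right_mono) auto
          also have "\<dots> < 1" using elim m by (simp add: field_simps)
          finally show ?thesis by (simp add: norm_mult)
        qed
        then have "Re (1 + z * x) > 0" using abs_Re_le_cmod[of "z * x"] by auto
        then show ?thesis using True by (auto simp: bypass_dom_def complex_nonpos_Reals_iff)
      qed
      then show ?case using True by auto
    qed
  qed
next
  case False
  show ?thesis using bypass_contour_avoids_cut[OF m l(1) False l(2), of d]
  proof eventually_elim
    case (elim \<epsilon>)
    let ?e = "cut_dir d l"
    define K where "K = (\<lambda>z. (z + 1 / l) / ?e) ` path_image (bypass_contour d A m \<epsilon>)"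
    have "compact K" unfolding K_def
      by (intro compact_continuous_image continuous_intros compact_path_image path_bypass_contour) auto
    moreover have "K \<inter> \<real>\<^sub>\<le>\<^sub>0 = {}" using elim False by (auto simp: K_def bypass_dom_def)
    ultimately obtain \<delta> where \<delta>: "\<delta> > 0" "\<And>x y. x \<in> K \<Longrightarrow> y \<in> \<real>\<^sub>\<le>\<^sub>0 \<Longrightarrow> \<delta> \<le> dist x y"
      using separate_compact_closed[of K "\<real>\<^sub>\<le>\<^sub>0"] closed_nonpos_Reals_complex by blast
    have "((\<lambda>x. 1 / x) \<longlongrightarrow> 1 / l) (nhds l)" using False by (intro tendsto_intros filterlim_ident) auto
    then have "\<forall>\<^sub>F x in nhds l. dist (1 / x) (1 / l) < \<delta>" using \<delta>(1) by (rule tendstoD)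
    moreover have "\<forall>\<^sub>F x in nhds l. x \<noteq> 0" using False by (intro t1_space_nhds) auto
    ultimately show ?case
    proof eventually_elim
      case (elim x)
      have "z \<in> bypass_dom d l x" if z: "z \<in> path_image (bypass_contour d A m \<epsilon>)" for z
      proof -
        have "dist ((z + 1 / l) / ?e) ((z + 1 / x) / ?e) = dist (1 / x) (1 / l)"
          by (simp add: dist_norm norm_divide norm_minus_commute flip: diff_divide_distrib)
        moreover have "(z + 1 / l) / ?e \<in> K" using z by (simp add: K_def)
        ultimately have "(z + 1 / x) / ?e \<notin> \<real>\<^sub>\<le>\<^sub>0" using \<delta>(2) elim by fastforce
        then show ?thesis using False by (simp add: bypass_dom_def)
      qed
      then show ?case using elim by auto
    qed
  qed
qed

lemma one_plus_spectrum_nonzero: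
  assumes "m > 0" "invertible (mat 1 + m *\<^sub>R A)" "l \<in> spectrum_of A"
  shows "1 + of_real m * l \<noteq> 0"
proof
  assume *: "1 + of_real m * l = 0"
  have "l = - 1 / of_real m" using assms(1) * by (simp add: field_simps add_eq_0_iff)
  then show False using assms invertible_mat1_plus_iff[of m A] by auto
qed

lemma continues_to_bypass_ln:
  assumes path: "path_image \<gamma> \<subseteq> bypass_dom d l x" "path \<gamma>" "\<gamma> 0 = 0"
    and x: "l = 0 \<or> x \<noteq> 0"
  shows "continues_to \<gamma> (\<lambda>z. Ln (1 + z * x)) (bypass_ln d l x (\<gamma> 1))"
proof (rule continues_to_holomorphic[OF path(2) holomorphic_bypass_ln open_bypass_dom path(1)])
  have "\<gamma> 0 \<in> path_image \<gamma>" by (auto simp: path_image_def)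
  then show "\<forall>\<^sub>F z in nhds (\<gamma> 0). bypass_ln d l x z = Ln (1 + z * x)"
    using path by (intro bypass_ln_eq_Ln[OF x, unfolded path(3)[symmetric]]) auto
qed

lemma ln_along_bypass_contour:
  assumes m: "m > 0" and l: "l \<in> spectrum_of A" "1 + of_real m * l \<noteq> 0"
  shows "\<forall>\<^sub>F \<epsilon> in at_right 0. \<forall>\<^sub>F x in nhds l. ln_along (bypass_contour d A m \<epsilon>) x = bypass_ln d l x (of_real m)"
  using bypass_contour_in_dom[OF assms, of d] bypass_contour_ends[OF m, of d A]
proof eventually_elim
  case (elim \<epsilon>)
  show ?case using elim(1)
  proof eventually_elim
    case (elim x)
    have "continues_to (bypass_contour d A m \<epsilon>) (\<lambda>z. Ln (1 + z * x)) (bypass_ln d l x (of_real m))"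
      using continues_to_bypass_ln[of "bypass_contour d A m \<epsilon>" d l x] elim \<open>_ = 0 \<and> _ = of_real m\<close>
      by (simp add: path_bypass_contour)
    then show ?case unfolding ln_along_def using continues_to_unique by blast
  qed
qed

lemma bypass_end_in_dom:
  assumes m: "m > 0" and l: "l \<in> spectrum_of A" "1 + of_real m * l \<noteq> 0"
  shows "\<forall>\<^sub>F x in nhds l. (l = 0 \<or> x \<noteq> 0) \<and> of_real m \<in> bypass_dom d l x \<and> 0 \<in> bypass_dom d l x"
proof -
  obtain \<epsilon> where \<epsilon>: "\<forall>\<^sub>F x in nhds l. (l = 0 \<or> x \<noteq> 0) \<and> path_image (bypass_contour d A m \<epsilon>) \<subseteq> bypass_dom d l x"
      "bypass_contour d A m \<epsilon> 0 = 0" "bypass_contour d A m \<epsilon> 1 = of_real m"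
    using eventually_happens[OF eventually_conj[OF bypass_contour_in_dom[OF assms, of d] bypass_contour_ends[OF m, of d A]]]
    by (auto simp: trivial_limit_at_right_real)
  have "0 \<in> path_image (bypass_contour d A m \<epsilon>)" "of_real m \<in> path_image (bypass_contour d A m \<epsilon>)"
    using \<epsilon>(2,3) unfolding path_image_def by (auto intro!: rev_image_eqI[of 0] rev_image_eqI[of 1])
  with \<epsilon>(1) show ?thesis by (auto elim!: eventually_mono)
qed

lemma bypass_ln_analytic:
  assumes m: "m > 0" and l: "l \<in> spectrum_of A" "1 + of_real m * l \<noteq> 0"
  shows "(\<lambda>x. bypass_ln d l x (of_real m)) analytic_on {l}"
proof (cases "l = 0")
  case True
  then show ?thesis using l by (auto simp: bypass_ln_def complex_nonpos_Reals_iff intro!: analytic_intros)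
next
  case False
  have "of_real m \<in> bypass_dom d l l" "0 \<in> bypass_dom d l l"
    using eventually_nhds_x_imp_x[OF bypass_end_in_dom[OF assms, of d]] by auto
  then show ?thesis using False by (auto simp: bypass_ln_def[abs_def] bypass_dom_def intro!: analytic_intros)
qed

text \<open>\<open>exp (f x) = 1 + z * x\<close> forces the derivative
  \<open>z / (1 + z * x)\<close> for every branch; the choice of branch enters only the value at
  \<open>l\<close>.\<close>

lemma log_jets:
  assumes f: "f analytic_on {l}" and e: "\<forall>\<^sub>F x in nhds l. exp (f x) = 1 + z * x"
  shows "(deriv ^^ Suc j) f l = (-1) ^ j * fact j * (z / (1 + z * l)) ^ Suc j"
proof -
  obtain r1 where r1: "r1 > 0" "f holomorphic_on ball l r1"
    using f by (auto simp: analytic_on_def)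
  obtain r2 where r2: "r2 > 0" "\<And>x. dist x l < r2 \<Longrightarrow> exp (f x) = 1 + z * x"
    using e unfolding eventually_nhds_metric by auto
  define V where "V = ball l (min r1 r2)"
  have V: "open V" "l \<in> V" using r1 r2 by (auto simp: V_def)
  have hol: "f holomorphic_on V" by (rule holomorphic_on_subset[OF r1(2)]) (auto simp: V_def)
  have ex: "exp (f x) = 1 + z * x" if "x \<in> V" for x using that r2 by (auto simp: V_def dist_commute)
  have ne: "1 + z * x \<noteq> 0" if "x \<in> V" for x using ex[OF that] exp_not_eq_zero by metis
  have "(deriv ^^ Suc j) f x = (-1) ^ j * fact j * (z / (1 + z * x)) ^ Suc j" if "x \<in> V" for x
    using that
  proof (induction j arbitrary: x)
    case 0
    have "((\<lambda>x. exp (f x)) has_field_derivative exp (f x) * deriv f x) (at x)"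
      using holomorphic_derivI[OF hol V(1) 0] by (auto intro!: derivative_eq_intros)
    moreover have "((\<lambda>x. exp (f x)) has_field_derivative z) (at x)"
    proof (rule has_field_derivative_transform_within_open[OF _ V(1) 0])
      show "((\<lambda>x. 1 + z * x) has_field_derivative z) (at x)" by (auto intro!: derivative_eq_intros)
    qed (simp add: ex)
    ultimately have "exp (f x) * deriv f x = z" by (rule DERIV_unique)
    then show ?case using ne[OF 0] ex[OF 0] by (simp add: field_simps)
  next
    case (Suc j)
    have "((\<lambda>x. (-1) ^ j * fact j * (z / (1 + z * x)) ^ Suc j) has_field_derivative
        (-1) ^ Suc j * fact (Suc j) * (z / (1 + z * x)) ^ Suc (Suc j)) (at x)"
    proof -
      have "((\<lambda>x. z / (1 + z * x)) has_field_derivative - ((z / (1 + z * x)) ^ 2)) (at x)"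
        using ne[OF Suc.prems] by (auto intro!: derivative_eq_intros simp: power2_eq_square)
      note der = DERIV_cmult[OF DERIV_power[OF this, of "Suc j"], of "(-1) ^ j * fact j"]
      have "(-1) ^ j * fact j * (of_nat (Suc j) * (- (u ^ 2) * u ^ (Suc j - Suc 0))) = (-1) ^ Suc j * fact (Suc j) * u ^ Suc (Suc j)"
        for u :: complex by (simp add: power2_eq_square algebra_simps)
      then show ?thesis by (rule DERIV_cong[OF der])
    qed
    then have "((deriv ^^ Suc j) f has_field_derivative
        (-1) ^ Suc j * fact (Suc j) * (z / (1 + z * x)) ^ Suc (Suc j)) (at x)"
      by (rule has_field_derivative_transform_within_open[OF _ V(1) Suc.prems]) (rule Suc.IH[symmetric])
    then show ?case by (simp only: funpow.simps o_apply DERIV_imp_deriv)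
  qed
  then show ?thesis using V(2) by blast
qed

lemma dvd_imp_bigo_poly:
  assumes "[:-x, 1:] ^ N dvd (r :: complex poly)"
  shows "poly r \<in> O[at x](\<lambda>z. (z - x) ^ N)"
proof -
  obtain q where r: "r = [:-x, 1:] ^ N * q" using assms by (elim dvdE)
  have "poly q \<in> O[at x](\<lambda>_. 1)" by (intro continuous_imp_bigo_1 continuous_intros)
  then have "(\<lambda>z. (z - x) ^ N * poly q z) \<in> O[at x](\<lambda>z. (z - x) ^ N * 1)"
    by (intro landau_o.big.mult landau_o.big_refl)
  moreover have "poly r = (\<lambda>z. (z - x) ^ N * poly q z)" by (auto simp: r)
  ultimately show ?thesis by simp
qed

text \<open>The germ \<open>h x\<close> may change with the point, as the branch of the logarithm
  does with the eigenvalue.\<close>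

lemma interpolate_analytic_jets:
  assumes "finite S" "\<And>x. x \<in> S \<Longrightarrow> h x analytic_on {x}"
  shows "\<exists>p. \<forall>x\<in>S. (\<lambda>z. h x z - poly p z) \<in> O[at x](\<lambda>z. (z - x) ^ N)"
proof -
  define t where "t x = (\<Sum>j<N. smult ((deriv ^^ j) (h x) x / fact j) ([:-x, 1:] ^ j))" for x
  obtain p where p: "\<And>x. x \<in> S \<Longrightarrow> [:-x, 1:] ^ N dvd p - t x"
    using poly_interpolate_jets[OF assms(1), of N t] by blast
  have "(\<lambda>z. h x z - poly p z) \<in> O[at x](\<lambda>z. (z - x) ^ N)" if x: "x \<in> S" for x
  proof -
    have "(\<lambda>z. poly (p - t x) z) \<in> O[at x](\<lambda>z. (z - x) ^ N)" by (rule dvd_imp_bigo_poly[OF p[OF x]])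
    from sum_in_bigo(2)[OF taylor_bigo[OF assms(2)[OF x], of N] this]
    show ?thesis by (simp add: t_def)
  qed
  then show ?thesis by blast
qed

lemma log_jet_coeff:
  assumes "f analytic_on {l}" "\<forall>\<^sub>F x in nhds l. exp (f x) = 1 + z * x"
  shows "(deriv ^^ j) f l / fact j = (if j = 0 then f l else (-1) ^ (j - 1) / of_nat j * (z / (1 + z * l)) ^ j)"
proof (cases j)
  case (Suc i)
  then show ?thesis using log_jets[OF assms, of i] by (simp del: funpow.simps of_nat_Suc add: fact_Suc)
qed simp

definition bypass_quot :: "side \<Rightarrow> complex \<Rightarrow> real \<Rightarrow> complex \<Rightarrow> complex" where
  "bypass_quot d l m x = (if x = 0 then of_real m else bypass_ln d l x (of_real m) / x)"

text \<open>At \<open>l = 0\<close> this is the difference quotient of \<open>Ln (1 + m x)\<close>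
  at the origin, a removable singularity filled by the derivative \<open>m\<close>.\<close>

lemma bypass_quot_analytic:
  assumes m: "m > 0" and l: "l \<in> spectrum_of A" "1 + of_real m * l \<noteq> 0"
  shows "bypass_quot d l m analytic_on {l}"
proof (cases "l = 0")
  case True
  define f where "f x = Ln (1 + of_real m * x)" for x
  have hol: "f holomorphic_on ball 0 (1 / m)"
    unfolding f_def
  proof (intro holomorphic_intros)
    fix x :: complex assume "x \<in> ball 0 (1 / m)"
    then have "norm (of_real m * x) < 1" using m by (simp add: norm_mult field_simps)
    then have "Re (1 + of_real m * x) > 0" using abs_Re_le_cmod[of "of_real m * x"] by auto
    then show "1 + of_real m * x \<notin> \<real>\<^sub>\<le>\<^sub>0" by (auto simp: complex_nonpos_Reals_iff)
  qed
  have "(f has_field_derivative of_real m) (at 0)"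
    unfolding f_def by (auto intro!: derivative_eq_intros)
  then have "deriv f 0 = of_real m" by (rule DERIV_imp_deriv)
  then have "bypass_quot d l m = (\<lambda>x. if x = 0 then deriv f 0 else (f x - f 0) / (x - 0))"
    using True by (auto simp: bypass_quot_def bypass_ln_def f_def)
  moreover have "(\<lambda>x. if x = 0 then deriv f 0 else (f x - f 0) / (x - 0)) holomorphic_on ball 0 (1 / m)"
    using hol m by (intro pole_lemma) auto
  ultimately have "bypass_quot d l m holomorphic_on ball 0 (1 / m)" by simp
  then show ?thesis using True m by (auto simp: analytic_on_def intro!: exI[of _ "1 / m"])
next
  case False
  have an: "(\<lambda>x. bypass_ln d l x (of_real m) / x) analytic_on {l}"
    using False by (intro analytic_on_divide bypass_ln_analytic[OF assms] analytic_on_ident) auto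
  have "\<forall>\<^sub>F x in nhds l. x \<noteq> 0" using False by (intro t1_space_nhds) auto
  then have "\<forall>\<^sub>F x in nhds l. bypass_quot d l m x = bypass_ln d l x (of_real m) / x"
    by eventually_elim (simp add: bypass_quot_def)
  from iffD2[OF analytic_at_cong[OF this refl] an] show ?thesis .
qed

section \<open>Evaluation of the matrix logarithm and its quotient by interpolating
  polynomials\<close>

lemma matrix_fun_value_iff:
  fixes A :: "complex^'n^'n"
  assumes "\<And>x. x \<in> spectrum_of A \<Longrightarrow> h analytic_on {x}"
    and p: "\<And>x. x \<in> spectrum_of A \<Longrightarrow> (\<lambda>z. h z - poly p z) \<in> O[at x](\<lambda>z. (z - x) ^ CARD('n))"
  shows "matrix_fun_value h A M \<longleftrightarrow> M = poly_matrix p A"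
proof
  assume "M = poly_matrix p A"
  moreover have "h analytic_on spectrum_of A" using assms(1) by (subst analytic_on_analytic_at) blast
  moreover have "\<forall>x\<in>spectrum_of A. \<forall>j<CARD('n). poly ((pderiv ^^ j) p) x = (deriv ^^ j) h x"
    using jets_eq_iff_bigo[OF assms(1), of _ "CARD('n)" p] p by blast
  ultimately show "matrix_fun_value h A M" unfolding matrix_fun_value_def by blast
next
  assume "matrix_fun_value h A M"
  then obtain q where q: "M = poly_matrix q A"
    "\<And>x. x \<in> spectrum_of A \<Longrightarrow> \<forall>j<CARD('n). poly ((pderiv ^^ j) q) x = (deriv ^^ j) h x"
    unfolding matrix_fun_value_def by blast
  have "poly_matrix q A = poly_matrix p A"
  proof (rule poly_matrix_cong)
    fix x assume x: "x \<in> spectrum_of A"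
    have "(\<lambda>z. h z - poly q z) \<in> O[at x](\<lambda>z. (z - x) ^ CARD('n))"
      using q(2)[OF x] jets_eq_iff_bigo[OF assms(1)[OF x], of "CARD('n)" q] by blast
    from sum_in_bigo(2)[OF p[OF x] this]
    have "(\<lambda>z. poly q z - poly p z) \<in> O[at x](\<lambda>z. (z - x) ^ CARD('n))" by simp
    moreover have "poly (q - p) = (\<lambda>z. poly q z - poly p z)" by auto
    ultimately show "[:-x, 1:] ^ CARD('n) dvd q - p" by (intro bigo_poly_imp_dvd) simp
  qed
  then show "M = poly_matrix p A" using q(1) by simp
qed

text \<open>Finiteness of the spectrum makes one range of \<open>\<epsilon>\<close> serve all
  eigenvalues; there the function being evaluated coincides near each \<open>l\<close> with
  \<open>bypass_quot d l m\<close> and so has the same jets.\<close>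

lemma inverse_matrix_Ln_eq:
  fixes A :: "complex^'n^'n"
  assumes m: "m > 0" and inv: "invertible (mat 1 + m *\<^sub>R A)"
    and p: "\<And>l. l \<in> spectrum_of A \<Longrightarrow> (\<lambda>x. bypass_quot d l m x - poly p x) \<in> O[at l](\<lambda>x. (x - l) ^ CARD('n))"
  shows "inverse_matrix_Ln d m A = poly_matrix p A"
proof -
  define h where "h \<epsilon> x = (if x = 0 then of_real m else ln_along (bypass_contour d A m \<epsilon>) x / x)" for \<epsilon> x
  have ne: "1 + of_real m * l \<noteq> 0" if "l \<in> spectrum_of A" for l
    by (rule one_plus_spectrum_nonzero[OF m inv that])
  have "\<forall>\<^sub>F \<epsilon> in at_right 0. \<forall>l\<in>spectrum_of A. \<forall>\<^sub>F x in nhds l. ln_along (bypass_contour d A m \<epsilon>) x = bypass_ln d l x (of_real m)"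
    by (intro eventually_ball_finite finite_spectrum_of ballI ln_along_bypass_contour m ne)
  then have ev: "\<forall>\<^sub>F \<epsilon> in at_right 0. \<forall>M. matrix_fun_value (h \<epsilon>) A M \<longleftrightarrow> M = poly_matrix p A"
  proof eventually_elim
    case (elim \<epsilon>)
    have eq: "\<forall>\<^sub>F x in nhds l. h \<epsilon> x = bypass_quot d l m x" if "l \<in> spectrum_of A" for l
      using elim[rule_format, OF that] by eventually_elim (simp add: h_def bypass_quot_def)
    show ?case
    proof (intro allI matrix_fun_value_iff)
      fix l assume l: "l \<in> spectrum_of A"
      show "h \<epsilon> analytic_on {l}"
        by (rule iffD2[OF analytic_at_cong[OF eq[OF l] refl] bypass_quot_analytic[OF m l ne[OF l]]])
      have "\<forall>\<^sub>F x in at l. h \<epsilon> x - poly p x = bypass_quot d l m x - poly p x"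
        using eq[OF l] unfolding eventually_at_filter by (auto elim!: eventually_mono)
      then show "(\<lambda>z. h \<epsilon> z - poly p z) \<in> O[at l](\<lambda>z. (z - l) ^ CARD('n))"
        using p[OF l] by (rule iffD2[OF landau_o.big.in_cong])
    qed
  qed
  show ?thesis unfolding inverse_matrix_Ln_def
  proof (rule the_equality)
    show "\<forall>\<^sub>F \<epsilon> in at_right 0. matrix_fun_value (\<lambda>x. if x = 0 then of_real m else ln_along (bypass_contour d A m \<epsilon>) x / x) A (poly_matrix p A)"
      using ev by eventually_elim (simp add: h_def[abs_def])
    fix M assume "\<forall>\<^sub>F \<epsilon> in at_right 0. matrix_fun_value (\<lambda>x. if x = 0 then of_real m else ln_along (bypass_contour d A m \<epsilon>) x / x) A M"
    from eventually_happens[OF eventually_conj[OF ev this]]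
    show "M = poly_matrix p A" by (auto simp: h_def[abs_def] trivial_limit_at_right_real)
  qed
qed

text \<open>All eigenvalues lie in a disc on which the series of \<open>ln (1 + z x)\<close>
  converges in \<open>x\<close>, so \<open>A\<close> can be substituted term by term.\<close>

lemma powser_Ln_matrix:
  fixes A :: "complex^'n^'n"
  assumes r: "spectrum_of A \<subseteq> ball 0 r" "r > 0" "norm z * r < 1"
    and p: "\<And>x. x \<in> spectrum_of A \<Longrightarrow> (\<lambda>y. Ln (1 + z * y) - poly p y) \<in> O[at x](\<lambda>y. (y - x) ^ CARD('n))"
  shows "(\<lambda>k. (-1) ^ k * z ^ Suc k / of_nat (Suc k) * matrix_power A (Suc k) $ a $ b) sums poly_matrix p A $ a $ b"
proof -
  define c where "c k = (-1) ^ Suc k / of_nat k * z ^ k" for k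
  have small: "norm (z * x) < 1" if "x \<in> ball 0 r" for x
  proof -
    have "norm z * norm x \<le> norm z * r" using that by (intro mult_left_mono) auto
    then show ?thesis using r(3) by (simp add: norm_mult)
  qed
  have ps: "(\<Sum>k. c k * x ^ k) = Ln (1 + z * x)" if "x \<in> ball 0 r" for x
    using Ln_series[OF small[OF that]] by (simp add: c_def power_mult_distrib sums_iff mult.assoc)
  have an: "(\<lambda>y. Ln (1 + z * y)) analytic_on {x}" if "x \<in> ball 0 r" for x
  proof -
    have "Re (1 + z * x) > 0" using abs_Re_le_cmod[of "z * x"] small[OF that] by auto
    then have "1 + z * x \<notin> \<real>\<^sub>\<le>\<^sub>0" by (auto simp: complex_nonpos_Reals_iff)
    then show ?thesis by (intro analytic_intros) auto
  qed
  have "(\<lambda>k. c k * matrix_power A k $ a $ b) sums poly_matrix p A $ a $ b"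
  proof (rule poly_matrix_powser_sums[OF r(1)])
    have "summable (\<lambda>k. (norm z * r) ^ k)" using r by (intro summable_geometric) (simp add: abs_mult)
    then show "summable (\<lambda>k. norm (c k) * r ^ k)"
    proof (rule summable_comparison_test'[where N = 0])
      fix k :: nat
      have "norm (c k) \<le> norm z ^ k"
      proof (cases "k = 0")
        case False
        have "norm z ^ k / real k \<le> norm z ^ k / 1" using False by (intro divide_left_mono) auto
        then show ?thesis by (simp add: c_def norm_mult norm_divide norm_power)
      qed (simp add: c_def)
      then have "norm (c k) * r ^ k \<le> norm z ^ k * r ^ k" using r(2) by (intro mult_right_mono) auto
      then show "norm (norm (c k) * r ^ k) \<le> (norm z * r) ^ k"
        using r(2) by (simp add: power_mult_distrib abs_mult)
    qed
  next
    fix x j assume x: "x \<in> spectrum_of A" and j: "j < CARD('n)"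
    then have xr: "x \<in> ball 0 r" using r(1) by auto
    have "\<forall>\<^sub>F y in nhds x. y \<in> ball 0 r" using xr by (intro eventually_nhds_in_open) auto
    then have "\<forall>\<^sub>F y in nhds x. (\<Sum>k. c k * y ^ k) = Ln (1 + z * y)" by eventually_elim (rule ps)
    then have "(deriv ^^ j) (\<lambda>x. \<Sum>k. c k * x ^ k) x = (deriv ^^ j) (\<lambda>y. Ln (1 + z * y)) x"
      by (intro higher_deriv_cong_ev refl)
    then show "poly ((pderiv ^^ j) p) x = (deriv ^^ j) (\<lambda>x. \<Sum>k. c k * x ^ k) x"
      using jets_eq_iff_bigo[OF an[OF xr], of "CARD('n)" p] p[OF x] j by simp
  qed
  then have "(\<lambda>k. c (Suc k) * matrix_power A (Suc k) $ a $ b) sums poly_matrix p A $ a $ b"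
    by (subst sums_Suc_iff) (simp add: c_def)
  moreover have "c (Suc k) = (-1) ^ k * z ^ Suc k / of_nat (Suc k)" for k by (simp add: c_def)
  ultimately show ?thesis by simp
qed

text \<open>As a function of \<open>z\<close>, each entry of \<open>Ln (E + z A)\<close> is a linear
  combination of Taylor coefficients of \<open>ln (1 + z x)\<close> at the eigenvalues. These are
  holomorphic in \<open>z\<close> on the domain common to the chosen branches, which contains the
  contour for small \<open>\<epsilon>\<close>. The combination equals the power series near
  \<open>0\<close> and the value of the polynomial at \<open>m\<close>.\<close>

lemma matrix_Ln_eq:
  fixes A :: "complex^'n^'n"
  assumes m: "m > 0" and inv: "invertible (mat 1 + m *\<^sub>R A)"
    and p: "\<And>l. l \<in> spectrum_of A \<Longrightarrow> (\<lambda>x. bypass_ln d l x (of_real m) - poly p x) \<in> O[at l](\<lambda>x. (x - l) ^ CARD('n))"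
  shows "matrix_Ln d m A = poly_matrix p A"
proof -
  let ?S = "spectrum_of A" and ?n = "CARD('n)"
  obtain Q where Q: "\<And>p. poly_matrix p A =
     (\<Sum>x\<in>?S. \<Sum>j<?n. mat (poly ((pderiv ^^ j) p) x / fact j) ** Q x j)"
    by (rule poly_matrix_spectral[of A]) (rule that)
  have ne: "1 + of_real m * l \<noteq> 0" if "l \<in> ?S" for l
    by (rule one_plus_spectrum_nonzero[OF m inv that])
  \<comment> \<open>The Taylor coefficients in \<open>x\<close> of the logarithm; the branch is
    confined to \<open>j = 0\<close>.\<close>
  define c where "c x z j = (if j = 0 then bypass_ln d x x z else (-1) ^ (j - 1) / of_nat j * (z / (1 + z * x)) ^ j)" for x z and j :: nat
  define G where "G a b z = (\<Sum>x\<in>?S. \<Sum>j<?n. c x z j * Q x j $ a $ b)" for a b z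
  define U where "U = (\<Inter>x\<in>?S. bypass_dom d x x)"
  have "open U" unfolding U_def by (intro open_INT finite_spectrum_of ballI open_bypass_dom)
  have dom0: "0 \<in> bypass_dom d x x" "of_real m \<in> bypass_dom d x x" if "x \<in> ?S" for x
    using eventually_nhds_x_imp_x[OF bypass_end_in_dom[OF m that ne[OF that], of d]] by auto
  have hol: "G a b holomorphic_on U" for a b
  proof -
    have "(\<lambda>z. c x z j) holomorphic_on U" if x: "x \<in> ?S" for x j
    proof (cases "j = 0")
      case True
      have "bypass_ln d x x holomorphic_on U"
        by (rule holomorphic_on_subset[OF holomorphic_bypass_ln]) (use x in \<open>auto simp: U_def\<close>)
      then show ?thesis using True by (simp add: c_def)
    next
      case False
      have "1 + z * x \<noteq> 0" if "z \<in> U" for z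
        using exp_bypass_ln[of x x z d] that x exp_not_eq_zero[of "bypass_ln d x x z"] by (auto simp: U_def)
      then show ?thesis using False by (auto simp: c_def intro!: holomorphic_intros)
    qed
    then show ?thesis unfolding G_def by (intro holomorphic_intros)
  qed
  \<comment> \<open>The branches \<open>f x\<close> are kept free so that the computation serves
    twice: for the bypassing branches at \<open>z = m\<close> and for the principal one at small
    \<open>z\<close>.\<close>
  have coeff: "poly_matrix q A $ a $ b = G a b z"
    if q: "\<And>x. x \<in> ?S \<Longrightarrow> (\<lambda>y. f x y - poly q y) \<in> O[at x](\<lambda>y. (y - x) ^ ?n)"
      and f: "\<And>x. x \<in> ?S \<Longrightarrow> f x analytic_on {x}" "\<And>x. x \<in> ?S \<Longrightarrow> \<forall>\<^sub>F y in nhds x. exp (f x y) = 1 + z * y"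
        "\<And>x. x \<in> ?S \<Longrightarrow> f x x = bypass_ln d x x z" for q f z a b
    unfolding Q G_def sum_component mat_mult_nth
  proof (intro sum.cong refl)
    fix x j assume x: "x \<in> ?S" and j: "j \<in> {..<?n}"
    have "poly ((pderiv ^^ j) q) x / fact j = (deriv ^^ j) (f x) x / fact j"
      using jets_eq_iff_bigo[OF f(1)[OF x], of ?n q] q[OF x] j by simp
    also have "\<dots> = c x z j" using log_jet_coeff[OF f(1,2)[OF x], of j] f(3)[OF x] by (simp add: c_def)
    finally show "poly ((pderiv ^^ j) q) x / fact j * Q x j $ a $ b = c x z j * Q x j $ a $ b" by simp
  qed
  have Gm: "G a b (of_real m) = poly_matrix p A $ a $ b" for a b
  proof (rule coeff[symmetric, where f = "\<lambda>l x. bypass_ln d l x (of_real m)"])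
    fix x assume x: "x \<in> ?S"
    show "(\<lambda>y. bypass_ln d x y (of_real m)) analytic_on {x}" by (rule bypass_ln_analytic[OF m x ne[OF x]])
    show "\<forall>\<^sub>F y in nhds x. exp (bypass_ln d x y (of_real m)) = 1 + of_real m * y"
      using bypass_end_in_dom[OF m x ne[OF x], of d] by eventually_elim (simp add: exp_bypass_ln)
  qed (use p in auto)
  have G0: "\<forall>\<^sub>F z in nhds 0. (\<Sum>k. (-1) ^ k * z ^ Suc k / of_nat (Suc k) * matrix_power A (Suc k) $ a $ b) = G a b z" for a b
  proof -
    obtain r where r: "r > 0" "?S \<subseteq> ball 0 r"
      using bounded_subset_ballD[OF finite_imp_bounded[OF finite_spectrum_of[of A]], of 0] by blast
    have "\<forall>\<^sub>F z in nhds 0. z \<in> ball 0 (1 / r)" using r(1) by (intro eventually_nhds_in_open) auto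
    moreover have "\<forall>\<^sub>F z in nhds 0. \<forall>x\<in>?S. bypass_ln d x x z = Ln (1 + z * x)"
      using dom0 by (intro eventually_ball_finite finite_spectrum_of ballI bypass_ln_eq_Ln) auto
    ultimately show ?thesis
    proof eventually_elim
      case (elim z)
      then have zr: "norm z * r < 1" using r(1) by (simp add: field_simps)
      have pos: "1 + z * x \<notin> \<real>\<^sub>\<le>\<^sub>0" if "x \<in> ball 0 r" for x
      proof -
        have "norm z * norm x \<le> norm z * r" using that by (intro mult_left_mono) auto
        then have "norm (z * x) < 1" using zr by (simp add: norm_mult)
        then have "Re (1 + z * x) > 0" using abs_Re_le_cmod[of "z * x"] by auto
        then show ?thesis by (auto simp: complex_nonpos_Reals_iff)
      qed
      have an: "(\<lambda>y. Ln (1 + z * y)) analytic_on {x}" if "x \<in> ?S" for x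
        using pos r(2) that by (intro analytic_intros) auto
      obtain q where q: "\<And>x. x \<in> ?S \<Longrightarrow> (\<lambda>y. Ln (1 + z * y) - poly q y) \<in> O[at x](\<lambda>y. (y - x) ^ ?n)"
        using interpolate_analytic_jets[OF finite_spectrum_of[of A] an, of ?n] by blast
      have "poly_matrix q A $ a $ b = G a b z"
      proof (rule coeff[OF q an])
        fix x assume x: "x \<in> ?S"
        have "\<forall>\<^sub>F y in nhds x. y \<in> ball 0 r" using x r(2) by (intro eventually_nhds_in_open) auto
        then show "\<forall>\<^sub>F y in nhds x. exp (Ln (1 + z * y)) = 1 + z * y"
        proof eventually_elim
          case (elim y)
          then have "1 + z * y \<noteq> 0" using pos[of y] by auto
          then show ?case by simp
        qed
        show "Ln (1 + z * x) = bypass_ln d x x z" using x elim by simp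
      qed
      with powser_Ln_matrix[OF r(2,1) zr q, of a b] show ?case by (simp add: sums_iff)
    qed
  qed
  have ev: "\<forall>\<^sub>F \<epsilon> in at_right 0. \<forall>i j. continues_to (bypass_contour d A m \<epsilon>)
          (\<lambda>z. \<Sum>k. (-1) ^ k * z ^ Suc k / of_nat (Suc k) * matrix_power A (Suc k) $ i $ j)
          (poly_matrix p A $ i $ j)"
  proof -
    have "\<forall>\<^sub>F \<epsilon> in at_right 0. \<forall>x\<in>?S. \<forall>\<^sub>F y in nhds x. (x = 0 \<or> y \<noteq> 0) \<and> path_image (bypass_contour d A m \<epsilon>) \<subseteq> bypass_dom d x y"
      by (intro eventually_ball_finite finite_spectrum_of ballI bypass_contour_in_dom m ne)
    with bypass_contour_ends[OF m, of d A] show ?thesis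
    proof eventually_elim
      case (elim \<epsilon>)
      let ?\<gamma> = "bypass_contour d A m \<epsilon>"
      have sub: "path_image ?\<gamma> \<subseteq> U"
        unfolding U_def using elim(2) eventually_nhds_x_imp_x by blast
      have g: "?\<gamma> 0 = 0" "?\<gamma> 1 = of_real m" using elim(1) by auto
      show ?case
      proof (intro allI)
        fix a b
        have "\<forall>\<^sub>F z in nhds (?\<gamma> 0). G a b z = (\<Sum>k. (-1) ^ k * z ^ Suc k / of_nat (Suc k) * matrix_power A (Suc k) $ a $ b)"
          unfolding g(1) using G0[of a b] by eventually_elim (rule sym)
        from continues_to_holomorphic[OF path_bypass_contour hol \<open>open U\<close> sub this]
        show "continues_to ?\<gamma> (\<lambda>z. \<Sum>k. (-1) ^ k * z ^ Suc k / of_nat (Suc k) * matrix_power A (Suc k) $ a $ b) (poly_matrix p A $ a $ b)"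
          unfolding g(2) Gm .
      qed
    qed
  qed
  show ?thesis unfolding matrix_Ln_def
  proof (rule the_equality)
    show "\<forall>\<^sub>F \<epsilon> in at_right 0. \<forall>i j. continues_to (bypass_contour d A m \<epsilon>)
          (\<lambda>z. \<Sum>k. (-1) ^ k * z ^ Suc k / of_nat (Suc k) * matrix_power A (Suc k) $ i $ j) (poly_matrix p A $ i $ j)"
      by (rule ev)
    fix L assume "\<forall>\<^sub>F \<epsilon> in at_right 0. \<forall>i j. continues_to (bypass_contour d A m \<epsilon>)
          (\<lambda>z. \<Sum>k. (-1) ^ k * z ^ Suc k / of_nat (Suc k) * matrix_power A (Suc k) $ i $ j) (L $ i $ j)"
    from eventually_happens[OF eventually_conj[OF ev this]]
    obtain \<epsilon> where "\<And>i j. continues_to (bypass_contour d A m \<epsilon>)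
          (\<lambda>z. \<Sum>k. (-1) ^ k * z ^ Suc k / of_nat (Suc k) * matrix_power A (Suc k) $ i $ j) (L $ i $ j)"
        "\<And>i j. continues_to (bypass_contour d A m \<epsilon>)
          (\<lambda>z. \<Sum>k. (-1) ^ k * z ^ Suc k / of_nat (Suc k) * matrix_power A (Suc k) $ i $ j) (poly_matrix p A $ i $ j)"
      by (auto simp: trivial_limit_at_right_real)
    then have "L $ i $ j = poly_matrix p A $ i $ j" for i j by (rule continues_to_unique)
    then show "L = poly_matrix p A" by (simp add: vec_eq_iff)
  qed
qed

subsection \<open>The flow across a gap\<close>

lemma norm_exp_diff_le: "norm (exp z - (\<Sum>k<N. z ^ k / fact k)) \<le> exp (norm z) * norm z ^ N" for z :: complex
proof (cases N)
  case 0
  show ?thesis using 0 norm_exp[of z] by simp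
next
  case (Suc n)
  have "norm (exp z - (\<Sum>k\<le>n. z ^ k / fact k)) \<le> exp \<bar>Re z\<bar> * norm z ^ Suc n / fact n"
    by (rule Taylor_exp)
  also have "\<dots> \<le> exp (norm z) * norm z ^ Suc n / 1"
    by (intro frac_le mult_mono) (auto simp: abs_Re_le_cmod)
  finally show ?thesis using Suc by (simp add: lessThan_Suc_atMost)
qed

lemma bigo_exp_taylor:
  fixes w :: "complex \<Rightarrow> complex"
  assumes w: "w \<in> O[at x](\<lambda>z. z - x)"
  shows "(\<lambda>z. exp (w z) - (\<Sum>k<N. w z ^ k / fact k)) \<in> O[at x](\<lambda>z. (z - x) ^ N)"
proof -
  obtain c where c: "c > 0" "\<forall>\<^sub>F z in at x. norm (w z) \<le> c * norm (z - x)"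
    using w by (elim landau_o.bigE)
  have "\<forall>\<^sub>F z in at x. dist z x < 1" unfolding eventually_at by (intro exI[of _ 1]) auto
  with c(2) have "\<forall>\<^sub>F z in at x. norm (exp (w z) - (\<Sum>k<N. w z ^ k / fact k)) \<le> (exp c * c ^ N) * norm ((z - x) ^ N)"
  proof eventually_elim
    case (elim z)
    have "c * norm (z - x) \<le> c * 1" using elim(2) c(1) by (intro mult_left_mono) (auto simp: dist_norm)
    then have "norm (w z) \<le> c" using elim(1) by linarith
    have "norm (exp (w z) - (\<Sum>k<N. w z ^ k / fact k)) \<le> exp (norm (w z)) * norm (w z) ^ N"
      by (rule norm_exp_diff_le)
    also have "\<dots> \<le> exp c * (c * norm (z - x)) ^ N"
      using elim(1) \<open>norm (w z) \<le> c\<close> by (intro mult_mono power_mono) auto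
    finally show ?case by (simp add: power_mult_distrib norm_power)
  qed
  then show ?thesis by (rule bigoI)
qed

text \<open>\<open>J k z\<close> is the integral from \<open>0\<close> to \<open>z\<close> of
  \<open>exp (c * t) * t ^ k / fact k\<close>. The last two relations are integration by parts,
  written without a division so that \<open>c = 0\<close> is allowed.\<close>

lemma exists_exp_power_integrals:
  fixes c :: complex
  obtains J where "\<And>k. J k 0 = 0"
    "\<And>k z. (J k has_field_derivative exp (c * z) * z ^ k / fact k) (at z)"
    "\<And>z. c * J 0 z = exp (c * z) - 1"
    "\<And>k z. c * J (Suc k) z + J k z = exp (c * z) * z ^ Suc k / fact (Suc k)"
proof -
  define E where "E k z = exp (c * z) * z ^ k / fact k" for k z
  have "\<exists>F. \<forall>z. (F has_field_derivative E k z) (at z)" for k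
  proof -
    have "E k holomorphic_on UNIV" unfolding E_def by (intro holomorphic_intros) auto
    then show ?thesis using holomorphic_convex_primitive'[of UNIV "E k"] by auto
  qed
  then obtain F where F: "\<And>k z. (F k has_field_derivative E k z) (at z)" by metis
  define J where "J k z = F k z - F k 0" for k z
  have J': "(J k has_field_derivative E k z) (at z)" for k z
    unfolding J_def using F by (auto intro!: derivative_eq_intros)
  have const: "f z = f 0" if "\<And>u. (f has_field_derivative 0) (at u)" for f :: "complex \<Rightarrow> complex" and z
    using has_field_derivative_zero_constant[of UNIV f] that by auto
  have E0: "(E 0 has_field_derivative c * E 0 z) (at z)" for z
    unfolding E_def by (auto intro!: derivative_eq_intros)
  have ES: "(E (Suc k) has_field_derivative c * E (Suc k) z + E k z) (at z)" for k z
  proof -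
    have "((\<lambda>z. exp (c * z) * z ^ Suc k) has_field_derivative
        exp (c * z) * (of_nat (Suc k) * z ^ k) + exp (c * z) * c * z ^ Suc k) (at z)"
    proof -
      have "((\<lambda>z. exp (c * z)) has_field_derivative exp (c * z) * c) (at z)" by (auto intro!: derivative_eq_intros)
      from DERIV_mult[OF this DERIV_power[OF DERIV_ident, where n = "Suc k"]] show ?thesis
        by (rule DERIV_cong) (simp add: algebra_simps)
    qed
    from DERIV_cdivide[OF this, of "fact (Suc k)"]
    have "((\<lambda>z. exp (c * z) * z ^ Suc k / fact (Suc k)) has_field_derivative
        (exp (c * z) * (of_nat (Suc k) * z ^ k) + exp (c * z) * c * z ^ Suc k) / fact (Suc k)) (at z)" .
    moreover have "of_nat (Suc k) / fact (Suc k) = (1 / fact k :: complex)"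
      by (simp add: fact_Suc del: of_nat_Suc)
    then have "exp (c * z) * (of_nat (Suc k) * z ^ k) / fact (Suc k) = E k z"
      unfolding E_def by (metis (no_types, lifting) mult.commute mult.left_commute mult_1 times_divide_eq_right)
    ultimately show ?thesis unfolding E_def[abs_def] by (simp add: add_divide_distrib ac_simps)
  qed
  show ?thesis
  proof (rule that[of J])
    show "J k 0 = 0" for k by (simp add: J_def)
    show "(J k has_field_derivative exp (c * z) * z ^ k / fact k) (at z)" for k z using J' by (simp add: E_def)
    show "c * J 0 z = exp (c * z) - 1" for z
    proof -
      have "((\<lambda>z. c * J 0 z - E 0 z) has_field_derivative 0) (at u)" for u
        using DERIV_diff[OF DERIV_cmult[OF J', of c 0 u] E0] by simp
      from const[OF this, of z] show ?thesis by (simp add: J_def E_def algebra_simps)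
    qed
    show "c * J (Suc k) z + J k z = exp (c * z) * z ^ Suc k / fact (Suc k)" for k z
    proof -
      have "((\<lambda>z. c * J (Suc k) z + J k z - E (Suc k) z) has_field_derivative 0) (at u)" for u
        using DERIV_diff[OF DERIV_add[OF DERIV_cmult[OF J', of c "Suc k" u] J'[of k]] ES[of k]] by simp
      from const[OF this, of z] show ?thesis by (simp add: J_def E_def)
    qed
  qed
qed

text \<open>A truncation of the identity that \<open>c + w\<close> times the integral of
  \<open>exp ((c + w) t)\<close> over \<open>[0, v]\<close> is \<open>exp ((c + w) v) - 1\<close>.
  The sum telescopes and leaves one term in \<open>w ^ Suc N\<close>.\<close>

lemma poly_exp_integral_identity:
  fixes w :: "'a::comm_ring_1 poly"
  assumes "c * J 0 = e 0 - 1" "\<And>k. c * J (Suc k) + J k = e (Suc k)"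
  shows "([:c:] + w) * (\<Sum>k<Suc N. smult (J k) (w ^ k)) + 1 = (\<Sum>k<Suc N. smult (e k) (w ^ k)) + smult (J N) (w ^ Suc N)"
proof (induction N)
  case 0
  show ?case using assms(1) by (simp add: algebra_simps) (simp add: one_pCons)
next
  case (Suc N)
  have "([:c:] + w) * smult (J (Suc N)) (w ^ Suc N) + smult (J N) (w ^ Suc N)
      = smult (c * J (Suc N) + J N) (w ^ Suc N) + smult (J (Suc N)) (w ^ Suc (Suc N))"
    by (simp add: algebra_simps smult_add_left smult_add_right)
  note step = this[unfolded assms(2)]
  define T where "T = (\<Sum>k<Suc N. smult (J k) (w ^ k))"
  define R where "R = (\<Sum>k<Suc N. smult (e k) (w ^ k))"
  have "([:c:] + w) * (T + smult (J (Suc N)) (w ^ Suc N)) + 1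
      = (([:c:] + w) * T + 1) + ([:c:] + w) * smult (J (Suc N)) (w ^ Suc N)"
    by (simp only: distrib_left add_ac)
  also have "\<dots> = R + (([:c:] + w) * smult (J (Suc N)) (w ^ Suc N) + smult (J N) (w ^ Suc N))"
    using Suc.IH by (simp only: T_def[symmetric] R_def[symmetric] add_ac)
  finally show ?case
    unfolding step sum.lessThan_Suc[of _ "Suc N"] T_def[symmetric] R_def[symmetric] by (simp only: add.assoc)
qed

text \<open>For \<open>x \<noteq> 0\<close> the factor \<open>X\<close> is invertible modulo
  \<open>(X - x)^n\<close>; at \<open>0\<close> its removal costs one order.\<close>

lemma dvd_mult_X_cancel:
  assumes "[:-x, 1:] ^ Suc n dvd [:0, 1:] * (q :: 'a::field poly)"
  shows "[:-x, 1:] ^ n dvd q"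
proof (cases "x = 0")
  case True
  then have "[:0, 1:] * [:0, 1:] ^ n dvd [:0, 1:] * q" using assms by (simp only: power_Suc minus_zero)
  then show ?thesis using True by (simp only: dvd_mult_cancel_left minus_zero) simp
next
  case False
  have "comaximal ([:-x, 1:] ^ n) ([:-0, 1:] ^ 1)" using False by (rule comaximal_linear_power)
  then obtain a b where ab: "a * [:-x, 1:] ^ n + b * [:0, 1:] = 1" by (auto simp: comaximal_def)
  have "q = (a * [:-x, 1:] ^ n + b * [:0, 1:]) * q" by (simp only: ab mult_1)
  also have "\<dots> = (a * q) * [:-x, 1:] ^ n + b * ([:0, 1:] * q)" by (simp only: distrib_left distrib_right mult_ac)
  also have "[:-x, 1:] ^ n dvd \<dots>"
  proof (rule dvd_add)
    have "[:-x, 1:] ^ n dvd [:0, 1:] * q" by (rule power_le_dvd[OF assms]) simp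
    then show "[:-x, 1:] ^ n dvd b * ([:0, 1:] * q)" by (rule dvd_mult)
  qed (rule dvd_triv_right)
  finally show ?thesis .
qed

lemma bounded_linear_mat_mult: "bounded_linear (\<lambda>c. mat c ** (R :: complex^'n^'n))"
proof -
  have "linear (\<lambda>c. mat c ** (R :: complex^'n^'n))"
    by (rule linearI) (simp_all add: vec_eq_iff mat_mult_nth algebra_simps)
  then show ?thesis by (simp add: linear_conv_bounded_linear)
qed

lemma bigo_exp_minus_1:
  fixes f :: "complex \<Rightarrow> complex"
  assumes "f \<in> O[F](g)" "f \<in> O[F](\<lambda>_. 1)"
  shows "(\<lambda>z. exp (f z) - 1) \<in> O[F](g)"
proof -
  obtain c where c: "\<forall>\<^sub>F z in F. norm (f z) \<le> c * norm (g z)" using assms(1) by (elim landau_o.bigE)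
  obtain b where b: "\<forall>\<^sub>F z in F. norm (f z) \<le> b * norm (1::complex)" using assms(2) by (elim landau_o.bigE)
  from c b have "\<forall>\<^sub>F z in F. norm (exp (f z) - 1) \<le> (exp b * c) * norm (g z)"
  proof eventually_elim
    case (elim z)
    have "norm (exp (f z) - 1) \<le> exp (norm (f z)) * norm (f z)"
      using norm_exp_diff_le[of "f z" 1] by simp
    also have "\<dots> \<le> exp b * (c * norm (g z))" using elim by (intro mult_mono) auto
    finally show ?case by (simp add: mult.assoc)
  qed
  then show ?thesis by (rule bigoI)
qed

text \<open>\<open>G v\<close> is \<open>(exp (v L) - E) / A\<close>, realised by polynomials in \<open>A\<close>. The interpolation is one order
  higher than the multiplicities require, because the factor \<open>A\<close> is cancelled at the end.\<close>

lemma gap_flow: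
  fixes A :: "complex^'n^'n" and d :: side
  assumes m: "m > 0" and inv: "invertible (mat 1 + m *\<^sub>R A)"
  defines "L \<equiv> matrix_Ln d m A" and "M \<equiv> inverse_matrix_Ln d m A"
  obtains G where "G 0 = 0" "G 1 = mat (of_real m)"
    "\<And>v. (G has_vector_derivative (L ** G v + M)) (at v)" "M ** A = L"
proof -
  let ?S = "spectrum_of A" and ?n = "CARD('n)"
  define N where "N = Suc ?n"
  have ne: "1 + of_real m * l \<noteq> 0" if "l \<in> ?S" for l
    by (rule one_plus_spectrum_nonzero[OF m inv that])
  obtain ph where ph: "\<And>l. l \<in> ?S \<Longrightarrow> (\<lambda>x. bypass_quot d l m x - poly ph x) \<in> O[at l](\<lambda>x. (x - l) ^ N)"
    using interpolate_analytic_jets[OF finite_spectrum_of[of A], of "\<lambda>l. bypass_quot d l m" N]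
      bypass_quot_analytic[OF m _ ne] by blast
  have lower: "f \<in> O[at l](\<lambda>x. (x - l) ^ k)" if "f \<in> O[at l](\<lambda>x. (x - l) ^ N)" "k \<le> N" for f :: "complex \<Rightarrow> complex" and l k
  proof -
    have "[:-l, 1:] ^ k dvd [:-l, 1:] ^ N" using that(2) by (rule le_imp_power_dvd)
    from dvd_imp_bigo_poly[OF this] have "poly ([:-l, 1:] ^ N) \<in> O[at l](\<lambda>x. (x - l) ^ k)" .
    moreover have "poly ([:-l, 1:] ^ N) = (\<lambda>x. (x - l) ^ N)" by auto
    ultimately have "(\<lambda>x. (x - l) ^ N) \<in> O[at l](\<lambda>x. (x - l) ^ k)" by simp
    with that(1) show ?thesis by (rule landau_o.big_trans)
  qed
  define p where "p = [:0, 1:] * ph"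
  define b where "b l x = bypass_ln d l x (of_real m)" for l x
  have p: "(\<lambda>x. b l x - poly p x) \<in> O[at l](\<lambda>x. (x - l) ^ N)" if l: "l \<in> ?S" for l
  proof -
    have "(\<lambda>x. x) \<in> O[at l](\<lambda>_. 1)" by (intro continuous_imp_bigo_1 continuous_intros)
    from landau_o.big.mult[OF this ph[OF l]]
    have *: "(\<lambda>x. x * (bypass_quot d l m x - poly ph x)) \<in> O[at l](\<lambda>x. (x - l) ^ N)" by simp
    have "x * (bypass_quot d l m x - poly ph x) = b l x - poly p x" if "x \<noteq> 0 \<or> l = 0" for x
      using that by (cases "x = 0") (auto simp: bypass_quot_def b_def p_def bypass_ln_def algebra_simps)
    moreover have "\<forall>\<^sub>F x in at l. x \<noteq> 0 \<or> l = 0"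
      by (cases "l = 0") (auto intro!: eventually_at_filter[THEN iffD2] eventually_mono[OF t1_space_nhds])
    ultimately have "\<forall>\<^sub>F x in at l. x * (bypass_quot d l m x - poly ph x) = b l x - poly p x"
      by (rule eventually_mono[rotated])
    from landau_o.big.in_cong[OF this] * show ?thesis by blast
  qed
  have M: "M = poly_matrix ph A"
    unfolding M_def by (rule inverse_matrix_Ln_eq[OF m inv]) (rule lower[OF ph], auto simp: N_def)
  have L: "L = poly_matrix p A"
    unfolding L_def by (rule matrix_Ln_eq[OF m inv]) (rule lower[OF p[unfolded b_def]], auto simp: N_def)
  have "\<exists>e. \<forall>x\<in>?S. [:-x, 1:] ^ N dvd e - (if x = y then 1 else 0)" for y
    by (rule poly_interpolate_jets[OF finite_spectrum_of])
  then obtain e where e: "\<And>x y. x \<in> ?S \<Longrightarrow> [:-x, 1:] ^ N dvd e y - (if x = y then 1 else 0)" by metis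
  define c where "c l = b l l" for l
  have "\<exists>J. (\<forall>k. J k 0 = 0) \<and> (\<forall>k z. (J k has_field_derivative exp (c l * z) * z ^ k / fact k) (at z))
      \<and> (\<forall>z. c l * J 0 z = exp (c l * z) - 1)
      \<and> (\<forall>k z. c l * J (Suc k) z + J k z = exp (c l * z) * z ^ Suc k / fact (Suc k))" for l
    by (rule exists_exp_power_integrals[of "c l"]) blast
  then have "\<exists>J. \<forall>l. (\<forall>k. J l k 0 = 0) \<and> (\<forall>k z. (J l k has_field_derivative exp (c l * z) * z ^ k / fact k) (at z))
      \<and> (\<forall>z. c l * J l 0 z = exp (c l * z) - 1)
      \<and> (\<forall>k z. c l * J l (Suc k) z + J l k z = exp (c l * z) * z ^ Suc k / fact (Suc k))"
    by (intro choice allI)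
  then obtain J where J: "\<And>l k. J l k 0 = 0"
    "\<And>l k z. (J l k has_field_derivative exp (c l * z) * z ^ k / fact k) (at z)"
    "\<And>l z. c l * J l 0 z = exp (c l * z) - 1"
    "\<And>l k z. c l * J l (Suc k) z + J l k z = exp (c l * z) * z ^ Suc k / fact (Suc k)"
    by blast
  \<comment> \<open>Near \<open>l\<close> the polynomial \<open>p\<close> is the constant
    \<open>c l\<close> plus \<open>w l\<close>, which is nilpotent modulo \<open>(X - l)^N\<close>.
    Thus \<open>E l v\<close> is \<open>exp (v * p)\<close> to order \<open>N\<close>, and
    \<open>s l v\<close> is its integral from \<open>0\<close> to \<open>v\<close>. Times
    \<open>ph\<close> the integral is \<open>(exp (v * p) - 1) / X\<close>, because
    \<open>p = X * ph\<close>.\<close>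
  define w where "w l = p - [:c l:]" for l
  define s where "s l v = (\<Sum>k<N. smult (J l k v) (w l ^ k))" for l v
  define E where "E l v = (\<Sum>k<N. smult (exp (c l * v) * v ^ k / fact k) (w l ^ k))" for l v
  define P where "P v = (\<Sum>l\<in>?S. e l * (ph * s l v))" for v
  define P' where "P' v = (\<Sum>l\<in>?S. e l * (ph * E l v))" for v
  have local: "[:-x, 1:] ^ N dvd (\<Sum>l\<in>?S. e l * q l) - q x" if x: "x \<in> ?S" for x q
  proof -
    have "(\<Sum>l\<in>?S. (if x = l then 1 else 0) * q l) = (\<Sum>l\<in>?S. if x = l then q l else 0)"
      by (intro sum.cong) auto
    also have "\<dots> = q x" using x finite_spectrum_of[of A] by simp
    finally have "(\<Sum>l\<in>?S. e l * q l) - q x = (\<Sum>l\<in>?S. (e l - (if x = l then 1 else 0)) * q l)"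
      by (simp add: left_diff_distrib sum_subtractf)
    also have "[:-x, 1:] ^ N dvd \<dots>" using e[OF x] by (intro dvd_sum dvd_mult2)
    finally show ?thesis .
  qed
  have w_dvd: "[:-x, 1:] dvd w x" if x: "x \<in> ?S" for x
  proof -
    have "(\<lambda>y. b x y) analytic_on {x}" unfolding b_def by (rule bypass_ln_analytic[OF m x ne[OF x]])
    from jets_eq_iff_bigo[OF this, of N p] p[OF x] have "poly p x = b x x"
      by (auto simp: N_def dest!: spec[of _ 0])
    then have "poly (w x) x = 0" by (simp add: w_def c_def)
    then show ?thesis by (simp add: poly_eq_0_iff_dvd)
  qed
  have ident: "[:-x, 1:] ^ N dvd p * s x v + 1 - E x v" if x: "x \<in> ?S" for x v
  proof -
    have "([:c x:] + w x) * s x v + 1 = E x v + smult (J x ?n v) (w x ^ N)"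
      unfolding s_def E_def N_def by (rule poly_exp_integral_identity) (use J(3,4) in auto)
    then have "p * s x v + 1 - E x v = smult (J x ?n v) (w x ^ N)"
      by (simp add: w_def)
    moreover have "[:-x, 1:] ^ N dvd w x ^ N" using w_dvd[OF x] by (rule dvd_power_same)
    ultimately show ?thesis by (simp only: dvd_smult)
  qed
  have n_le: "[:-x, 1:] ^ ?n dvd q" if "[:-x, 1:] ^ N dvd q" for x :: complex and q
    using that by (rule power_le_dvd) (simp add: N_def)
  \<comment> \<open>Locally \<open>P' v\<close> is \<open>ph * E\<close>, \<open>P v\<close> is
    \<open>ph * s\<close>, and \<open>E\<close> is \<open>p * s + 1\<close>: this is the
    differential equation of \<open>G\<close> at the level of polynomials.\<close>
  have P'_eq: "poly_matrix (P' v) A = poly_matrix (p * P v + ph) A" for v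
  proof (rule poly_matrix_cong, rule n_le)
    fix x assume x: "x \<in> ?S"
    have "[:-x, 1:] ^ N dvd (P' v - ph * E x v) - p * (P v - ph * s x v) - ph * (p * s x v + 1 - E x v)"
    proof -
      have "[:-x, 1:] ^ N dvd P' v - ph * E x v" "[:-x, 1:] ^ N dvd p * (P v - ph * s x v)"
        "[:-x, 1:] ^ N dvd ph * (p * s x v + 1 - E x v)"
        unfolding P_def P'_def by (rule local[OF x], rule dvd_mult[OF local[OF x]], rule dvd_mult[OF ident[OF x]])
      then show ?thesis by (simp only: dvd_diff)
    qed
    also have "(P' v - ph * E x v) - p * (P v - ph * s x v) - ph * (p * s x v + 1 - E x v) = P' v - (p * P v + ph)"
      by (simp add: algebra_simps)
    finally show "[:-x, 1:] ^ N dvd P' v - (p * P v + ph)" .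
  qed
  \<comment> \<open>\<open>exp p\<close> and \<open>exp (b x)\<close> have contact of order
    \<open>N\<close> because \<open>p\<close> and \<open>b x\<close> do, and the latter exponential
    is \<open>1 + m z\<close>.\<close>
  have E1: "[:-x, 1:] ^ N dvd E x 1 - [:1, of_real m:]" if x: "x \<in> ?S" for x
  proof (rule bigo_poly_imp_dvd)
    have "poly (w x) \<in> O[at x](\<lambda>z. (z - x) ^ 1)" using w_dvd[OF x] by (intro dvd_imp_bigo_poly) simp
    then have "(\<lambda>z. exp (poly (w x) z) - (\<Sum>k<N. poly (w x) z ^ k / fact k)) \<in> O[at x](\<lambda>z. (z - x) ^ N)"
      by (intro bigo_exp_taylor) simp
    then have 1: "(\<lambda>z. exp (c x) * (exp (poly (w x) z) - (\<Sum>k<N. poly (w x) z ^ k / fact k))) \<in> O[at x](\<lambda>z. (z - x) ^ N)"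
      by simp
    have "(\<lambda>z. exp (b x z - poly p z) - 1) \<in> O[at x](\<lambda>z. (z - x) ^ N)"
      using lower[OF p[OF x], of 0] by (intro bigo_exp_minus_1 p[OF x]) simp
    moreover have "(\<lambda>z. exp (poly p z)) \<in> O[at x](\<lambda>_. 1)" by (intro continuous_imp_bigo_1 continuous_intros)
    ultimately have 2: "(\<lambda>z. exp (poly p z) * (exp (b x z - poly p z) - 1)) \<in> O[at x](\<lambda>z. 1 * (z - x) ^ N)"
      by (intro landau_o.big.mult)
    have "\<forall>\<^sub>F z in nhds x. exp (b x z) = 1 + of_real m * z"
      using bypass_end_in_dom[OF m x ne[OF x], of d] by eventually_elim (simp add: exp_bypass_ln b_def)
    then have "\<forall>\<^sub>F z in at x. exp (b x z) = 1 + of_real m * z"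
      by (auto simp: eventually_at_filter elim: eventually_mono)
    then have "\<forall>\<^sub>F z in at x. - (exp (c x) * (exp (poly (w x) z) - (\<Sum>k<N. poly (w x) z ^ k / fact k)))
        - exp (poly p z) * (exp (b x z - poly p z) - 1) = poly (E x 1 - [:1, of_real m:]) z"
    proof eventually_elim
      case (elim z)
      have "exp (c x) * exp (poly (w x) z) = exp (poly p z)" by (simp add: w_def flip: exp_add)
      moreover have "exp (poly p z) * exp (b x z - poly p z) = 1 + of_real m * z" by (simp add: elim flip: exp_add)
      moreover have "poly (E x 1) z = exp (c x) * (\<Sum>k<N. poly (w x) z ^ k / fact k)"
        by (simp add: E_def poly_sum sum_distrib_left)
      ultimately show ?case by (simp add: algebra_simps)
    qed
    from landau_o.big.in_cong[OF this] sum_in_bigo(2)[OF landau_o.big.uminus_in_iff[THEN iffD2, OF 1] 2[simplified mult_1]]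
    show "poly (E x 1 - [:1, of_real m:]) \<in> O[at x](\<lambda>z. (z - x) ^ N)" by blast
  qed
  have G1: "poly_matrix (P 1) A = mat (of_real m)"
  proof -
    have "poly_matrix (P 1) A = poly_matrix [:of_real m:] A"
    proof (rule poly_matrix_cong)
      fix x assume x: "x \<in> ?S"
      \<comment> \<open>Hence \<open>p * s\<close> is \<open>m * X\<close> to order
        \<open>N\<close>; cancelling \<open>X\<close> leaves \<open>ph * s = m\<close> to order
        \<open>CARD('n)\<close>.\<close>
      have "[:-x, 1:] ^ N dvd (p * s x 1 + 1 - E x 1) + (E x 1 - [:1, of_real m:])"
        by (intro dvd_add ident E1 x)
      also have "(p * s x 1 + 1 - E x 1) + (E x 1 - [:1, of_real m:]) = [:0, 1:] * (ph * s x 1 - [:of_real m:])"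
        by (simp add: p_def algebra_simps one_pCons)
      finally have "[:-x, 1:] ^ ?n dvd ph * s x 1 - [:of_real m:]" unfolding N_def by (rule dvd_mult_X_cancel)
      moreover have "[:-x, 1:] ^ ?n dvd P 1 - ph * s x 1" unfolding P_def by (intro n_le local x)
      ultimately have "[:-x, 1:] ^ ?n dvd (P 1 - ph * s x 1) + (ph * s x 1 - [:of_real m:])" by (intro dvd_add)
      then show "[:-x, 1:] ^ ?n dvd P 1 - [:of_real m:]" by (simp only: add_diff_eq diff_add_cancel)
    qed
    then show ?thesis by simp
  qed
  define R where "R l k = poly_matrix (e l * (ph * w l ^ k)) A" for l k
  have PR: "poly_matrix (P z) A = (\<Sum>l\<in>?S. \<Sum>k<N. mat (J l k z) ** R l k)" for z
    unfolding P_def s_def R_def sum_distrib_left mult_smult_right poly_matrix_sum poly_matrix_smult ..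
  have PR': "poly_matrix (P' z) A = (\<Sum>l\<in>?S. \<Sum>k<N. mat (exp (c l * z) * z ^ k / fact k) ** R l k)" for z
    unfolding P'_def E_def R_def sum_distrib_left mult_smult_right poly_matrix_sum poly_matrix_smult ..
  show ?thesis
  proof (rule that[of "\<lambda>v. poly_matrix (P (of_real v)) A"])
    show "poly_matrix (P (of_real 0)) A = 0" by (simp add: PR J(1))
    show "poly_matrix (P (of_real 1)) A = mat (of_real m)" using G1 by simp
    show "M ** A = L" by (simp add: M L p_def poly_matrix_pCons poly_matrix_commute_self)
    fix v :: real
    have "((\<lambda>v. poly_matrix (P (of_real v)) A) has_vector_derivative poly_matrix (P' (of_real v)) A) (at v)"
      unfolding PR PR'
      by (intro has_vector_derivative_sum bounded_linear.has_vector_derivative[OF bounded_linear_mat_mult]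
            has_vector_derivative_real_field J(2))
    then show "((\<lambda>v. poly_matrix (P (of_real v)) A) has_vector_derivative L ** poly_matrix (P (of_real v)) A + M) (at v)"
      by (simp add: P'_eq M L poly_matrix_add poly_matrix_mult)
  qed
qed

section \<open>Estimates for short gaps\<close>

lemma spectrum_norm_le:
  fixes A :: "complex^'n^'n"
  assumes "\<And>i j. norm (A $ i $ j) \<le> K" "x \<in> spectrum_of A"
  shows "norm x \<le> real CARD('n) * K"
proof -
  obtain v where v: "v \<noteq> 0" "A *v v = x *s v" by (rule spectrum_eigenvector[OF assms(2)])
  \<comment> \<open>The eigenvalue equation is compared in the row where the eigenvector has its
    largest component.\<close>
  define b where "b = Max (range (\<lambda>i. norm (v $ i)))"
  have vb: "norm (v $ i) \<le> b" for i unfolding b_def by (intro Max_ge) auto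
  have "b \<in> range (\<lambda>i. norm (v $ i))" unfolding b_def by (intro Max_in) auto
  then obtain i where i: "b = norm (v $ i)" by blast
  have "b > 0"
  proof (rule ccontr)
    assume "\<not> b > 0"
    then have "v $ j = 0" for j using vb[of j] norm_ge_zero[of "v $ j"] by (simp only: norm_le_zero_iff[symmetric])
    then show False using v(1) by (simp add: vec_eq_iff)
  qed
  have "norm x * b = norm ((A *v v) $ i)" by (simp add: v(2) i norm_mult)
  also have "\<dots> \<le> (\<Sum>j\<in>UNIV. norm (A $ i $ j * v $ j))"
    unfolding matrix_vector_mult_def by (simp add: norm_sum)
  also have "\<dots> \<le> (\<Sum>j\<in>(UNIV::'n set). K * b)"
    unfolding norm_mult using assms(1) vb order_trans[OF norm_ge_zero assms(1)] by (intro sum_mono mult_mono) auto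
  finally show ?thesis using \<open>b > 0\<close> by (simp flip: mult.assoc)
qed

lemma matrix_power_norm_le:
  fixes A :: "complex^'n^'n"
  assumes "\<And>i j. norm (A $ i $ j) \<le> K"
  shows "norm (matrix_power A k $ i $ j) \<le> (real CARD('n) * K) ^ k"
proof (induction k arbitrary: i j)
  case 0
  show ?case by (simp add: mat_def)
next
  case (Suc k)
  have K: "0 \<le> K" using order_trans[OF norm_ge_zero assms] .
  have "norm (matrix_power A (Suc k) $ i $ j) \<le> (\<Sum>l\<in>UNIV. norm (A $ i $ l * matrix_power A k $ l $ j))"
    by (simp add: matrix_matrix_mult_def norm_sum)
  also have "\<dots> \<le> (\<Sum>l\<in>(UNIV::'n set). K * (real CARD('n) * K) ^ k)"
    unfolding norm_mult using assms Suc.IH K by (intro sum_mono mult_mono) auto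
  finally show ?case by (simp add: mult_ac)
qed

text \<open>No singular value lies in \<open>(0, m)\<close>, so the contour is a straight segment.
  Along it both branches continue \<open>Ln (1 + z * x)\<close>, and uniqueness of continuation
  identifies them at \<open>m\<close>.\<close>

lemma bypass_ln_small:
  assumes m: "m > 0" and l: "l \<in> spectrum_of A" and small: "\<And>x. x \<in> spectrum_of A \<Longrightarrow> m * norm x < 1"
  shows "\<forall>\<^sub>F x in nhds l. bypass_ln d l x (of_real m) = Ln (1 + of_real m * x)"
proof -
  have ne: "1 + of_real m * l \<noteq> 0"
  proof
    assume "1 + of_real m * l = 0"
    then have "norm (of_real m * l) = 1" by (metis add_eq_0_iff norm_minus_cancel norm_one)
    then show False using small[OF l] m by (simp add: norm_mult)
  qed
  have sing: "singular_values A m = {}"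
  proof -
    have False if p: "0 < p" "p < m" "- 1 / of_real p \<in> spectrum_of A" for p
    proof -
      have "m * norm (- 1 / of_real p :: complex) = m / p" using p by (simp add: norm_divide)
      then show False using small[OF p(3)] p by simp
    qed
    then show ?thesis by (auto simp: singular_values_eq)
  qed
  define \<gamma> where "\<gamma> = bypass_contour d A m"
  have \<gamma>: "\<gamma> \<epsilon> v = of_real (m * v)" for \<epsilon> v
    by (simp add: \<gamma>_def bypass_contour_def sing complex_eq_iff)
  obtain \<epsilon> where \<epsilon>: "\<forall>\<^sub>F x in nhds l. (l = 0 \<or> x \<noteq> 0) \<and> path_image (\<gamma> \<epsilon>) \<subseteq> bypass_dom d l x"
    using eventually_happens[OF bypass_contour_in_dom[OF m l ne, of d]]
    by (auto simp: trivial_limit_at_right_real \<gamma>_def)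
  have "\<forall>\<^sub>F x in nhds l. norm x < 1 / m"
  proof -
    have "norm l < 1 / m" using small[OF l] m by (simp add: field_simps)
    then have "\<forall>\<^sub>F x in nhds l. x \<in> ball 0 (1 / m)" by (intro eventually_nhds_in_open) auto
    then show ?thesis by simp
  qed
  with \<epsilon> show ?thesis
  proof eventually_elim
    case (elim x)
    have p: "path (\<gamma> \<epsilon>)" unfolding \<gamma>_def by (rule path_bypass_contour)
    have "path_image (\<gamma> \<epsilon>) \<subseteq> bypass_dom d 0 x"
    proof
      fix z assume "z \<in> path_image (\<gamma> \<epsilon>)"
      then obtain v where v: "0 \<le> v" "v \<le> 1" "z = of_real (m * v)" by (auto simp: path_image_def \<gamma>)
      have "norm z \<le> m" using v m by (simp add: norm_mult mult_left_le)
      then have "norm z * norm x \<le> m * norm x" by (intro mult_right_mono) auto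
      also have "\<dots> < 1" using elim(2) m by (simp add: field_simps)
      finally have "norm (z * x) < 1" by (simp add: norm_mult)
      then have "Re (1 + z * x) > 0" using abs_Re_le_cmod[of "z * x"] by auto
      then show "z \<in> bypass_dom d 0 x" by (auto simp: bypass_dom_def complex_nonpos_Reals_iff)
    qed
    from continues_to_bypass_ln[OF this p] have 1: "continues_to (\<gamma> \<epsilon>) (\<lambda>z. Ln (1 + z * x)) (bypass_ln d 0 x (of_real m))"
      by (simp add: \<gamma>)
    have "continues_to (\<gamma> \<epsilon>) (\<lambda>z. Ln (1 + z * x)) (bypass_ln d l x (of_real m))"
      using continues_to_bypass_ln[of "\<gamma> \<epsilon>" d l x] elim p by (simp add: \<gamma>)
    from continues_to_unique[OF this 1] show ?case by (simp add: bypass_ln_def)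
  qed
qed

text \<open>The series begins \<open>m - m^2 A / 2\<close>; beyond the constant term it is dominated
  by a geometric series of ratio at most \<open>1 / 2\<close>, whose sum is the factor
  \<open>2\<close>.\<close>

lemma inverse_matrix_Ln_small:
  fixes A :: "complex^'n^'n" and K :: real
  defines "R \<equiv> real CARD('n) * K"
  assumes K: "\<And>i j. norm (A $ i $ j) \<le> K" "K > 0" and m: "m > 0" "m * R \<le> 1 / 2"
    and inv: "invertible (mat 1 + m *\<^sub>R A)"
  shows "norm ((inverse_matrix_Ln d m A - mat (of_real m)) $ a $ b) \<le> 2 * R * m\<^sup>2"
proof -
  have R: "R > 0" using K(2) by (simp add: R_def)
  have spec: "norm x \<le> R" if "x \<in> spectrum_of A" for x
    unfolding R_def by (rule spectrum_norm_le[OF K(1) that])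
  have small: "m * norm x < 1" if "x \<in> spectrum_of A" for x
  proof -
    have "m * norm x \<le> m * R" using spec[OF that] m(1) by (intro mult_left_mono) auto
    then show ?thesis using m(2) by linarith
  qed
  have ne: "1 + of_real m * l \<noteq> 0" if "l \<in> spectrum_of A" for l
    by (rule one_plus_spectrum_nonzero[OF m(1) inv that])
  obtain ph where ph: "\<And>l. l \<in> spectrum_of A \<Longrightarrow> (\<lambda>x. bypass_quot d l m x - poly ph x) \<in> O[at l](\<lambda>x. (x - l) ^ CARD('n))"
    using interpolate_analytic_jets[OF finite_spectrum_of[of A], of "\<lambda>l. bypass_quot d l m" "CARD('n)"]
      bypass_quot_analytic[OF m(1) _ ne] by blast
  have M: "inverse_matrix_Ln d m A = poly_matrix ph A"
    by (rule inverse_matrix_Ln_eq[OF m(1) inv ph])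
  \<comment> \<open>Larger than the spectral bound, so that the open disc contains the spectrum,
    while \<open>m * r\<close> is still at most \<open>3 / 4\<close>.\<close>
  define r where "r = 3 / 2 * R"
  have mr: "m * r < 1" "r > 0" using m R by (auto simp: r_def)
  define c :: "nat \<Rightarrow> complex" where "c k = (-1) ^ k * of_real (m ^ Suc k) / of_nat (Suc k)" for k
  have nc: "norm (c k) \<le> m * m ^ k" for k
  proof -
    have "m ^ Suc k / real (Suc k) \<le> m ^ Suc k / 1" using m(1) by (intro divide_left_mono) auto
    then show ?thesis using m(1) by (simp add: c_def norm_mult norm_divide norm_power del: of_nat_Suc)
  qed
  have ps: "(\<Sum>k. c k * x ^ k) = (if x = 0 then of_real m else Ln (1 + of_real m * x) / x)" if "m * norm x < 1" for x
  proof (cases "x = 0")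
    case True
    then show ?thesis using powser_zero[of c] by (simp add: c_def)
  next
    case False
    have "norm (of_real m * x) < 1" using that m(1) by (simp add: norm_mult)
    from Ln_series[OF this] have "(\<lambda>n. (-1) ^ Suc (Suc n) / of_nat (Suc n) * (of_real m * x) ^ Suc n) sums Ln (1 + of_real m * x)"
      by (subst sums_Suc_iff) simp
    from sums_divide[OF this, of x] have "(\<lambda>n. c n * x ^ n) sums (Ln (1 + of_real m * x) / x)"
      using False by (simp add: c_def power_mult_distrib mult_ac del: of_nat_Suc)
    then show ?thesis using False by (simp add: sums_iff)
  qed
  have "(\<lambda>k. c k * matrix_power A k $ a $ b) sums poly_matrix ph A $ a $ b"
  proof (rule poly_matrix_powser_sums)
    show "spectrum_of A \<subseteq> ball 0 r" using spec R by (fastforce simp: r_def)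
    have "summable (\<lambda>k. m * (m * r) ^ k)" using mr m(1) by (intro summable_mult summable_geometric) simp
    then show "summable (\<lambda>k. norm (c k) * r ^ k)"
    proof (rule summable_comparison_test'[where N = 0])
      fix k :: nat
      have "norm (c k) * r ^ k \<le> m * m ^ k * r ^ k" using nc mr by (intro mult_right_mono) auto
      then show "norm (norm (c k) * r ^ k) \<le> m * (m * r) ^ k" using mr by (simp add: power_mult_distrib mult_ac abs_mult)
    qed
  next
    fix x j assume x: "x \<in> spectrum_of A" and j: "j < CARD('n)"
    have "norm x < 1 / m" using small[OF x] m by (simp add: field_simps)
    then have "\<forall>\<^sub>F y in nhds x. y \<in> ball 0 (1 / m)" by (intro eventually_nhds_in_open) auto
    moreover have "\<forall>\<^sub>F y in nhds x. bypass_ln d x y (of_real m) = Ln (1 + of_real m * y)"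
      by (rule bypass_ln_small[OF m(1) x]) (rule small)
    ultimately have "\<forall>\<^sub>F y in nhds x. (\<Sum>k. c k * y ^ k) = bypass_quot d x m y"
    proof eventually_elim
      case (elim y)
      have "m * norm y < 1" using elim(1) m by (simp add: field_simps)
      then show ?case using elim(2) by (simp add: ps bypass_quot_def)
    qed
    then have "(deriv ^^ j) (\<lambda>x. \<Sum>k. c k * x ^ k) x = (deriv ^^ j) (bypass_quot d x m) x"
      by (intro higher_deriv_cong_ev refl)
    then show "poly ((pderiv ^^ j) ph) x = (deriv ^^ j) (\<lambda>x. \<Sum>k. c k * x ^ k) x"
      using jets_eq_iff_bigo[OF bypass_quot_analytic[OF m(1) x ne[OF x], of d], of "CARD('n)" ph] ph[OF x] j by simp
  qed
  then have "(\<lambda>k. c (Suc k) * matrix_power A (Suc k) $ a $ b) sums (poly_matrix ph A $ a $ b - c 0 * matrix_power A 0 $ a $ b)"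
    by (subst sums_Suc_iff) (simp only: diff_add_cancel)
  moreover have "c 0 * matrix_power A 0 $ a $ b = mat (of_real m) $ a $ b" by (simp add: c_def mat_def)
  ultimately have "(\<lambda>k. c (Suc k) * matrix_power A (Suc k) $ a $ b) sums (poly_matrix ph A $ a $ b - mat (of_real m) $ a $ b)"
    by simp
  moreover have "(\<lambda>k. m * (m * R) * (1 / 2) ^ k) sums (m * (m * R) * 2)"
    using sums_mult[OF geometric_sums[of "1 / 2 :: real"], of "m * (m * R)"] by simp
  moreover have "norm (c (Suc k) * matrix_power A (Suc k) $ a $ b) \<le> m * (m * R) * (1 / 2) ^ k" for k
  proof -
    have "norm (c (Suc k) * matrix_power A (Suc k) $ a $ b) \<le> (m * m ^ Suc k) * R ^ Suc k"
      unfolding norm_mult R_def using nc[of "Suc k"] m(1) by (intro mult_mono matrix_power_norm_le K(1)) auto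
    also have "\<dots> = m * (m * R) * (m * R) ^ k" by (simp add: power_mult_distrib)
    also have "\<dots> \<le> m * (m * R) * (1 / 2) ^ k" using m R by (intro mult_left_mono power_mono) auto
    finally show ?thesis .
  qed
  ultimately have "norm (poly_matrix ph A $ a $ b - mat (of_real m) $ a $ b) \<le> m * (m * R) * 2"
    by (rule norm_sums_le)
  then show ?thesis by (simp add: M power2_eq_square mult_ac)
qed

subsection \<open>The renormalization function\<close>

text \<open>Countable additivity as an unordered sum, the form in which \<open>renorm_on\<close>
  sums over gaps.\<close>

lemma has_sum_measure_disjoint:
  assumes "countable I" "disjoint_family_on A I" "\<And>i. i \<in> I \<Longrightarrow> A i \<in> sets M"
    and "emeasure M (\<Union>i\<in>I. A i) \<noteq> \<infinity>"
  shows "((\<lambda>i. measure M (A i)) has_sum measure M (\<Union>i\<in>I. A i)) I"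
proof (cases "finite I")
  case True
  have "A i \<in> fmeasurable M" if "i \<in> I" for i
  proof (rule fmeasurableI2)
    show "(\<Union>i\<in>I. A i) \<in> fmeasurable M"
      using assms(3,4) True by (intro fmeasurableI sets.finite_UN) (auto simp: less_top)
  qed (use that assms(3) in auto)
  then have "measure M (\<Union>i\<in>I. A i) = (\<Sum>i\<in>I. measure M (A i))"
    using True assms(2) by (intro measure_UNION') (auto simp: disjoint_family_on_def pairwise_def disjnt_def)
  then show ?thesis using True by (simp add: has_sum_finiteI)
next
  case False
  let ?g = "from_nat_into I"
  have bij: "bij_betw ?g UNIV I" by (rule bij_betw_from_nat_into[OF assms(1) False])
  have "range (\<lambda>n. A (?g n)) = A ` range ?g" by (simp only: image_image)
  also have "range ?g = I" by (rule bij_betw_imp_surj_on[OF bij])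
  finally have un: "(\<Union>n. A (?g n)) = (\<Union>i\<in>I. A i)" by (simp only:)
  have "(\<lambda>n. measure M (A (?g n))) sums measure M (\<Union>n. A (?g n))"
  proof (rule measure_UNION)
    show "range (\<lambda>n. A (?g n)) \<subseteq> sets M" using assms(3) bij_betw_apply[OF bij] by blast
    show "disjoint_family (\<lambda>n. A (?g n))"
      unfolding disjoint_family_on_def
    proof (intro ballI impI)
      fix m n :: nat assume "m \<noteq> n"
      then have "?g m \<noteq> ?g n" using bij_betw_imp_inj_on[OF bij] by (simp add: inj_eq)
      moreover have "?g m \<in> I" "?g n \<in> I" using bij_betw_apply[OF bij] by auto
      ultimately show "A (?g m) \<inter> A (?g n) = {}" using assms(2) by (simp add: disjoint_family_on_def)
    qed
  qed (use assms(4) un in simp)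
  then have "((\<lambda>n. measure M (A (?g n))) has_sum measure M (\<Union>i\<in>I. A i)) UNIV"
    unfolding un by (rule sums_nonneg_imp_has_sum) simp
  then show ?thesis using has_sum_reindex_bij_betw[OF bij, of "\<lambda>i. measure M (A i)"] by simp
qed

locale time_scale_set =
  fixes T :: "real set"
  assumes ts: "time_scale T"
begin

lemma closed_T: "closed T" and zero_in_T: "0 \<in> T"
  using ts by (auto simp: time_scale_def)

lemma ex_greater: "\<exists>r\<in>T. t < r" and ex_less: "\<exists>r\<in>T. r < t"
  using ts by (auto simp: time_scale_def bdd_above_def bdd_below_def not_le)

lemma origin_eq: "origin T = 0"
  unfolding origin_def by (rule cInf_eq_minimum) (use zero_in_T in auto)

lemma sigma_ge: "t \<le> sigma T t"
  unfolding sigma_def by (rule cInf_greatest) (use ex_greater in auto)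

lemma sigma_le: "r \<in> T \<Longrightarrow> t < r \<Longrightarrow> sigma T t \<le> r"
  unfolding sigma_def by (rule cInf_lower) (auto intro!: bdd_belowI[of _ t])

lemma mu_ge_0: "0 \<le> mu T t"
  using sigma_ge by (simp add: mu_def)

lemma sigma_in_T: assumes "t \<in> T" shows "sigma T t \<in> T"
proof (cases "sigma T t = t")
  case False
  then have lt: "t < sigma T t" using sigma_ge[of t] by simp
  have "{r \<in> T. r > t} = T \<inter> {sigma T t..}" using sigma_le lt by fastforce
  then have "closed {r \<in> T. r > t}" using closed_T by (simp add: closed_Int)
  then have "Inf {r \<in> T. r > t} \<in> {r \<in> T. r > t}"
    using ex_greater by (intro closed_contains_Inf) (auto intro!: bdd_belowI[of _ t])
  then show ?thesis by (simp add: sigma_def)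
qed (use assms in simp)

definition prev :: "real \<Rightarrow> real" where "prev t = Sup {\<tau> \<in> T. \<tau> \<le> t}"

lemma prev_in_T: "prev t \<in> T" and prev_le: "prev t \<le> t"
proof -
  have "closed {\<tau> \<in> T. \<tau> \<le> t}" using closed_T by (simp add: closed_Collect_conj closed_Collect_le continuous_on_id)
  then have "prev t \<in> {\<tau> \<in> T. \<tau> \<le> t}"
    unfolding prev_def
  proof (intro closed_contains_Sup)
    obtain r where "r \<in> T" "r < t" using ex_less by blast
    then have "r \<in> {\<tau> \<in> T. \<tau> \<le> t}" by simp
    then show "{\<tau> \<in> T. \<tau> \<le> t} \<noteq> {}" by blast
  qed (auto intro!: bdd_aboveI[of _ t])
  then show "prev t \<in> T" "prev t \<le> t" by auto
qed

lemma prev_ge: "r \<in> T \<Longrightarrow> r \<le> t \<Longrightarrow> r \<le> prev t"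
  unfolding prev_def by (rule cSup_upper) (auto intro!: bdd_aboveI[of _ t])

lemma gap_bounds:
  assumes "t \<notin> T" shows "prev t < t" "t < sigma T (prev t)" "mu T (prev t) > 0"
proof -
  show 1: "prev t < t" using prev_in_T[of t] prev_le[of t] assms by (metis order_le_less)
  show 2: "t < sigma T (prev t)"
  proof (rule ccontr)
    assume "\<not> t < sigma T (prev t)"
    then have "sigma T (prev t) \<le> prev t" by (intro prev_ge sigma_in_T prev_in_T) auto
    then have eq: "sigma T (prev t) = prev t" using sigma_ge[of "prev t"] by simp
    obtain r where "r \<in> T" "prev t < r" "r < t"
    proof -
      have "Inf {r \<in> T. r > prev t} < t" using eq 1 by (simp add: sigma_def)
      then show ?thesis using that ex_greater by (subst (asm) cInf_less_iff) (auto intro!: bdd_belowI[of _ "prev t"])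
    qed
    then show False using prev_ge[of r t] by simp
  qed
  show "mu T (prev t) > 0" using 1 2 by (simp add: mu_def)
qed

lemma no_gap_points: "r \<in> T \<Longrightarrow> r \<le> t \<or> sigma T t \<le> r"
  using sigma_le by force

lemma prev_eqI: "a \<in> T \<Longrightarrow> a \<le> t \<Longrightarrow> t < sigma T a \<Longrightarrow> prev t = a"
  using prev_ge[of a t] prev_in_T[of t] prev_le[of t] no_gap_points[of "prev t" a] by force

text \<open>The left ends in \<open>[v, w)\<close> of the gaps: the index set of the sums in
  \<open>renorm_on\<close>.\<close>

definition rs :: "real \<Rightarrow> real \<Rightarrow> real set" where
  "rs v w = {\<tau> \<in> {v..<w} \<inter> T. mu T \<tau> > 0}"

lemma rs_disjoint: "disjoint_family_on (\<lambda>\<tau>. {\<tau><..<sigma T \<tau>}) (rs v w)"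
  unfolding disjoint_family_on_def
proof (intro ballI impI)
  fix a b assume ab: "a \<in> rs v w" "b \<in> rs v w" "a \<noteq> b"
  then have "b \<le> a \<or> sigma T a \<le> b" "a \<le> b \<or> sigma T b \<le> a"
    using no_gap_points[of b a] no_gap_points[of a b] by (auto simp: rs_def)
  then show "{a<..<sigma T a} \<inter> {b<..<sigma T b} = {}" using ab(3) by auto
qed

lemma countable_rs: "countable (rs v w)"
proof -
  let ?f = "\<lambda>\<tau>. {\<tau><..<sigma T \<tau>}"
  have ne: "?f \<tau> \<noteq> {}" if "\<tau> \<in> rs v w" for \<tau> using that by (auto simp: rs_def mu_def)
  have "pairwise disjnt (?f ` rs v w)"
    using rs_disjoint[of v w] by (auto simp: pairwise_def disjoint_family_on_def disjnt_def)
  then have "countable (?f ` rs v w)" by (intro countable_disjoint_open_subsets) auto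
  moreover have "inj_on ?f (rs v w)"
    using rs_disjoint[of v w] ne unfolding inj_on_def disjoint_family_on_def by (metis inf.idem)
  ultimately show ?thesis by (rule countable_image_inj_on)
qed

lemma gaps_Un:
  assumes "v \<in> T" "w \<in> T" "v \<le> w"
  shows "(\<Union>\<tau>\<in>rs v w. {\<tau><..<sigma T \<tau>}) = {v..w} - T"
proof (intro equalityI subsetI)
  fix x assume "x \<in> (\<Union>\<tau>\<in>rs v w. {\<tau><..<sigma T \<tau>})"
  then obtain \<tau> where \<tau>: "\<tau> \<in> rs v w" "\<tau> < x" "x < sigma T \<tau>" by auto
  then show "x \<in> {v..w} - T"
    using no_gap_points[of x \<tau>] no_gap_points[OF assms(2), of \<tau>] by (auto simp: rs_def)
next
  fix x assume x: "x \<in> {v..w} - T"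
  then have "prev x \<in> rs v w"
    using gap_bounds[of x] prev_in_T[of x] prev_ge[of v x] assms by (auto simp: rs_def)
  then show "x \<in> (\<Union>\<tau>\<in>rs v w. {\<tau><..<sigma T \<tau>})" using gap_bounds[of x] x by force
qed

text \<open>The gaps partition \<open>[v, w]\<close> minus \<open>T\<close>. This sum dominates the
  logarithmic one and also serves to bound it from below.\<close>

lemma mu_has_sum:
  assumes "v \<in> T" "w \<in> T" "v \<le> w"
  shows "(mu T has_sum (w - v - measure lebesgue ({v..w} \<inter> T))) (rs v w)"
proof -
  have "((\<lambda>\<tau>. measure lebesgue {\<tau><..<sigma T \<tau>}) has_sum measure lebesgue (\<Union>\<tau>\<in>rs v w. {\<tau><..<sigma T \<tau>})) (rs v w)"
  proof (rule has_sum_measure_disjoint[OF countable_rs rs_disjoint])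
    have "{v..w} - T \<in> lmeasurable" using closed_T by (intro fmeasurable_Diff lmeasurable_cbox[of v w, simplified] lborelD) auto
    then show "emeasure lebesgue (\<Union>\<tau>\<in>rs v w. {\<tau><..<sigma T \<tau>}) \<noteq> \<infinity>"
      unfolding gaps_Un[OF assms] by (rule fmeasurableD2[folded infinity_ennreal_def])
  qed auto
  moreover have "measure lebesgue {\<tau><..<sigma T \<tau>} = mu T \<tau>" for \<tau>
    using sigma_ge[of \<tau>] by (simp add: mu_def)
  moreover have "measure lebesgue ({v..w} - T) = w - v - measure lebesgue ({v..w} \<inter> T)"
  proof -
    have "{v..w} \<inter> T \<in> lmeasurable"
      using closed_T by (intro lmeasurable_compact compact_Int_closed) auto
    moreover have "{v..w} - T \<in> lmeasurable"
      using closed_T by (intro fmeasurable_Diff lmeasurable_cbox[of v w, simplified] lborelD) auto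
    moreover have "{v..w} = ({v..w} \<inter> T) \<union> ({v..w} - T)" "({v..w} \<inter> T) \<inter> ({v..w} - T) = {}" by auto
    ultimately have "measure lebesgue {v..w} = measure lebesgue ({v..w} \<inter> T) + measure lebesgue ({v..w} - T)"
      using measure_Un3[of "{v..w} \<inter> T" lebesgue "{v..w} - T"] by (simp only: measure_empty diff_zero)
    then show ?thesis using assms(3) by simp
  qed
  ultimately show ?thesis unfolding gaps_Un[OF assms] by simp
qed

lemma mu_le: "\<tau> \<in> rs v w \<Longrightarrow> w \<in> T \<Longrightarrow> \<tau> + mu T \<tau> \<le> w"
  using sigma_le[of w \<tau>] by (auto simp: rs_def mu_def)

lemma ln_mu_lower: "mu T \<tau> / (1 + mu T \<tau>) \<le> ln (1 + mu T \<tau>)"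
proof -
  have m: "0 < 1 + mu T \<tau>" using mu_ge_0[of \<tau>] by simp
  have "ln (inverse (1 + mu T \<tau>)) \<le> inverse (1 + mu T \<tau>) - 1" using m by (intro ln_le_minus_one) simp
  then have "1 - inverse (1 + mu T \<tau>) \<le> ln (1 + mu T \<tau>)" using m by (simp add: ln_inverse)
  also have "1 - inverse (1 + mu T \<tau>) = mu T \<tau> / (1 + mu T \<tau>)" using m by (simp add: field_simps)
  finally show ?thesis .
qed

lemma ln_mu_summable:
  assumes "v \<in> T" "w \<in> T" "v \<le> w"
  shows "(\<lambda>\<tau>. ln (1 + mu T \<tau>)) summable_on rs v w"
  by (rule summable_on_comparison_test[OF has_sum_imp_summable[OF mu_has_sum[OF assms]]])
     (auto intro!: ln_add_one_self_le_self ln_ge_zero mu_ge_0)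

text \<open>Being additive, it becomes the increment of \<open>s\<close> between any two points of
  \<open>T\<close>, which frees the estimates from the case distinction at the origin.\<close>

definition incr :: "real \<Rightarrow> real \<Rightarrow> real" where
  "incr v w = measure lebesgue ({v..w} \<inter> T) + infsum (\<lambda>\<tau>. ln (1 + mu T \<tau>)) (rs v w)"

lemma incr_add:
  assumes "u \<in> T" "v \<in> T" "w \<in> T" "u \<le> v" "v \<le> w"
  shows "incr u w = incr u v + incr v w"
proof -
  have T: "T \<in> sets lebesgue" using closed_T by auto
  have "measure lebesgue ({u..w} \<inter> T) = measure lebesgue ({u..v} \<inter> T) + measure lebesgue ({v..w} \<inter> T)"
  proof -
    have "{u..w} \<inter> T = ({u..v} \<inter> T) \<union> ({v..w} \<inter> T)" using assms by auto
    moreover have "negligible (({u..v} \<inter> T) \<inter> ({v..w} \<inter> T))"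
      by (rule negligible_subset[of "{v}"]) auto
    then have "measure lebesgue (({u..v} \<inter> T) \<inter> ({v..w} \<inter> T)) = 0" by (rule negligible_imp_measure0)
    moreover have "{a..b} \<inter> T \<in> lmeasurable" for a b
      using closed_T by (intro lmeasurable_compact compact_Int_closed) auto
    ultimately show ?thesis by (simp add: measure_Un3)
  qed
  moreover have "rs u w = rs u v \<union> rs v w" "rs u v \<inter> rs v w = {}"
    using assms by (auto simp: rs_def)
  ultimately show ?thesis
    using infsum_Un_disjoint[OF ln_mu_summable[of u v] ln_mu_summable[of v w]] assms
    by (simp add: incr_def)
qed

lemma renorm_T: assumes "t \<in> T" shows "renorm T t = (if 0 \<le> t then incr 0 t else - incr t 0)"
  using assms by (auto simp: renorm_def renorm_on_def origin_eq incr_def rs_def)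

lemma renorm_diff:
  assumes "v \<in> T" "w \<in> T" "v \<le> w"
  shows "renorm T w - renorm T v = incr v w"
  using incr_add[of 0 v w] incr_add[of v 0 w] incr_add[of v w 0] assms zero_in_T by (auto simp: renorm_T)

text \<open>The upper bound comes from \<open>ln (1 + \<mu>) \<le> \<mu>\<close>, the lower one from
  \<open>\<mu> / (1 + \<mu>) \<ge> (1 - (w - v)) \<mu>\<close>, since a gap inside
  \<open>[v, w]\<close> has length at most \<open>w - v\<close>. The quadratic error expresses that
  \<open>s\<close> has slope \<open>1\<close> along \<open>T\<close> at right-dense points.\<close>

lemma incr_sandwich:
  assumes "v \<in> T" "w \<in> T" "v \<le> w"
  shows "incr v w \<le> w - v" "w - v - (w - v)\<^sup>2 \<le> incr v w"
proof -
  let ?L = "\<lambda>\<tau>. ln (1 + mu T \<tau>)"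
  have S: "(mu T has_sum (w - v - measure lebesgue ({v..w} \<inter> T))) (rs v w)" by (rule mu_has_sum[OF assms])
  have L: "(?L has_sum infsum ?L (rs v w)) (rs v w)" by (rule has_sum_infsum[OF ln_mu_summable[OF assms]])
  have "infsum ?L (rs v w) \<le> w - v - measure lebesgue ({v..w} \<inter> T)"
    by (rule has_sum_mono[OF L S]) (auto intro: ln_add_one_self_le_self mu_ge_0)
  then show "incr v w \<le> w - v" by (simp add: incr_def)
  have "(1 - (w - v)) * (w - v - measure lebesgue ({v..w} \<inter> T)) \<le> infsum ?L (rs v w)"
  proof (rule has_sum_mono[OF has_sum_cmult_right[OF S] L])
    fix \<tau> assume \<tau>: "\<tau> \<in> rs v w"
    then have m: "0 \<le> mu T \<tau>" "mu T \<tau> \<le> w - v" using mu_le[OF \<tau> assms(2)] mu_ge_0 by (auto simp: rs_def)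
    have "(1 - (w - v)) * mu T \<tau> * (1 + mu T \<tau>) \<le> mu T \<tau>"
    proof -
      have "0 \<le> (w - v) * mu T \<tau> * mu T \<tau>" using assms(3) m by (intro mult_nonneg_nonneg) auto
      moreover have "mu T \<tau> * mu T \<tau> \<le> (w - v) * mu T \<tau>" using m by (intro mult_right_mono) auto
      ultimately show ?thesis by (simp add: algebra_simps)
    qed
    then have "(1 - (w - v)) * mu T \<tau> \<le> mu T \<tau> / (1 + mu T \<tau>)" using m by (simp add: pos_le_divide_eq)
    also have "\<dots> \<le> ?L \<tau>" by (rule ln_mu_lower)
    finally show "(1 - (w - v)) * mu T \<tau> \<le> ?L \<tau>" .
  qed
  moreover have "0 \<le> (w - v) * measure lebesgue ({v..w} \<inter> T)" using assms(3) by simp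
  ultimately show "w - v - (w - v)\<^sup>2 \<le> incr v w"
    by (simp add: incr_def algebra_simps power2_eq_square)
qed

text \<open>A gap longer than \<open>1\<close> alone contributes at least \<open>ln 2\<close>; if
  there is none, \<open>ln (1 + \<mu>) \<ge> \<mu> / 2\<close> on every gap. Strict monotonicity and
  unboundedness of \<open>s\<close> rest on this bound.\<close>

lemma incr_lower:
  assumes "v \<in> T" "w \<in> T" "v \<le> w"
  shows "min ((w - v) / 2) (1 / 2) \<le> incr v w"
proof (cases "\<exists>\<tau>\<in>rs v w. mu T \<tau> > 1")
  case True
  then obtain \<tau> where \<tau>: "\<tau> \<in> rs v w" "mu T \<tau> > 1" by blast
  let ?L = "\<lambda>\<tau>. ln (1 + mu T \<tau>)"
  have "?L \<tau> \<le> infsum ?L (rs v w)"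
  proof (rule has_sum_mono'[OF has_sum_finiteI has_sum_infsum[OF ln_mu_summable[OF assms]]])
    show "?L \<tau> = sum ?L {\<tau>}" by simp
  qed (use \<tau>(1) mu_ge_0 in \<open>auto intro: ln_ge_zero\<close>)
  moreover have "1 / 2 \<le> ln (2::real)" using ln2_ge_two_thirds by simp
  moreover have "ln 2 \<le> ?L \<tau>" using \<tau>(2) by (intro ln_mono) auto
  ultimately have "1 / 2 \<le> incr v w"
    using measure_nonneg[of lebesgue "{v..w} \<inter> T"] unfolding incr_def by linarith
  then show ?thesis by (rule min.coboundedI2)
next
  case False
  let ?L = "\<lambda>\<tau>. ln (1 + mu T \<tau>)"
  have "1 / 2 * (w - v - measure lebesgue ({v..w} \<inter> T)) \<le> infsum ?L (rs v w)"
  proof (rule has_sum_mono[OF has_sum_cmult_right[OF mu_has_sum[OF assms]] has_sum_infsum[OF ln_mu_summable[OF assms]]])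
    fix \<tau> assume "\<tau> \<in> rs v w"
    then have m: "0 \<le> mu T \<tau>" "mu T \<tau> \<le> 1" using False mu_ge_0 by (auto simp: not_less)
    then have "1 / 2 * mu T \<tau> \<le> mu T \<tau> / (1 + mu T \<tau>)" by (simp add: field_simps mult_left_le)
    also have "\<dots> \<le> ?L \<tau>" by (rule ln_mu_lower)
    finally show "1 / 2 * mu T \<tau> \<le> ?L \<tau>" .
  qed
  then have "(w - v) / 2 \<le> incr v w"
    using measure_nonneg[of lebesgue "{v..w} \<inter> T"] unfolding incr_def by argo
  then show ?thesis by linarith
qed

lemma incr_gap:
  assumes "t \<in> T" "mu T t > 0"
  shows "incr t (sigma T t) = ln (1 + mu T t)"
proof -
  have pts: "r = t \<or> sigma T t \<le> r" if "r \<in> T" "t \<le> r" for r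
    using no_gap_points[OF that(1), of t] that(2) by auto
  have "{t..sigma T t} \<inter> T \<subseteq> {t, sigma T t}"
  proof
    fix r assume "r \<in> {t..sigma T t} \<inter> T"
    then show "r \<in> {t, sigma T t}" using pts[of r] by auto
  qed
  then have "negligible ({t..sigma T t} \<inter> T)" by (rule negligible_subset[rotated]) auto
  moreover have "rs t (sigma T t) = {t}"
  proof (intro equalityI subsetI)
    fix r assume "r \<in> rs t (sigma T t)"
    then show "r \<in> {t}" using pts[of r] by (auto simp: rs_def)
  next
    fix r assume "r \<in> {t}"
    then show "r \<in> rs t (sigma T t)" using assms by (simp add: rs_def mu_def)
  qed
  ultimately show ?thesis by (simp add: incr_def negligible_imp_measure0)
qed

abbreviation s :: "real \<Rightarrow> real" where "s \<equiv> renorm T"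

lemma renorm_sandwich:
  assumes "v \<in> T" "w \<in> T" "v \<le> w"
  shows "s w - s v \<le> w - v" "w - v - (w - v)\<^sup>2 \<le> s w - s v" "min ((w - v) / 2) (1 / 2) \<le> s w - s v"
  using incr_sandwich[OF assms] incr_lower[OF assms] by (simp_all add: renorm_diff[OF assms])

lemma renorm_gap: "t \<in> T \<Longrightarrow> mu T t > 0 \<Longrightarrow> s (sigma T t) = s t + ln (1 + mu T t)"
  using renorm_diff[of t "sigma T t"] incr_gap[of t] sigma_in_T[of t] sigma_ge[of t] by simp

lemma renorm_strict_mono_T:
  assumes "v \<in> T" "w \<in> T" "v < w" shows "s v < s w"
  using renorm_sandwich(3)[OF assms(1,2)] assms(3) by (auto simp: min_def split: if_splits)

lemma renorm_not_T:
  assumes "t \<notin> T"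
  shows "s t = (if 0 \<le> t then s (prev t) + ln (1 + t - prev t)
                else s (sigma T (prev t)) - ln (1 + sigma T (prev t) - t))"
proof (cases "0 \<le> t")
  case True
  have "T \<inter> {..t} = {\<tau> \<in> T. \<tau> \<le> t}" by auto
  then have "Sup (T \<inter> {..t}) = prev t" by (simp add: prev_def)
  then show ?thesis using assms True prev_in_T[of t] by (simp add: renorm_def origin_eq Let_def)
next
  case False
  have "Inf (T \<inter> {t..}) = sigma T (prev t)"
  proof (rule cInf_eq_minimum)
    show "sigma T (prev t) \<in> T \<inter> {t..}" using gap_bounds[OF assms] sigma_in_T[OF prev_in_T, of t] by auto
    fix r assume "r \<in> T \<inter> {t..}"
    then show "sigma T (prev t) \<le> r" using no_gap_points[of r "prev t"] gap_bounds[OF assms] by auto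
  qed
  then show ?thesis using assms False sigma_in_T[OF prev_in_T, of t] by (simp add: renorm_def origin_eq Let_def)
qed

lemma renorm_in_gap:
  assumes "t \<notin> T" shows "s (prev t) < s t" "s t < s (sigma T (prev t))"
proof -
  let ?a = "prev t" and ?b = "sigma T (prev t)"
  note g = gap_bounds[OF assms]
  have jump: "s ?b = s ?a + ln (1 + (?b - ?a))"
    using renorm_gap[OF prev_in_T g(3)] by (simp add: mu_def)
  have "ln (1 + t - ?a) > 0" "ln (1 + t - ?a) < ln (1 + (?b - ?a))"
    "ln (1 + ?b - t) > 0" "ln (1 + ?b - t) < ln (1 + (?b - ?a))"
    using g by auto
  then show "s ?a < s t" "s t < s ?b" unfolding renorm_not_T[OF assms] using jump by auto
qed

lemma renorm_strict_mono: "strict_mono s"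
proof (rule strict_monoI)
  fix x y :: real assume xy: "x < y"
  show "s x < s y"
  proof (cases "\<exists>r\<in>T. x \<le> r \<and> r \<le> y")
    case True
    then obtain r where r: "r \<in> T" "x \<le> r" "r \<le> y" by blast
    have 1: "s x \<le> s r \<and> (x < r \<longrightarrow> s x < s r)"
    proof (cases "x \<in> T")
      case True
      then show ?thesis using renorm_strict_mono_T[of x r] r by (cases "x = r") auto
    next
      case False
      have "sigma T (prev x) \<le> r" using no_gap_points[OF r(1), of "prev x"] gap_bounds[OF False] r(2) by auto
      then have "s (sigma T (prev x)) \<le> s r"
        using renorm_strict_mono_T[OF sigma_in_T[OF prev_in_T] r(1), of x] by (cases "sigma T (prev x) = r") auto
      then show ?thesis using renorm_in_gap[OF False] by auto
    qed
    have 2: "s r \<le> s y \<and> (r < y \<longrightarrow> s r < s y)"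
    proof (cases "y \<in> T")
      case True
      then show ?thesis using renorm_strict_mono_T[of r y] r by (cases "r = y") auto
    next
      case False
      have "r \<le> prev y" using prev_ge r by blast
      then have "s r \<le> s (prev y)"
        using renorm_strict_mono_T[OF r(1) prev_in_T, of y] by (cases "r = prev y") auto
      then show ?thesis using renorm_in_gap[OF False] by auto
    qed
    show ?thesis using 1 2 xy r by (cases "x < r") auto
  next
    case False
    then have nT: "x \<notin> T" "y \<notin> T" using xy by auto
    have "y < sigma T (prev x)"
    proof (rule ccontr)
      assume "\<not> ?thesis"
      then show False using False sigma_in_T[OF prev_in_T, of x] gap_bounds[OF nT(1)] by auto
    qed
    then have p: "prev y = prev x"
      using prev_eqI[OF prev_in_T, of x y] gap_bounds[OF nT(1)] xy by simp
    \<comment> \<open>\<open>0\<close> belongs to \<open>T\<close>, so the gap lies on one side of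
      it and the same formula applies to both points.\<close>
    have "\<not> (x < 0 \<and> 0 \<le> y)" using False zero_in_T by force
    then show ?thesis
      using xy gap_bounds[OF nT(1)] \<open>y < sigma T (prev x)\<close> unfolding renorm_not_T[OF nT(1)] renorm_not_T[OF nT(2)] p
      by auto
  qed
qed

text \<open>Let \<open>a\<close> be the supremum of the points of \<open>T\<close> with
  \<open>s t \<le> u\<close>. Either \<open>s a = u\<close>, or \<open>a\<close> is the left end of
  a gap in which the logarithmic formula is inverted by \<open>exp\<close>. A right-dense
  \<open>a\<close> with \<open>s a < u\<close> would not be the supremum, since on \<open>T\<close>
  the function \<open>s\<close> grows no faster than the identity.\<close>

lemma renorm_surj: "surj s"
proof -
  have unb: "\<exists>t\<in>T. u < s t" "\<exists>t\<in>T. s t < u" for u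
  proof -
    \<comment> \<open>A step longer than \<open>1\<close> raises \<open>s\<close> by at least
      \<open>1 / 2\<close>.\<close>
    have up: "\<exists>t\<in>T. s t \<ge> s 0 + real n / 2" for n
    proof (induction n)
      case 0
      show ?case by (rule bexI[OF _ zero_in_T]) simp
    next
      case (Suc n)
      then obtain t where t: "t \<in> T" "s t \<ge> s 0 + real n / 2" by blast
      obtain r where "r \<in> T" "t + 1 < r" using ex_greater by blast
      then show ?case using renorm_sandwich(3)[OF t(1), of r] t(2) by (intro bexI[of _ r]) (auto simp: field_simps)
    qed
    have down: "\<exists>t\<in>T. s t \<le> s 0 - real n / 2" for n
    proof (induction n)
      case 0
      show ?case by (rule bexI[OF _ zero_in_T]) simp
    next
      case (Suc n)
      then obtain t where t: "t \<in> T" "s t \<le> s 0 - real n / 2" by blast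
      obtain r where "r \<in> T" "r < t - 1" using ex_less by blast
      then show ?case using renorm_sandwich(3)[OF _ t(1), of r] t(2) by (intro bexI[of _ r]) (auto simp: field_simps)
    qed
    obtain n where "2 * (u - s 0) < real n" using reals_Archimedean2 by blast
    moreover obtain t where t: "t \<in> T" "s 0 + real n / 2 \<le> s t" using up[of n] by blast
    ultimately have "u < s t" by argo
    then show "\<exists>t\<in>T. u < s t" using t(1) by (rule bexI)
    obtain n where "2 * (s 0 - u) < real n" using reals_Archimedean2 by blast
    moreover obtain t where t: "t \<in> T" "s t \<le> s 0 - real n / 2" using down[of n] by blast
    ultimately have "s t < u" by argo
    then show "\<exists>t\<in>T. s t < u" using t(1) by (rule bexI)
  qed
  have ex: "\<exists>t. u = s t" for u
  proof -
    obtain lo where lo: "lo \<in> T" "s lo < u" using unb(2) by blast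
    obtain hi where hi: "hi \<in> T" "u < s hi" using unb(1) by blast
    define C where "C = {t \<in> T. s t \<le> u}"
    have le_hi: "t \<le> hi" if "t \<in> C" for t
    proof (rule ccontr)
      assume "\<not> t \<le> hi"
      then have "s hi < s t" using renorm_strict_mono by (simp add: strict_mono_less)
      then show False using hi(2) that by (simp add: C_def)
    qed
    have C: "lo \<in> C" using lo by (simp add: C_def)
    have bdd: "bdd_above C" by (rule bdd_aboveI[of _ hi]) (rule le_hi)
    define a where "a = Sup C"
    have upper: "t \<le> a" if "t \<in> C" for t unfolding a_def by (rule cSup_upper[OF that bdd])
    have near: "\<exists>c\<in>C. a - e < c" if "e > 0" for e
    proof -
      have "a - e < Sup C" using that by (simp add: a_def)
      then show ?thesis using C by (subst (asm) less_cSup_iff[OF _ bdd]) auto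
    qed
    have aT: "a \<in> T"
    proof -
      have "a \<in> closure T" unfolding closure_approachable
      proof (intro allI impI)
        fix e :: real assume "e > 0"
        then obtain c where "c \<in> C" "a - e < c" using near by blast
        then show "\<exists>y\<in>T. dist y a < e" using upper[of c] by (intro bexI[of _ c]) (auto simp: C_def dist_real_def)
      qed
      then show ?thesis using closed_T by simp
    qed
    have "s a \<le> u"
    proof (rule field_le_epsilon)
      fix e :: real assume "e > 0"
      then obtain c where c: "c \<in> C" "a - e < c" using near by blast
      then have "s a - s c \<le> a - c" using upper[OF c(1)] aT by (intro renorm_sandwich(1)) (auto simp: C_def)
      then show "s a \<le> u + e" using c by (simp add: C_def)
    qed
    then consider "s a = u" | "s a < u" "mu T a = 0" | "s a < u" "mu T a > 0"
      using mu_ge_0[of a] by linarith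
    then show ?thesis
    proof cases
      case 1
      from this[symmetric] show ?thesis by (rule exI)
    next
      case 2
      have "Inf {r \<in> T. r > a} < a + (u - s a)" using 2 by (simp add: mu_def sigma_def)
      moreover have "{r \<in> T. r > a} \<noteq> {}" using ex_greater[of a] by blast
      moreover have "bdd_below {r \<in> T. r > a}" by (rule bdd_belowI[of _ a]) auto
      ultimately obtain r where r: "r \<in> T" "a < r" "r < a + (u - s a)"
        using cInf_less_iff[of "{r \<in> T. r > a}"] by auto
      have "s r - s a \<le> r - a" using r aT by (intro renorm_sandwich(1)) auto
      then have "r \<in> C" using r by (simp add: C_def)
      then show ?thesis using upper[of r] r(2) by simp
    next
      case 3
      define b where "b = sigma T a"
      have b: "b = a + mu T a" "b \<in> T" "a < b" using 3(2) sigma_in_T[OF aT] by (simp_all add: b_def mu_def)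
      have sb: "s b = s a + ln (1 + mu T a)" unfolding b_def by (rule renorm_gap[OF aT 3(2)])
      have "u < s b"
      proof (rule ccontr)
        assume "\<not> u < s b"
        then have "b \<in> C" using b(2) by (simp add: C_def)
        then show False using upper[of b] b(3) by simp
      qed
      have inT: "t \<notin> T \<and> prev t = a" if "a < t" "t < b" for t
        using no_gap_points[of t a] prev_eqI[OF aT, of t] that by (auto simp: b_def)
      have expL: "exp x < 1 + mu T a" if "x < ln (1 + mu T a)" for x
        using that 3(2) by (metis exp_less_mono exp_ln add_pos_pos zero_less_one)
      show ?thesis
      proof (cases "0 \<le> a")
        case True
        define t where "t = a + exp (u - s a) - 1"
        have "exp (u - s a) > 1" "exp (u - s a) < 1 + mu T a" using 3(1) sb \<open>u < s b\<close> by (auto intro!: expL)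
        then have t: "a < t" "t < b" by (auto simp: t_def b(1))
        have "1 + t - a = exp (u - s a)" by (simp add: t_def)
        then have "u = s t" using inT[OF t] renorm_not_T[of t] True t(1) by simp
        then show ?thesis by (rule exI)
      next
        case False
        then have "b \<le> 0" using no_gap_points[OF zero_in_T, of a] by (auto simp: b_def)
        define t where "t = b + 1 - exp (s b - u)"
        have "exp (s b - u) > 1" "exp (s b - u) < 1 + mu T a" using 3(1) sb \<open>u < s b\<close> by (auto intro!: expL)
        then have t: "a < t" "t < b" by (auto simp: t_def b(1))
        have "1 + b - t = exp (s b - u)" by (simp add: t_def)
        then have "u = s t" using inT[OF t] renorm_not_T[of t] \<open>b \<le> 0\<close> t(2) by (simp add: b_def)
        then show ?thesis by (rule exI)
      qed
    qed
  qed
  show ?thesis unfolding surj_def by (rule allI) (rule ex)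
qed

end

subsection \<open>Uniqueness on closed sets and Caratheodory equations\<close>

text \<open>Consecutive points of \<open>S\<close> are handled by hypothesis, accumulation points by the Lipschitz bound in
  terms of the supremum of \<open>w\<close> itself.\<close>

lemma zero_propagation_forward:
  fixes w :: "real \<Rightarrow> 'a::real_normed_vector"
  assumes S: "closed S" "a \<in> S" "b \<in> S" "a \<le> b" and K: "K \<ge> 0"
    and lip: "\<And>c d M. c \<in> S \<Longrightarrow> d \<in> S \<Longrightarrow> a \<le> c \<Longrightarrow> c \<le> d \<Longrightarrow> d \<le> b \<Longrightarrow>
        (\<And>t. t \<in> S \<Longrightarrow> c \<le> t \<Longrightarrow> t \<le> d \<Longrightarrow> norm (w t) \<le> M) \<Longrightarrow> norm (w d - w c) \<le> K * M * (d - c)"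
    and cont: "continuous_on S w"
    and jump: "\<And>c d. c \<in> S \<Longrightarrow> d \<in> S \<Longrightarrow> a \<le> c \<Longrightarrow> c < d \<Longrightarrow> d \<le> b \<Longrightarrow> S \<inter> {c<..<d} = {} \<Longrightarrow> w c = 0 \<Longrightarrow> w d = 0"
    and zero: "w a = 0"
  shows "w b = 0"
proof -
  define Z where "Z = {t \<in> S \<inter> {a..b}. w t = 0}"
  have "closed Z"
  proof -
    have "continuous_on (S \<inter> {a..b}) w" by (rule continuous_on_subset[OF cont]) auto
    moreover have "closed (S \<inter> {a..b})" using S by auto
    ultimately show ?thesis unfolding Z_def by (rule continuous_closed_preimage_constant)
  qed
  moreover have "a \<in> Z" using S zero by (simp add: Z_def)
  moreover have "bdd_above Z" by (rule bdd_aboveI[of _ b]) (auto simp: Z_def)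
  ultimately have "Sup Z \<in> Z" by (intro closed_contains_Sup) auto
  define z where "z = Sup Z"
  have z: "z \<in> S" "a \<le> z" "z \<le> b" "w z = 0" using \<open>Sup Z \<in> Z\<close> by (auto simp: z_def Z_def)
  have max: "t \<le> z" if "t \<in> S" "a \<le> t" "t \<le> b" "w t = 0" for t
    unfolding z_def using that \<open>bdd_above Z\<close> by (intro cSup_upper) (auto simp: Z_def)
  show ?thesis
  proof (cases "z = b")
    case False
    then have zb: "z < b" using z by simp
    \<comment> \<open>Over a stretch this short the Lipschitz bound at a maximum \<open>t0\<close>
      of \<open>norm (w t)\<close> reads
      \<open>norm (w t0) \<le> K * \<delta> * norm (w t0)\<close>, with
      \<open>K * \<delta> < 1\<close>.\<close>
    define \<delta> where "\<delta> = 1 / (2 * K + 1)"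
    have \<delta>: "\<delta> > 0" "K * \<delta> < 1" using K by (auto simp: \<delta>_def field_simps)
    have False
    proof (cases "\<exists>r\<in>S. z < r \<and> r \<le> min b (z + \<delta>)")
      case True
      then obtain r where r: "r \<in> S" "z < r" "r \<le> b" "r \<le> z + \<delta>" by auto
      have "compact (S \<inter> {z..r})" using S(1) by (simp add: closed_Int_compact)
      moreover have "continuous_on (S \<inter> {z..r}) (\<lambda>t. norm (w t))"
        by (intro continuous_on_norm continuous_on_subset[OF cont]) auto
      moreover have "S \<inter> {z..r} \<noteq> {}" using z r by auto
      ultimately obtain t0 where t0: "t0 \<in> S \<inter> {z..r}" "\<And>t. t \<in> S \<inter> {z..r} \<Longrightarrow> norm (w t) \<le> norm (w t0)"
        using continuous_attains_sup[of "S \<inter> {z..r}" "\<lambda>t. norm (w t)"] by blast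
      have "norm (w t0 - w z) \<le> K * norm (w t0) * (t0 - z)"
        using t0 z r by (intro lip) auto
      also have "\<dots> \<le> K * norm (w t0) * \<delta>" using t0 r K by (intro mult_left_mono) auto
      finally have "norm (w t0) \<le> (K * \<delta>) * norm (w t0)" using z(4) by (simp add: mult_ac)
      then have "(1 - K * \<delta>) * norm (w t0) \<le> 0" by (simp add: algebra_simps)
      then have "norm (w t0) \<le> 0" using \<delta>(2) by (simp add: mult_le_0_iff)
      then have "w r = 0" using t0(2)[of r] r z by simp
      then show False using max[of r] r z by simp
    next
      case none: False
      \<comment> \<open>No point of \<open>S\<close> follows \<open>z\<close> within reach, so
        \<open>d\<close> is the next one and \<open>z\<close>, \<open>d\<close> are
        consecutive.\<close>
      define d where "d = Inf (S \<inter> {min b (z + \<delta>)..})"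
      have ne: "S \<inter> {min b (z + \<delta>)..} \<noteq> {}" using S(3) by auto
      have bdd: "bdd_below (S \<inter> {min b (z + \<delta>)..})" by (rule bdd_belowI[of _ "min b (z + \<delta>)"]) auto
      have d: "d \<in> S \<inter> {min b (z + \<delta>)..}"
        unfolding d_def using S(1) ne bdd by (intro closed_contains_Inf) auto
      have "d \<le> b" unfolding d_def using S(3) bdd by (intro cInf_lower) auto
      have "S \<inter> {z<..<d} = {}"
      proof -
        have False if "t \<in> S" "z < t" "t < d" for t
        proof (cases "t \<le> min b (z + \<delta>)")
          case True then show False using none that by blast
        next
          case False
          then have "d \<le> t" unfolding d_def using that bdd by (intro cInf_lower) auto
          then show False using that by simp
        qed
        then show ?thesis by auto
      qed
      moreover have "z < d" using d zb \<delta>(1) by auto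
      ultimately have "w d = 0" using jump[of z d] z d \<open>d \<le> b\<close> by auto
      then show False using max[of d] d \<open>z < d\<close> \<open>d \<le> b\<close> z by auto
    qed
    then show ?thesis ..
  qed (use z in simp)
qed

text \<open>Reflection of the time axis reduces this to the forward case.\<close>

lemma zero_propagation_backward:
  fixes w :: "real \<Rightarrow> 'a::real_normed_vector"
  assumes S: "closed S" "a \<in> S" "b \<in> S" "a \<le> b" and K: "K \<ge> 0"
    and lip: "\<And>c d M. c \<in> S \<Longrightarrow> d \<in> S \<Longrightarrow> a \<le> c \<Longrightarrow> c \<le> d \<Longrightarrow> d \<le> b \<Longrightarrow>
        (\<And>t. t \<in> S \<Longrightarrow> c \<le> t \<Longrightarrow> t \<le> d \<Longrightarrow> norm (w t) \<le> M) \<Longrightarrow> norm (w d - w c) \<le> K * M * (d - c)"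
    and cont: "continuous_on S w"
    and jump: "\<And>c d. c \<in> S \<Longrightarrow> d \<in> S \<Longrightarrow> a \<le> c \<Longrightarrow> c < d \<Longrightarrow> d \<le> b \<Longrightarrow> S \<inter> {c<..<d} = {} \<Longrightarrow> w d = 0 \<Longrightarrow> w c = 0"
    and zero: "w b = 0"
  shows "w a = 0"
proof -
  have "w (- (- a)) = 0"
  proof (rule zero_propagation_forward[of "uminus ` S" "- b" "- a" K "\<lambda>t. w (- t)"])
    show "closed (uminus ` S)" using S(1) by (rule closed_negations)
    show "continuous_on (uminus ` S) (\<lambda>t. w (- t))"
      by (rule continuous_on_compose2[OF cont]) (auto intro!: continuous_intros)
  next
    fix c d M assume cd: "c \<in> uminus ` S" "d \<in> uminus ` S" "- b \<le> c" "c \<le> d" "d \<le> - a"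
      and M: "\<And>t. t \<in> uminus ` S \<Longrightarrow> c \<le> t \<Longrightarrow> t \<le> d \<Longrightarrow> norm (w (- t)) \<le> M"
    have "norm (w (- c) - w (- d)) \<le> K * M * (- c - - d)"
    proof (rule lip)
      fix t assume "t \<in> S" "- d \<le> t" "t \<le> - c"
      then show "norm (w t) \<le> M" using M[of "- t"] by auto
    qed (use cd in auto)
    then show "norm (w (- d) - w (- c)) \<le> K * M * (d - c)" by (simp add: norm_minus_commute)
  next
    fix c d assume cd: "c \<in> uminus ` S" "d \<in> uminus ` S" "- b \<le> c" "c < d" "d \<le> - a"
      "uminus ` S \<inter> {c<..<d} = {}" "w (- c) = 0"
    have "S \<inter> {- d<..<- c} = {}"
    proof -
      have False if "t \<in> S" "- d < t" "t < - c" for t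
      proof -
        have "- t \<in> uminus ` S \<inter> {c<..<d}" using that by auto
        then show False using cd(6) by blast
      qed
      then show ?thesis by auto
    qed
    then show "w (- d) = 0" using cd by (intro jump[of "- d" "- c"]) auto
  qed (use S K zero in auto)
  then show ?thesis by simp
qed

text \<open>Zeros are to spread in both directions, so the condition at consecutive points is an
  equivalence; for dynamic equations this is where regressivity enters.\<close>

lemma zero_propagation_everywhere:
  fixes w :: "real \<Rightarrow> 'a::real_normed_vector"
  assumes S: "closed S" "\<tau> \<in> S" "t \<in> S" and cont: "continuous_on S w"
    and lip: "\<And>a b. a \<le> b \<Longrightarrow> \<exists>K\<ge>0. \<forall>c d M. c \<in> S \<longrightarrow> d \<in> S \<longrightarrow> a \<le> c \<longrightarrow> c \<le> d \<longrightarrow> d \<le> b \<longrightarrow>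
        (\<forall>t\<in>S. c \<le> t \<longrightarrow> t \<le> d \<longrightarrow> norm (w t) \<le> M) \<longrightarrow> norm (w d - w c) \<le> K * M * (d - c)"
    and jump: "\<And>c d. c \<in> S \<Longrightarrow> d \<in> S \<Longrightarrow> c < d \<Longrightarrow> S \<inter> {c<..<d} = {} \<Longrightarrow> w c = 0 \<longleftrightarrow> w d = 0"
    and zero: "w \<tau> = 0"
  shows "w t = 0"
proof (cases "\<tau> \<le> t")
  case True
  from lip[OF this] obtain K where K: "K \<ge> 0" "\<And>c d M. c \<in> S \<Longrightarrow> d \<in> S \<Longrightarrow> \<tau> \<le> c \<Longrightarrow> c \<le> d \<Longrightarrow> d \<le> t \<Longrightarrow>
        (\<forall>t\<in>S. c \<le> t \<longrightarrow> t \<le> d \<longrightarrow> norm (w t) \<le> M) \<Longrightarrow> norm (w d - w c) \<le> K * M * (d - c)" by blast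
  show ?thesis
    by (rule zero_propagation_forward[OF S(1,2,3) True K(1) _ cont _ zero]) (use K(2) jump in auto)
next
  case False
  then have "t \<le> \<tau>" by simp
  from lip[OF this] obtain K where K: "K \<ge> 0" "\<And>c d M. c \<in> S \<Longrightarrow> d \<in> S \<Longrightarrow> t \<le> c \<Longrightarrow> c \<le> d \<Longrightarrow> d \<le> \<tau> \<Longrightarrow>
        (\<forall>t\<in>S. c \<le> t \<longrightarrow> t \<le> d \<longrightarrow> norm (w t) \<le> M) \<Longrightarrow> norm (w d - w c) \<le> K * M * (d - c)" by blast
  show ?thesis
    by (rule zero_propagation_backward[OF S(1,3,2) \<open>t \<le> \<tau>\<close> K(1) _ cont _ zero]) (use K(2) jump in auto)
qed

section \<open>Global existence and uniqueness for Caratheodory equations\<close>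

definition signed_integral :: "real \<Rightarrow> (real \<Rightarrow> 'a::euclidean_space) \<Rightarrow> real \<Rightarrow> 'a" where
  "signed_integral u0 f u = (if u0 \<le> u then integral {u0..u} f else - integral {u..u0} f)"

lemma signed_integral_diff:
  assumes "\<And>a b. f integrable_on {a..b}" "a \<le> b"
  shows "signed_integral u0 f b - signed_integral u0 f a = integral {a..b} f"
proof -
  have c: "integral {p..q} f + integral {q..r} f = integral {p..r} f" if "p \<le> q" "q \<le> r" for p q r
    using that assms(1) by (intro Henstock_Kurzweil_Integration.integral_combine)
  consider "u0 \<le> a" | "a < u0" "u0 \<le> b" | "b < u0" by linarith
  then show ?thesis
    using c[of u0 a b] c[of a u0 b] c[of a b u0] assms(2)
    by cases (auto simp: signed_integral_def algebra_simps)
qed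

lemma signed_integral_minus:
  assumes "\<And>a b. f integrable_on {a..b}" "\<And>a b. g integrable_on {a..b}"
  shows "signed_integral u0 (\<lambda>v. f v - g v) u = signed_integral u0 f u - signed_integral u0 g u"
  by (simp add: signed_integral_def Henstock_Kurzweil_Integration.integral_diff assms)

text \<open>Integrating a power of \<open>\<bar>v - u0\<bar>\<close> raises the exponent and divides
  by it: the source of the factorials in the Picard bound.\<close>

lemma signed_integral_power_bound:
  assumes f: "\<And>a b. f integrable_on {a..b}" and "c \<ge> 0"
    and bd: "\<And>v. v \<in> closed_segment u0 u \<Longrightarrow> norm (f v) \<le> c * \<bar>v - u0\<bar> ^ n"
  shows "norm (signed_integral u0 f u) \<le> c * \<bar>u - u0\<bar> ^ Suc n / Suc n"
proof (cases "u0 \<le> u")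
  case True
  have "((\<lambda>v. c * (v - u0) ^ n) has_integral (c * (u - u0) ^ Suc n / Suc n - c * (u0 - u0) ^ Suc n / Suc n)) {u0..u}"
    by (rule fundamental_theorem_of_calculus[OF True])
       (auto intro!: derivative_eq_intros simp: has_real_derivative_iff_has_vector_derivative[symmetric] field_simps simp del: power_Suc of_nat_Suc)
  then have I: "((\<lambda>v. c * (v - u0) ^ n) has_integral (c * (u - u0) ^ Suc n / Suc n)) {u0..u}" by simp
  have "norm (integral {u0..u} f) \<le> integral {u0..u} (\<lambda>v. c * (v - u0) ^ n)"
    using I bd True by (intro integral_norm_bound_integral f) (auto simp: closed_segment_eq_real_ivl has_integral_integrable)
  also have "\<dots> = c * \<bar>u - u0\<bar> ^ Suc n / Suc n" using integral_unique[OF I] True by simp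
  finally show ?thesis using True by (simp only: signed_integral_def if_True)
next
  case False
  then have le: "u \<le> u0" by simp
  have "((\<lambda>v. c * (u0 - v) ^ n) has_integral (- c * (u0 - u0) ^ Suc n / Suc n - - c * (u0 - u) ^ Suc n / Suc n)) {u..u0}"
    by (rule fundamental_theorem_of_calculus[OF le])
       (auto intro!: derivative_eq_intros simp: has_real_derivative_iff_has_vector_derivative[symmetric] field_simps simp del: power_Suc of_nat_Suc)
  then have I: "((\<lambda>v. c * (u0 - v) ^ n) has_integral (c * (u0 - u) ^ Suc n / Suc n)) {u..u0}" by simp
  have "norm (integral {u..u0} f) \<le> integral {u..u0} (\<lambda>v. c * (u0 - v) ^ n)"
  proof (intro integral_norm_bound_integral f)
    fix v assume "v \<in> {u..u0}"
    then have "v \<in> closed_segment u0 u" "\<bar>v - u0\<bar> = u0 - v" by (auto simp: closed_segment_eq_real_ivl)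
    then show "norm (f v) \<le> c * (u0 - v) ^ n" using bd[of v] by simp
  qed (use I in \<open>auto simp: has_integral_integrable\<close>)
  also have "\<dots> = c * \<bar>u - u0\<bar> ^ Suc n / Suc n" using integral_unique[OF I] le by simp
  finally show ?thesis using False by (simp only: signed_integral_def if_False norm_minus_cancel)
qed

text \<open>The constants may depend on the time interval but not on the state, so solutions exist
  on the whole line. Measurability is asked along continuous functions, as the Picard iterates
  are.\<close>

locale caratheodory =
  fixes F :: "real \<Rightarrow> 'a::euclidean_space \<Rightarrow> 'a"
  assumes meas: "\<And>x. continuous_on UNIV x \<Longrightarrow> (\<lambda>u. F u (x u)) \<in> borel_measurable borel"
    and lip: "\<And>a b. \<exists>K\<ge>0. \<forall>u\<in>{a..b}. \<forall>x y. norm (F u x - F u y) \<le> K * norm (x - y)"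
    and bdd: "\<And>a b. \<exists>C\<ge>0. \<forall>u\<in>{a..b}. norm (F u 0) \<le> C"
begin

lemma field_bounded:
  assumes "continuous_on UNIV x"
  shows "\<exists>C\<ge>0. \<forall>u\<in>{a..b}. norm (F u (x u)) \<le> C"
proof -
  obtain K where K: "K \<ge> 0" "\<And>u y. u \<in> {a..b} \<Longrightarrow> norm (F u (x u) - F u y) \<le> K * norm (x u - y)"
    using lip[of a b] by blast
  obtain C where C: "C \<ge> 0" "\<And>u. u \<in> {a..b} \<Longrightarrow> norm (F u 0) \<le> C" using bdd[of a b] by blast
  have "compact (x ` {a..b})" using assms by (intro compact_continuous_image) (auto elim: continuous_on_subset)
  then obtain M where M: "M > 0" "\<And>u. u \<in> {a..b} \<Longrightarrow> norm (x u) \<le> M"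
    using compact_imp_bounded bounded_pos by (metis imageI)
  have "norm (F u (x u)) \<le> K * M + C" if u: "u \<in> {a..b}" for u
  proof -
    have "norm (F u (x u)) \<le> norm (F u (x u) - F u 0) + norm (F u 0)" by (metis norm_triangle_sub add.commute)
    moreover have "norm (F u (x u) - F u 0) \<le> K * norm (x u - 0)" by (rule K(2)[OF u])
    moreover have "K * norm (x u - 0) \<le> K * M" using M(2)[OF u] K(1) by (intro mult_left_mono) auto
    ultimately show ?thesis using C(2)[OF u] by linarith
  qed
  then show ?thesis using K(1) C(1) M(1) by (intro exI[of _ "K * M + C"]) auto
qed

lemma field_integrable:
  assumes "continuous_on UNIV x"
  shows "(\<lambda>u. F u (x u)) absolutely_integrable_on {a..b}" "(\<lambda>u. F u (x u)) integrable_on {a..b}"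
proof -
  obtain C where "\<And>u. u \<in> {a..b} \<Longrightarrow> norm (F u (x u)) \<le> C" using field_bounded[OF assms, of a b] by blast
  then show "(\<lambda>u. F u (x u)) absolutely_integrable_on {a..b}"
    using measurable_bounded_by_integrable_imp_absolutely_integrable[of "\<lambda>u. F u (x u)" "{a..b}" "\<lambda>_. C"] meas[OF assms]
    by (auto simp: measurable_completion measurable_restrict_space1)
  then show "(\<lambda>u. F u (x u)) integrable_on {a..b}" by (rule set_lebesgue_integral_eq_integral(1))
qed

lemma solution_continuous:
  assumes "ode_solution F x"
  shows "continuous_on UNIV x"
proof -
  have "isCont x u" for u
  proof -
    have int: "(\<lambda>v. F v (x v)) integrable_on {u-1..u+1}"
      using assms by (auto simp: ode_solution_def intro: set_lebesgue_integral_eq_integral(1))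
    have "continuous_on {u-1..u+1} (\<lambda>v. x (u - 1) + integral {u-1..v} (\<lambda>v. F v (x v)))"
      by (intro continuous_intros indefinite_integral_continuous_1 int)
    moreover have "x (u - 1) + integral {u-1..v} (\<lambda>v. F v (x v)) = x v" if "v \<in> {u-1..u+1}" for v
    proof -
      have "x v - x (u - 1) = integral {u-1..v} (\<lambda>v. F v (x v))" using assms that by (simp add: ode_solution_def)
      then show ?thesis by (simp add: algebra_simps)
    qed
    ultimately have "continuous_on {u-1..u+1} x" by (rule continuous_on_eq)
    then show ?thesis by (rule continuous_on_interior) simp
  qed
  then show ?thesis by (simp add: continuous_at_imp_continuous_on)
qed

lemma solution_unique:
  assumes x: "ode_solution F x" and y: "ode_solution F y" and "x u0 = y u0"
  shows "x u = y u"
proof -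
  have cont: "continuous_on UNIV (\<lambda>u. x u - y u)"
    using solution_continuous[OF x] solution_continuous[OF y] by (intro continuous_intros)
  have "x u - y u = 0"
  proof (rule zero_propagation_everywhere[of UNIV u0 u "\<lambda>u. x u - y u"])
    fix a b :: real assume "a \<le> b"
    obtain K where K: "K \<ge> 0" "\<And>u p q. u \<in> {a..b} \<Longrightarrow> norm (F u p - F u q) \<le> K * norm (p - q)"
      using lip[of a b] by blast
    have "norm ((x d - y d) - (x c - y c)) \<le> K * M * (d - c)"
      if cd: "a \<le> c" "c \<le> d" "d \<le> b" and M: "\<And>t. c \<le> t \<Longrightarrow> t \<le> d \<Longrightarrow> norm (x t - y t) \<le> M" for c d M
    proof -
      note ix = field_integrable(2)[OF solution_continuous[OF x], of c d]
      note iy = field_integrable(2)[OF solution_continuous[OF y], of c d]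
      have "(x d - y d) - (x c - y c) = (x d - x c) - (y d - y c)" by simp
      also have "\<dots> = integral {c..d} (\<lambda>u. F u (x u) - F u (y u))"
        using x y cd(2) ix iy by (simp add: ode_solution_def Henstock_Kurzweil_Integration.integral_diff)
      also have "norm \<dots> \<le> (K * M) * (d - c)"
      proof -
        have "norm (F t (x t) - F t (y t)) \<le> K * M" if t: "t \<in> {c..d}" for t
        proof -
          have "norm (F t (x t) - F t (y t)) \<le> K * norm (x t - y t)" using t cd by (intro K(2)) auto
          also have "\<dots> \<le> K * M" using M[of t] t K(1) by (intro mult_left_mono) auto
          finally show ?thesis .
        qed
        then have "norm (integral {c..d} (\<lambda>u. F u (x u) - F u (y u))) \<le> integral {c..d} (\<lambda>_. K * M)"
          using ix iy by (intro integral_norm_bound_integral integrable_diff) auto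
        then show ?thesis using cd(2) by (simp add: mult_ac)
      qed
      finally show ?thesis .
    qed
    then show "\<exists>K\<ge>0. \<forall>c d M. c \<in> UNIV \<longrightarrow> d \<in> UNIV \<longrightarrow> a \<le> c \<longrightarrow> c \<le> d \<longrightarrow> d \<le> b \<longrightarrow>
        (\<forall>t\<in>UNIV. c \<le> t \<longrightarrow> t \<le> d \<longrightarrow> norm (x t - y t) \<le> M) \<longrightarrow> norm ((x d - y d) - (x c - y c)) \<le> K * M * (d - c)"
      using K(1) by (intro exI[of _ K]) simp
  next
    fix c d :: real assume "c < d" "UNIV \<inter> {c<..<d} = {}"
    then show "x c - y c = 0 \<longleftrightarrow> x d - y d = 0" using dense[of c d] by auto
  qed (use cont assms(3) in auto)
  then show ?thesis by simp
qed

definition picard :: "real \<Rightarrow> 'a \<Rightarrow> (real \<Rightarrow> 'a) \<Rightarrow> real \<Rightarrow> 'a" where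
  "picard u0 x0 x u = x0 + signed_integral u0 (\<lambda>v. F v (x v)) u"

lemma picard_diff:
  assumes "continuous_on UNIV x" "a \<le> b"
  shows "picard u0 x0 x b - picard u0 x0 x a = integral {a..b} (\<lambda>v. F v (x v))"
  using signed_integral_diff[OF field_integrable(2)[OF assms(1)] assms(2)] by (simp add: picard_def)

lemma picard_continuous:
  assumes "continuous_on UNIV x"
  shows "continuous_on UNIV (picard u0 x0 x)"
proof -
  have "isCont (picard u0 x0 x) u" for u
  proof -
    have "continuous_on {u-1..u+1} (\<lambda>v. picard u0 x0 x (u - 1) + integral {u-1..v} (\<lambda>v. F v (x v)))"
      by (intro continuous_intros indefinite_integral_continuous_1 field_integrable assms)
    moreover have "picard u0 x0 x (u - 1) + integral {u-1..v} (\<lambda>v. F v (x v)) = picard u0 x0 x v" if "v \<in> {u-1..u+1}" for v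
      using picard_diff[OF assms, of "u - 1" v u0 x0] that by (simp add: algebra_simps)
    ultimately have "continuous_on {u-1..u+1} (picard u0 x0 x)" by (rule continuous_on_eq)
    then show ?thesis by (rule continuous_on_interior) simp
  qed
  then show ?thesis by (simp add: continuous_at_imp_continuous_on)
qed

text \<open>Picard iteration from the constant \<open>x0\<close>. On \<open>[u0 - R, u0 + R]\<close>
  consecutive iterates differ by at most \<open>C K^n \<bar>u - u0\<bar>^(n+1) / (n+1)!\<close>, so
  the telescoping series converges uniformly, and the Lipschitz bound carries the limit through the
  integral.\<close>

lemma solution_exists: "\<exists>x. ode_solution F x \<and> x u0 = x0"
proof -
  define X where "X n = (picard u0 x0 ^^ n) (\<lambda>_. x0)" for n
  have X_Suc: "X (Suc n) = picard u0 x0 (X n)" for n by (simp add: X_def)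
  have cont: "continuous_on UNIV (X n)" for n
    by (induction n) (simp_all add: X_Suc picard_continuous, simp add: X_def)
  have X_u0: "X n u0 = x0" for n
    by (cases n) (simp_all add: X_Suc picard_def signed_integral_def, simp add: X_def)
  define D where "D n u = X (Suc n) u - X n u" for n u
  define x where "x u = x0 + (\<Sum>n. D n u)" for u
  have lim: "uniform_limit {u0 - R..u0 + R} X x sequentially" if R: "R > 0" for R
  proof -
    obtain K where K: "K \<ge> 0" "\<And>u p q. u \<in> {u0 - R..u0 + R} \<Longrightarrow> norm (F u p - F u q) \<le> K * norm (p - q)"
      using lip[of "u0 - R" "u0 + R"] by blast
    obtain C where C: "C \<ge> 0" "\<And>u. u \<in> {u0 - R..u0 + R} \<Longrightarrow> norm (F u x0) \<le> C"
      using field_bounded[of "\<lambda>_. x0" "u0 - R" "u0 + R"] by auto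
    have seg: "v \<in> {u0 - R..u0 + R}" if "u \<in> {u0 - R..u0 + R}" "v \<in> closed_segment u0 u" for u v
      using that R by (auto simp: closed_segment_eq_real_ivl split: if_splits)
    have bound: "norm (D n u) \<le> C * K ^ n / fact (Suc n) * \<bar>u - u0\<bar> ^ Suc n" if "u \<in> {u0 - R..u0 + R}" for n u
      using that
    proof (induction n arbitrary: u)
      case 0
      have "norm (signed_integral u0 (\<lambda>v. F v x0) u) \<le> C * \<bar>u - u0\<bar> ^ Suc 0 / real (Suc 0)"
        using field_integrable(2)[of "\<lambda>_. x0"] C seg[OF 0] by (intro signed_integral_power_bound) auto
      then show ?case by (simp add: D_def X_Suc picard_def) (simp add: X_def)
    next
      case (Suc n)
      note iX = field_integrable(2)[OF cont]
      have "D (Suc n) u = signed_integral u0 (\<lambda>v. F v (X (Suc n) v) - F v (X n v)) u"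
      proof -
        have "X (Suc (Suc n)) u = picard u0 x0 (X (Suc n)) u" "X (Suc n) u = picard u0 x0 (X n) u"
          by (rule X_Suc[THEN fun_cong])+
        then have "D (Suc n) u = picard u0 x0 (X (Suc n)) u - picard u0 x0 (X n) u" by (simp only: D_def)
        then show ?thesis by (simp only: picard_def signed_integral_minus[OF iX iX]) simp
      qed
      also have "norm \<dots> \<le> (C * K ^ Suc n / fact (Suc n)) * \<bar>u - u0\<bar> ^ Suc (Suc n) / real (Suc (Suc n))"
      proof (intro signed_integral_power_bound integrable_diff iX)
        fix v assume "v \<in> closed_segment u0 u"
        then have v: "v \<in> {u0 - R..u0 + R}" using seg Suc.prems by blast
        have "norm (F v (X (Suc n) v) - F v (X n v)) \<le> K * norm (D n v)" unfolding D_def by (rule K(2)[OF v])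
        also have "\<dots> \<le> K * (C * K ^ n / fact (Suc n) * \<bar>v - u0\<bar> ^ Suc n)"
          by (intro mult_left_mono Suc.IH v K(1))
        finally show "norm (F v (X (Suc n) v) - F v (X n v)) \<le> C * K ^ Suc n / fact (Suc n) * \<bar>v - u0\<bar> ^ Suc n"
          by (simp add: mult_ac)
      qed (use C K in auto)
      finally show ?case by (simp add: fact_Suc[of "Suc n"] mult_ac del: power_Suc of_nat_Suc)
    qed
    have "summable (\<lambda>n. C * R * ((K * R) ^ n / fact n))"
      using summable_exp[of "K * R"] by (intro summable_mult) (simp add: field_simps)
    moreover have "norm (D n u) \<le> C * R * ((K * R) ^ n / fact n)" if u: "u \<in> {u0 - R..u0 + R}" for n u
    proof -
      have "C * K ^ n / fact (Suc n) * \<bar>u - u0\<bar> ^ Suc n \<le> C * K ^ n / fact n * R ^ Suc n"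
        using u C(1) K(1) by (intro mult_mono divide_left_mono power_mono fact_mono) auto
      then show ?thesis using bound[OF u, of n] by (simp add: power_mult_distrib mult_ac)
    qed
    ultimately have "uniform_limit {u0 - R..u0 + R} (\<lambda>n u. \<Sum>i<n. D i u) (\<lambda>u. \<Sum>n. D n u) sequentially"
      by (intro Weierstrass_m_test)
    then have "uniform_limit {u0 - R..u0 + R} (\<lambda>n u. x0 + (\<Sum>i<n. D i u)) x sequentially"
      unfolding x_def by (intro uniform_limit_add uniform_limit_const)
    moreover have "x0 + (\<Sum>i<n. D i u) = X n u" for n u
      unfolding D_def by (subst sum_lessThan_telescope) (simp add: X_def)
    ultimately show ?thesis by simp
  qed
  have pt: "(\<lambda>n. X n u) \<longlonglongrightarrow> x u" for u
    by (rule tendsto_uniform_limitI[OF lim[of "\<bar>u - u0\<bar> + 1"]]) auto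
  have x_cont: "continuous_on UNIV x"
  proof -
    have "isCont x u" for u
    proof -
      let ?R = "\<bar>u - u0\<bar> + 1"
      have "continuous_on {u0 - ?R..u0 + ?R} x"
        by (rule uniform_limit_theorem[OF _ lim]) (auto intro!: always_eventually continuous_on_subset[OF cont])
      then show ?thesis by (rule continuous_on_interior) auto
    qed
    then show ?thesis by (simp add: continuous_at_imp_continuous_on)
  qed
  have eq: "x b - x a = integral {a..b} (\<lambda>u. F u (x u))" if ab: "a \<le> b" for a b
  proof -
    define R where "R = \<bar>a - u0\<bar> + \<bar>b - u0\<bar> + 1"
    have R: "R > 0" "{a..b} \<subseteq> {u0 - R..u0 + R}" by (auto simp: R_def)
    obtain K where K: "K \<ge> 0" "\<And>u p q. u \<in> {a..b} \<Longrightarrow> norm (F u p - F u q) \<le> K * norm (p - q)"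
      using lip[of a b] by blast
    have "(\<lambda>n. integral {a..b} (\<lambda>u. F u (X n u))) \<longlonglongrightarrow> integral {a..b} (\<lambda>u. F u (x u))"
    proof (rule tendstoI)
      fix e :: real assume e: "e > 0"
      \<comment> \<open>The added ones keep the denominator positive when \<open>K = 0\<close> or
        \<open>a = b\<close>.\<close>
      define e' where "e' = e / ((K + 1) * (b - a + 1))"
      have e': "e' > 0" using e K(1) ab by (simp add: e'_def)
      have "K * e' * (b - a) < (K + 1) * e' * (b - a + 1)" using K(1) e' ab by (intro mult_strict_mono' mult_strict_right_mono) auto
      also have "\<dots> = e" using K(1) ab by (simp add: e'_def)
      finally have small: "K * e' * (b - a) < e" .
      show "\<forall>\<^sub>F n in sequentially. dist (integral {a..b} (\<lambda>u. F u (X n u))) (integral {a..b} (\<lambda>u. F u (x u))) < e"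
        using uniform_limitD[OF lim[OF R(1)] e']
      proof eventually_elim
        case (elim n)
        note i = field_integrable(2)[OF cont[of n], of a b] field_integrable(2)[OF x_cont, of a b]
        have "norm (F u (X n u) - F u (x u)) \<le> K * e'" if u: "u \<in> {a..b}" for u
        proof -
          have "norm (F u (X n u) - F u (x u)) \<le> K * norm (X n u - x u)" by (rule K(2)[OF u])
          also have "\<dots> \<le> K * e'"
          proof (rule mult_left_mono[OF _ K(1)])
            have "u \<in> {u0 - R..u0 + R}" using u R(2) by blast
            then show "norm (X n u - x u) \<le> e'" using elim by (simp add: dist_norm less_imp_le)
          qed
          finally show ?thesis .
        qed
        then have "norm (integral {a..b} (\<lambda>u. F u (X n u) - F u (x u))) \<le> integral {a..b} (\<lambda>_. K * e')"
          using i by (intro integral_norm_bound_integral integrable_diff) auto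
        then show ?case using ab small i
          by (simp add: dist_norm Henstock_Kurzweil_Integration.integral_diff mult_ac)
      qed
    qed
    moreover have "(\<lambda>n. X (Suc n) b - X (Suc n) a) \<longlonglongrightarrow> x b - x a"
      by (intro tendsto_diff LIMSEQ_Suc pt)
    ultimately show ?thesis
      unfolding X_Suc picard_diff[OF cont ab] by (metis LIMSEQ_unique)
  qed
  have "x u0 = x0" using LIMSEQ_unique[OF pt[of u0]] X_u0 by simp
  moreover have "ode_solution F x" unfolding ode_solution_def using eq field_integrable(1)[OF x_cont] by blast
  ultimately show ?thesis by blast
qed

end

subsection \<open>Dynamic equations\<close>

context time_scale_set
begin

text \<open>The defining estimate is available at \<open>r = t\<close> itself, for every
  \<open>\<epsilon>\<close>.\<close>

lemma delta_derivative_at: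
  assumes "has_delta_derivative T x \<gamma> t" "t \<in> T"
  shows "x (sigma T t) - x t = mu T t *\<^sub>R \<gamma>"
proof -
  have "norm (x (sigma T t) - x t - mu T t *\<^sub>R \<gamma>) \<le> 0"
  proof (rule field_le_epsilon)
    fix e :: real assume e: "e > 0"
    have m: "0 < mu T t + 1" using mu_ge_0[of t] by simp
    have "e / (mu T t + 1) > 0" using e m by simp
    then obtain W where "open W" "t \<in> W" "\<And>r. r \<in> W \<inter> T \<Longrightarrow>
        norm (x (sigma T t) - x r - (sigma T t - r) *\<^sub>R \<gamma>) \<le> e / (mu T t + 1) * \<bar>sigma T t - r\<bar>"
      using assms(1) unfolding has_delta_derivative_def by meson
    from this(3)[of t] this(2) assms(2)
    have "norm (x (sigma T t) - x t - mu T t *\<^sub>R \<gamma>) \<le> e / (mu T t + 1) * mu T t"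
      using mu_ge_0[of t] by (simp add: mu_def)
    also have "\<dots> \<le> e" using e m by (simp add: field_simps)
    finally show "norm (x (sigma T t) - x t - mu T t *\<^sub>R \<gamma>) \<le> 0 + e" by simp
  qed
  then show ?thesis by simp
qed

lemma delta_derivative_near:
  assumes "has_delta_derivative T x \<gamma> t" "e > 0"
  obtains \<delta> where "\<delta> > 0" "\<And>r. r \<in> T \<Longrightarrow> \<bar>r - t\<bar> < \<delta> \<Longrightarrow>
        norm (x (sigma T t) - x r - (sigma T t - r) *\<^sub>R \<gamma>) \<le> e * \<bar>sigma T t - r\<bar>"
proof -
  obtain W where W: "open W" "t \<in> W" "\<And>r. r \<in> W \<inter> T \<Longrightarrow>
      norm (x (sigma T t) - x r - (sigma T t - r) *\<^sub>R \<gamma>) \<le> e * \<bar>sigma T t - r\<bar>"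
    using assms unfolding has_delta_derivative_def by meson
  obtain \<delta> where "\<delta> > 0" "ball t \<delta> \<subseteq> W" using W(1,2) openE by blast
  then show ?thesis using W(3) by (intro that[of \<delta>]) (auto simp: dist_real_def abs_minus_commute subset_iff)
qed

lemma delta_derivative_continuous:
  assumes der: "has_delta_derivative T x \<gamma> t" and t: "t \<in> T"
  shows "continuous (at t within T) x"
  unfolding continuous_within_eps_delta
proof (intro allI impI)
  fix e :: real assume e: "e > 0"
  \<comment> \<open>The increment is at most \<open>e2 * (mu T t + 1)\<close>, from the defining
    estimate, plus \<open>e2 * norm \<gamma>\<close>; one more unit makes the inequality
    strict.\<close>
  define k where "k = norm \<gamma> + mu T t + 2"
  have k: "k > 0" using mu_ge_0[of t] by (auto simp: k_def intro: add_nonneg_pos)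
  define e1 where "e1 = min 1 (e / k)"
  have e1: "e1 > 0" "e1 \<le> 1" "e1 * k \<le> e" using e k by (auto simp: e1_def min_def field_simps)
  define e2 where "e2 = e1 / 2"
  have "e2 > 0" using e1 by (simp add: e2_def)
  from delta_derivative_near[OF der this] obtain \<delta> where \<delta>: "\<delta> > 0" "\<And>r. r \<in> T \<Longrightarrow> \<bar>r - t\<bar> < \<delta> \<Longrightarrow>
        norm (x (sigma T t) - x r - (sigma T t - r) *\<^sub>R \<gamma>) \<le> e2 * \<bar>sigma T t - r\<bar>" by blast
  show "\<exists>d>0. \<forall>r\<in>T. dist r t < d \<longrightarrow> dist (x r) (x t) < e"
  proof (intro exI conjI ballI impI)
    show "0 < min \<delta> e2" using \<delta>(1) \<open>e2 > 0\<close> by simp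
    fix r assume r: "r \<in> T" "dist r t < min \<delta> e2"
    then have d: "\<bar>r - t\<bar> < \<delta>" "\<bar>t - r\<bar> < e2" by (auto simp: dist_real_def abs_minus_commute)
    have "x t - x r = (x (sigma T t) - x r - (sigma T t - r) *\<^sub>R \<gamma>) + (t - r) *\<^sub>R \<gamma>"
      using delta_derivative_at[OF der t] by (simp add: mu_def algebra_simps)
    then have "norm (x t - x r) \<le> norm (x (sigma T t) - x r - (sigma T t - r) *\<^sub>R \<gamma>) + norm ((t - r) *\<^sub>R \<gamma>)"
      using norm_triangle_ineq by metis
    also have "norm ((t - r) *\<^sub>R \<gamma>) \<le> e2 * norm \<gamma>" using d by (simp add: mult_right_mono)
    also have "norm (x (sigma T t) - x r - (sigma T t - r) *\<^sub>R \<gamma>) \<le> e2 * (mu T t + 1)"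
    proof -
      have "\<bar>t - r\<bar> < 1" using d e1 by (simp add: e2_def)
      then have "\<bar>sigma T t - r\<bar> \<le> mu T t + 1" using sigma_ge[of t] unfolding mu_def by linarith
      then show ?thesis using \<delta>(2)[OF r(1) d(1)] \<open>e2 > 0\<close> by (meson mult_left_mono less_imp_le order_trans)
    qed
    also have "e2 * (mu T t + 1) + e2 * norm \<gamma> < e2 * k" using \<open>e2 > 0\<close> by (simp add: k_def algebra_simps)
    also have "e2 * k \<le> e" using e1 e by (simp add: e2_def)
    finally show "dist (x r) (x t) < e" by (simp add: dist_norm norm_minus_commute)
  qed
qed

text \<open>Continuous induction: the largest point \<open>z\<close> at which the estimate holds can
  be passed if it is not \<open>b\<close>, by the exact jump when \<open>z\<close> is
  right-scattered and by the derivative estimate when it is right-dense. The latter costs a slack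
  \<open>e\<close>, removed at the end.\<close>

lemma delta_mean_value:
  assumes der: "\<And>t. t \<in> T \<Longrightarrow> has_delta_derivative T x (g t) t"
    and ab: "a \<in> T" "b \<in> T" "a \<le> b" and bound: "\<And>t. t \<in> T \<Longrightarrow> a \<le> t \<Longrightarrow> t \<le> b \<Longrightarrow> norm (g t) \<le> C"
  shows "norm (x b - x a) \<le> C * (b - a)"
proof -
  have cont: "continuous_on T x"
    using delta_derivative_continuous[OF der] by (simp add: continuous_on_eq_continuous_within)
  have C: "C \<ge> 0" using bound[OF ab(1)] ab(3) norm_ge_zero[of "g a"] by linarith
  have main: "norm (x b - x a) \<le> (C + e) * (b - a)" if e: "e > 0" for e
  proof -
    define Z where "Z = {t \<in> T \<inter> {a..b}. norm (x t - x a) \<le> (C + e) * (t - a)}"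
    have step: "r \<in> Z" if "t \<in> Z" "r \<in> T" "t \<le> r" "r \<le> b" "norm (x r - x t) \<le> (C + e) * (r - t)" for t r
    proof -
      have "norm (x r - x a) \<le> norm (x r - x t) + norm (x t - x a)" by (rule norm_diff_triangle_le) auto
      also have "\<dots> \<le> (C + e) * (r - t) + (C + e) * (t - a)" using that by (intro add_mono) (auto simp: Z_def)
      also have "\<dots> = (C + e) * (r - a)" by (simp add: algebra_simps)
      finally show ?thesis using that by (auto simp: Z_def)
    qed
    have "closed Z"
    proof -
      have "Z = (T \<inter> {a..b}) \<inter> (\<lambda>t. norm (x t - x a) - (C + e) * (t - a)) -` {..0}" by (auto simp: Z_def)
      moreover have "closed \<dots>"
        by (rule continuous_closed_preimage) (auto intro!: continuous_intros continuous_on_subset[OF cont] closed_T)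
      ultimately show ?thesis by simp
    qed
    moreover have "a \<in> Z" using ab by (simp add: Z_def)
    moreover have bdd: "bdd_above Z" by (rule bdd_aboveI[of _ b]) (auto simp: Z_def)
    ultimately have "Sup Z \<in> Z" by (intro closed_contains_Sup) auto
    define z where "z = Sup Z"
    have z: "z \<in> Z" "z \<in> T" "a \<le> z" "z \<le> b" using \<open>Sup Z \<in> Z\<close> by (auto simp: z_def Z_def)
    have max: "t \<le> z" if "t \<in> Z" for t unfolding z_def using that bdd by (rule cSup_upper)
    have "z = b"
    proof (rule ccontr)
      assume "z \<noteq> b"
      then have zb: "z < b" using z by simp
      have gz: "norm (g z) \<le> C" using bound z by simp
      show False
      proof (cases "mu T z > 0")
        case True
        have "norm (x (sigma T z) - x z) \<le> (C + e) * (sigma T z - z)"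
          using delta_derivative_at[OF der[OF z(2)] z(2)] True gz e by (simp add: mu_def mult.commute mult_left_mono)
        then have "sigma T z \<in> Z"
          using sigma_le[OF ab(2) zb] sigma_in_T[OF z(2)] sigma_ge[of z] by (intro step[OF z(1)]) auto
        then show False using max[of "sigma T z"] True by (simp add: mu_def)
      next
        case False
        then have sz: "sigma T z = z" using mu_ge_0[of z] by (simp add: mu_def)
        obtain \<delta> where \<delta>: "\<delta> > 0" "\<And>r. r \<in> T \<Longrightarrow> \<bar>r - z\<bar> < \<delta> \<Longrightarrow>
            norm (x (sigma T z) - x r - (sigma T z - r) *\<^sub>R g z) \<le> e * \<bar>sigma T z - r\<bar>"
          using delta_derivative_near[OF der[OF z(2)] e] by blast
        have "Inf {r \<in> T. r > z} < min b (z + \<delta>)" using sz zb \<delta>(1) by (simp add: sigma_def)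
        moreover have "{r \<in> T. r > z} \<noteq> {}" using ex_greater[of z] by blast
        moreover have "bdd_below {r \<in> T. r > z}" by (rule bdd_belowI[of _ z]) auto
        ultimately obtain r where r: "r \<in> T" "z < r" "r < b" "r < z + \<delta>"
          using cInf_less_iff[of "{r \<in> T. r > z}" "min b (z + \<delta>)"] by auto
        have "x r - x z = (r - z) *\<^sub>R g z - (x z - x r - (z - r) *\<^sub>R g z)" by (simp add: algebra_simps)
        then have "norm (x r - x z) \<le> norm ((r - z) *\<^sub>R g z) + norm (x z - x r - (z - r) *\<^sub>R g z)"
          using norm_triangle_ineq4 by metis
        also have "\<dots> \<le> (r - z) * C + e * (r - z)"
          using \<delta>(2)[OF r(1)] r gz sz by (intro add_mono) (auto simp: mult_left_mono)
        also have "\<dots> = (C + e) * (r - z)" by (simp add: algebra_simps)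
        finally have "r \<in> Z" using r by (intro step[OF z(1)]) auto
        then show False using max[of r] r by simp
      qed
    qed
    then show ?thesis using z(1) by (simp add: Z_def)
  qed
  show ?thesis
  proof (rule field_le_epsilon)
    fix e :: real assume e: "e > 0"
    have "norm (x b - x a) \<le> (C + e / (b - a + 1)) * (b - a)" using e ab(3) by (intro main) auto
    also have "\<dots> \<le> C * (b - a) + e" using e ab(3) by (simp add: field_simps)
    finally show "norm (x b - x a) \<le> C * (b - a) + e" .
  qed
qed

text \<open>\<open>inj\<close> is regressivity: with it a zero at the right end of a gap forces one
  at the left end. All other propagation of zeros rests on the growth bound
  \<open>K\<close>.\<close>

lemma ts_linear_unique:
  fixes H :: "real \<Rightarrow> 'b \<Rightarrow> 'b::real_normed_vector"
  assumes der: "\<And>t. t \<in> T \<Longrightarrow> has_delta_derivative T w (H t (w t)) t"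
    and K: "K \<ge> 0" "\<And>t y. t \<in> T \<Longrightarrow> norm (H t y) \<le> K * norm y"
    and inj: "\<And>t y. t \<in> T \<Longrightarrow> y + mu T t *\<^sub>R H t y = 0 \<Longrightarrow> y = 0"
    and zero: "\<tau> \<in> T" "w \<tau> = 0" and t: "t \<in> T"
  shows "w t = 0"
proof (rule zero_propagation_everywhere[of T \<tau> t w])
  show "continuous_on T w"
    using delta_derivative_continuous[OF der] by (simp add: continuous_on_eq_continuous_within)
next
  fix a b :: real assume "a \<le> b"
  show "\<exists>K\<ge>0. \<forall>c d M. c \<in> T \<longrightarrow> d \<in> T \<longrightarrow> a \<le> c \<longrightarrow> c \<le> d \<longrightarrow> d \<le> b \<longrightarrow>
        (\<forall>t\<in>T. c \<le> t \<longrightarrow> t \<le> d \<longrightarrow> norm (w t) \<le> M) \<longrightarrow> norm (w d - w c) \<le> K * M * (d - c)"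
  proof (intro exI[of _ K] conjI allI impI)
    fix c d M assume cd: "c \<in> T" "d \<in> T" "c \<le> d" and M: "\<forall>t\<in>T. c \<le> t \<longrightarrow> t \<le> d \<longrightarrow> norm (w t) \<le> M"
    show "norm (w d - w c) \<le> K * M * (d - c)"
    proof (rule delta_mean_value[OF der cd])
      fix t assume t: "t \<in> T" "c \<le> t" "t \<le> d"
      have "norm (H t (w t)) \<le> K * norm (w t)" by (rule K(2)[OF t(1)])
      also have "\<dots> \<le> K * M" using M t K(1) by (intro mult_left_mono) auto
      finally show "norm (H t (w t)) \<le> K * M" .
    qed
  qed (rule K(1))
next
  fix c d assume cd: "c \<in> T" "d \<in> T" "c < d" "T \<inter> {c<..<d} = {}"
  have "sigma T c = d"
  proof (rule antisym)
    show "sigma T c \<le> d" using cd by (intro sigma_le)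
    show "d \<le> sigma T c" unfolding sigma_def using cd ex_greater[of c]
      by (intro cInf_greatest) (auto simp: disjoint_iff not_less[symmetric])
  qed
  then have wd: "w d - w c = mu T c *\<^sub>R H c (w c)" using delta_derivative_at[OF der[OF cd(1)] cd(1)] by simp
  have "H c 0 = 0" using K(2)[OF cd(1), of 0] by simp
  then show "w c = 0 \<longleftrightarrow> w d = 0"
    using wd inj[OF cd(1), of "w c"] by (auto simp: algebra_simps)
qed (use closed_T zero t in auto)

text \<open>At a right-scattered \<open>t\<close> the jump makes the defining estimate exact for
  \<open>r = t\<close>, and continuity extends it to nearby \<open>r\<close>, because the distance
  from \<open>r\<close> to \<open>sigma T t\<close> stays at least half the gap. At a right-dense
  \<open>t\<close> the integrand between \<open>s r\<close> and \<open>s t\<close> is compared with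
  the constant \<open>\<gamma>\<close>, and the length of that interval with
  \<open>\<bar>t - r\<bar>\<close> up to a quadratic error.\<close>

lemma ode_restrict_ts_solution:
  fixes \<Psi> :: "real \<Rightarrow> 'a::euclidean_space"
  assumes sol: "ode_solution F \<Psi>" and cont: "continuous_on UNIV \<Psi>" and s_cont: "continuous_on UNIV s"
    and jump: "\<And>t. t \<in> T \<Longrightarrow> mu T t > 0 \<Longrightarrow> \<Psi> (s (sigma T t)) = \<Psi> (s t) + mu T t *\<^sub>R H t (\<Psi> (s t))"
    and dense: "\<And>t e. t \<in> T \<Longrightarrow> mu T t = 0 \<Longrightarrow> e > 0 \<Longrightarrow> \<exists>\<delta>>0. \<forall>r\<in>T. \<bar>r - t\<bar> < \<delta> \<longrightarrow>
       (\<forall>u\<in>closed_segment (s r) (s t). norm (F u (\<Psi> u) - H t (\<Psi> (s t))) \<le> e)"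
  shows "ts_solution T H (\<lambda>t. \<Psi> (s t))"
  unfolding ts_solution_def has_delta_derivative_def
proof (intro ballI allI impI)
  fix t e :: real assume t: "t \<in> T" and e: "e > 0"
  define \<gamma> where "\<gamma> = H t (\<Psi> (s t))"
  define x where "x = (\<lambda>t. \<Psi> (s t))"
  have "\<exists>\<delta>>0. \<forall>r\<in>T. \<bar>r - t\<bar> < \<delta> \<longrightarrow> norm (x (sigma T t) - x r - (sigma T t - r) *\<^sub>R \<gamma>) \<le> e * \<bar>sigma T t - r\<bar>"
  proof (cases "mu T t > 0")
    case True
    have "isCont (\<lambda>r. norm (x t - x r - (t - r) *\<^sub>R \<gamma>)) t"
    proof -
      have "isCont x t" unfolding x_def
        using cont s_cont by (auto intro!: isCont_o2[of _ s \<Psi>] simp: continuous_on_eq_continuous_at)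
      then show ?thesis by (intro continuous_intros)
    qed
    then have "\<forall>e>0. \<exists>d>0. \<forall>r. dist r t < d \<longrightarrow> dist (norm (x t - x r - (t - r) *\<^sub>R \<gamma>)) (norm (x t - x t - (t - t) *\<^sub>R \<gamma>)) < e"
      unfolding continuous_at_eps_delta .
    moreover have "e * (mu T t / 2) > 0" using e True by simp
    ultimately obtain d where d1: "d > 0" "\<And>r. dist r t < d \<Longrightarrow>
        dist (norm (x t - x r - (t - r) *\<^sub>R \<gamma>)) (norm (x t - x t - (t - t) *\<^sub>R \<gamma>)) < e * (mu T t / 2)"
      by blast
    have d: "d > 0" "norm (x t - x r - (t - r) *\<^sub>R \<gamma>) < e * (mu T t / 2)" if "dist r t < d" for r
      using d1(1) d1(2)[OF that] by (simp_all add: dist_real_def)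
    show ?thesis
    proof (intro exI[of _ "min d (mu T t / 2)"] conjI ballI impI)
      show "0 < min d (mu T t / 2)" using d1 True by simp
      fix r assume r: "r \<in> T" "\<bar>r - t\<bar> < min d (mu T t / 2)"
      have "x (sigma T t) - x r - (sigma T t - r) *\<^sub>R \<gamma> = x t - x r - (t - r) *\<^sub>R \<gamma>"
        using jump[OF t True] by (simp add: x_def \<gamma>_def mu_def algebra_simps)
      moreover have "norm (x t - x r - (t - r) *\<^sub>R \<gamma>) \<le> e * (mu T t / 2)"
        using d(2)[of r] r by (simp add: dist_real_def)
      ultimately have "norm (x (sigma T t) - x r - (sigma T t - r) *\<^sub>R \<gamma>) \<le> e * (mu T t / 2)" by (simp only:)
      also have "\<dots> \<le> e * \<bar>sigma T t - r\<bar>"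
      proof (intro mult_left_mono)
        show "mu T t / 2 \<le> \<bar>sigma T t - r\<bar>" using r(2) unfolding mu_def by (simp add: abs_if split: if_splits)
      qed (use e in simp)
      finally show "norm (x (sigma T t) - x r - (sigma T t - r) *\<^sub>R \<gamma>) \<le> e * \<bar>sigma T t - r\<bar>" .
    qed
  next
    case False
    then have m: "mu T t = 0" "sigma T t = t" using mu_ge_0[of t] by (auto simp: mu_def)
    have "e / 2 > 0" using e by simp
    from dense[OF t m(1) this] obtain \<delta> where \<delta>: "\<delta> > 0" "\<And>r u. r \<in> T \<Longrightarrow> \<bar>r - t\<bar> < \<delta> \<Longrightarrow>
        u \<in> closed_segment (s r) (s t) \<Longrightarrow> norm (F u (\<Psi> u) - \<gamma>) \<le> e / 2" unfolding \<gamma>_def by blast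
    have key: "norm (x q - x p - (q - p) *\<^sub>R \<gamma>) \<le> e / 2 * (q - p) + (q - p)\<^sup>2 * norm \<gamma>"
      if pq: "p \<in> T" "q \<in> T" "p \<le> q" and b: "\<And>u. u \<in> {s p..s q} \<Longrightarrow> norm (F u (\<Psi> u) - \<gamma>) \<le> e / 2" for p q
    proof -
      have sle: "s p \<le> s q" using renorm_strict_mono pq(3) by (simp add: strict_mono_less_eq)
      have int: "(\<lambda>u. F u (\<Psi> u)) integrable_on {s p..s q}"
        using sol sle by (auto simp: ode_solution_def intro: set_lebesgue_integral_eq_integral(1))
      have "x q - x p - (s q - s p) *\<^sub>R \<gamma> = integral {s p..s q} (\<lambda>u. F u (\<Psi> u) - \<gamma>)"
        using sol sle Henstock_Kurzweil_Integration.integral_diff[OF int integrable_const_ivl[of \<gamma>]]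
        by (simp add: x_def ode_solution_def)
      also have "norm \<dots> \<le> integral {s p..s q} (\<lambda>_. e / 2)"
        using int b by (intro integral_norm_bound_integral integrable_diff) auto
      also have "\<dots> = e / 2 * (s q - s p)" using sle by simp
      also have "\<dots> \<le> e / 2 * (q - p)" using renorm_sandwich(1)[OF pq] e by (intro mult_left_mono) auto
      finally have 1: "norm (x q - x p - (s q - s p) *\<^sub>R \<gamma>) \<le> e / 2 * (q - p)" .
      have 2: "norm (((q - p) - (s q - s p)) *\<^sub>R \<gamma>) \<le> (q - p)\<^sup>2 * norm \<gamma>"
        using renorm_sandwich(1,2)[OF pq] by (auto intro!: mult_right_mono)
      have "x q - x p - (q - p) *\<^sub>R \<gamma> = (x q - x p - (s q - s p) *\<^sub>R \<gamma>) - ((q - p) - (s q - s p)) *\<^sub>R \<gamma>"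
        by (simp add: algebra_simps)
      then have "norm (x q - x p - (q - p) *\<^sub>R \<gamma>) \<le> norm (x q - x p - (s q - s p) *\<^sub>R \<gamma>) + norm (((q - p) - (s q - s p)) *\<^sub>R \<gamma>)"
        using norm_triangle_ineq4 by metis
      then show ?thesis using 1 2 by linarith
    qed
    \<comment> \<open>Half of \<open>e\<close> pays for the deviation of the integrand from
      \<open>\<gamma>\<close>, the other half for the quadratic error in the length.\<close>
    define \<delta>' where "\<delta>' = min \<delta> (e / 2 / (norm \<gamma> + 1))"
    have g1: "norm \<gamma> + 1 > 0" by (simp add: add_nonneg_pos)
    have small: "e / 2 * h + h\<^sup>2 * norm \<gamma> \<le> e * h" if "0 \<le> h" "h < \<delta>'" for h
    proof -
      have "h * norm \<gamma> \<le> e / 2 / (norm \<gamma> + 1) * norm \<gamma>" using that by (intro mult_right_mono) (auto simp: \<delta>'_def)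
      also have "\<dots> \<le> e / 2" using g1 e by (simp add: field_simps)
      finally have "h * (h * norm \<gamma>) \<le> h * (e / 2)" using that by (intro mult_left_mono)
      then show ?thesis by (simp add: power2_eq_square algebra_simps)
    qed
    show ?thesis
    proof (intro exI[of _ \<delta>'] conjI ballI impI)
      show "0 < \<delta>'" using \<delta>(1) e g1 by (simp add: \<delta>'_def)
      fix r assume r: "r \<in> T" "\<bar>r - t\<bar> < \<delta>'"
      then have rd: "\<bar>r - t\<bar> < \<delta>" by (simp add: \<delta>'_def)
      show "norm (x (sigma T t) - x r - (sigma T t - r) *\<^sub>R \<gamma>) \<le> e * \<bar>sigma T t - r\<bar>"
      proof (cases "r \<le> t")
        case True
        have "s r \<le> s t" using renorm_strict_mono True by (simp add: strict_mono_less_eq)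
        then have "norm (x t - x r - (t - r) *\<^sub>R \<gamma>) \<le> e / 2 * (t - r) + (t - r)\<^sup>2 * norm \<gamma>"
          using \<delta>(2)[OF r(1) rd] True by (intro key r(1) t) (auto simp: closed_segment_eq_real_ivl)
        also have "\<dots> \<le> e * (t - r)" using True r(2) by (intro small) auto
        finally show ?thesis using True m by simp
      next
        case False
        have "s t \<le> s r" using renorm_strict_mono False by (simp add: strict_mono_less_eq)
        then have "norm (x r - x t - (r - t) *\<^sub>R \<gamma>) \<le> e / 2 * (r - t) + (r - t)\<^sup>2 * norm \<gamma>"
          using \<delta>(2)[OF r(1) rd] False by (intro key r(1) t) (auto simp: closed_segment_eq_real_ivl split: if_splits)
        also have "\<dots> \<le> e * (r - t)" using False r(2) by (intro small) auto
        also have "norm (x r - x t - (r - t) *\<^sub>R \<gamma>) = norm (x t - x r - (t - r) *\<^sub>R \<gamma>)"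
          by (subst norm_minus_cancel[symmetric]) (simp add: algebra_simps)
        finally show ?thesis using False m by simp
      qed
    qed
  qed
  then obtain \<delta> where \<delta>: "\<delta> > 0" "\<And>r. r \<in> T \<Longrightarrow> \<bar>r - t\<bar> < \<delta> \<Longrightarrow>
      norm (x (sigma T t) - x r - (sigma T t - r) *\<^sub>R \<gamma>) \<le> e * \<bar>sigma T t - r\<bar>" by blast
  show "\<exists>W. open W \<and> t \<in> W \<and> (\<forall>r\<in>W \<inter> T. norm (\<Psi> (s (sigma T t)) - \<Psi> (s r) - (sigma T t - r) *\<^sub>R H t (\<Psi> (s t))) \<le> e * \<bar>sigma T t - r\<bar>)"
  proof (intro exI[of _ "ball t \<delta>"] conjI ballI)
    fix r assume "r \<in> ball t \<delta> \<inter> T"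
    then show "norm (\<Psi> (s (sigma T t)) - \<Psi> (s r) - (sigma T t - r) *\<^sub>R H t (\<Psi> (s t))) \<le> e * \<bar>sigma T t - r\<bar>"
      using \<delta>(2)[of r] by (simp add: x_def \<gamma>_def dist_real_def abs_minus_commute)
  qed (use \<delta>(1) in auto)
qed

end

section \<open>Delta derivatives of linear images and of differences\<close>

lemma has_delta_derivative_bounded_linear:
  assumes "bounded_linear f" "has_delta_derivative T x \<gamma> t"
  shows "has_delta_derivative T (\<lambda>t. f (x t)) (f \<gamma>) t"
proof -
  interpret f: bounded_linear f by fact
  obtain K where K: "K > 0" "\<And>y. norm (f y) \<le> norm y * K" using f.pos_bounded by blast
  show ?thesis unfolding has_delta_derivative_def
  proof (intro allI impI)
    fix e :: real assume "e > 0"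
    then have "e / K > 0" using K by simp
    then obtain W where W: "open W" "t \<in> W" "\<And>r. r \<in> W \<inter> T \<Longrightarrow>
       norm (x (sigma T t) - x r - (sigma T t - r) *\<^sub>R \<gamma>) \<le> e / K * \<bar>sigma T t - r\<bar>"
      using assms(2) unfolding has_delta_derivative_def by meson
    show "\<exists>W. open W \<and> t \<in> W \<and> (\<forall>r\<in>W \<inter> T. norm (f (x (sigma T t)) - f (x r) - (sigma T t - r) *\<^sub>R f \<gamma>) \<le> e * \<bar>sigma T t - r\<bar>)"
    proof (intro exI[of _ W] conjI ballI W(1,2))
      fix r assume r: "r \<in> W \<inter> T"
      have "f (x (sigma T t)) - f (x r) - (sigma T t - r) *\<^sub>R f \<gamma> = f (x (sigma T t) - x r - (sigma T t - r) *\<^sub>R \<gamma>)"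
        by (simp add: f.diff f.scaleR)
      also have "norm \<dots> \<le> norm (x (sigma T t) - x r - (sigma T t - r) *\<^sub>R \<gamma>) * K" by (rule K(2))
      also have "\<dots> \<le> e / K * \<bar>sigma T t - r\<bar> * K" using W(3)[OF r] K(1) by (intro mult_right_mono) auto
      finally show "norm (f (x (sigma T t)) - f (x r) - (sigma T t - r) *\<^sub>R f \<gamma>) \<le> e * \<bar>sigma T t - r\<bar>"
        using K(1) by simp
    qed
  qed
qed

lemma has_delta_derivative_diff:
  assumes "has_delta_derivative T x \<gamma> t" "has_delta_derivative T y \<eta> t"
  shows "has_delta_derivative T (\<lambda>t. x t - y t) (\<gamma> - \<eta>) t"
  unfolding has_delta_derivative_def
proof (intro allI impI)
  fix e :: real assume "e > 0"
  then have e: "e / 2 > 0" by simp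
  obtain W where W: "open W" "t \<in> W" "\<And>r. r \<in> W \<inter> T \<Longrightarrow>
      norm (x (sigma T t) - x r - (sigma T t - r) *\<^sub>R \<gamma>) \<le> e / 2 * \<bar>sigma T t - r\<bar>"
    using assms(1) e unfolding has_delta_derivative_def by meson
  obtain V where V: "open V" "t \<in> V" "\<And>r. r \<in> V \<inter> T \<Longrightarrow>
      norm (y (sigma T t) - y r - (sigma T t - r) *\<^sub>R \<eta>) \<le> e / 2 * \<bar>sigma T t - r\<bar>"
    using assms(2) e unfolding has_delta_derivative_def by meson
  show "\<exists>W. open W \<and> t \<in> W \<and> (\<forall>r\<in>W \<inter> T. norm (x (sigma T t) - y (sigma T t) - (x r - y r) - (sigma T t - r) *\<^sub>R (\<gamma> - \<eta>)) \<le> e * \<bar>sigma T t - r\<bar>)"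
  proof (intro exI[of _ "W \<inter> V"] conjI ballI)
    fix r assume r: "r \<in> W \<inter> V \<inter> T"
    have "x (sigma T t) - y (sigma T t) - (x r - y r) - (sigma T t - r) *\<^sub>R (\<gamma> - \<eta>)
        = (x (sigma T t) - x r - (sigma T t - r) *\<^sub>R \<gamma>) - (y (sigma T t) - y r - (sigma T t - r) *\<^sub>R \<eta>)"
      by (simp add: algebra_simps)
    then have "norm (x (sigma T t) - y (sigma T t) - (x r - y r) - (sigma T t - r) *\<^sub>R (\<gamma> - \<eta>))
        \<le> norm (x (sigma T t) - x r - (sigma T t - r) *\<^sub>R \<gamma>) + norm (y (sigma T t) - y r - (sigma T t - r) *\<^sub>R \<eta>)"
      using norm_triangle_ineq4 by metis
    then show "norm (x (sigma T t) - y (sigma T t) - (x r - y r) - (sigma T t - r) *\<^sub>R (\<gamma> - \<eta>)) \<le> e * \<bar>sigma T t - r\<bar>"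
      using W(3)[of r] V(3)[of r] r by simp
  qed (use W V in auto)
qed

subsection \<open>Functions transported by the renormalization\<close>

context time_scale_set
begin

definition \<kappa> :: "real \<Rightarrow> real" where "\<kappa> = inv s"

lemma s_\<kappa> [simp]: "s (\<kappa> u) = u" and \<kappa>_s [simp]: "\<kappa> (s t) = t"
  using renorm_surj strict_mono_imp_inj_on[OF renorm_strict_mono] by (simp_all add: \<kappa>_def surj_f_inv_f)

lemma s_less [simp]: "s a < s b \<longleftrightarrow> a < b" and s_le [simp]: "s a \<le> s b \<longleftrightarrow> a \<le> b"
  using renorm_strict_mono by (simp_all add: strict_mono_less strict_mono_less_eq)

lemma \<kappa>_le [simp]: "\<kappa> a \<le> \<kappa> b \<longleftrightarrow> a \<le> b" and \<kappa>_less [simp]: "\<kappa> a < \<kappa> b \<longleftrightarrow> a < b"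
  using s_le[of "\<kappa> a" "\<kappa> b"] s_less[of "\<kappa> a" "\<kappa> b"] by simp_all

lemma continuous_s: "continuous_on UNIV s"
  by (rule continuous_onI_mono) (use renorm_surj in auto)

lemma continuous_\<kappa>: "continuous_on UNIV \<kappa>"
proof (rule continuous_onI_mono)
  have "surj \<kappa>" unfolding surj_def using \<kappa>_s by metis
  then show "open (\<kappa> ` UNIV)" by simp
qed auto

definition scattered :: "real set" where "scattered = {t \<in> T. mu T t > 0}"

lemma countable_scattered: "countable scattered"
proof -
  have "scattered \<subseteq> (\<Union>n. rs (- real n) (real n))"
  proof
    fix t assume t: "t \<in> scattered"
    obtain n where "\<bar>t\<bar> < real n" using reals_Archimedean2 by blast
    then have "t \<in> rs (- real n) (real n)" using t by (auto simp: scattered_def rs_def)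
    then show "t \<in> (\<Union>n. rs (- real n) (real n))" by blast
  qed
  then show ?thesis by (rule countable_subset) (intro countable_UN countable_rs, simp)
qed

text \<open>\<open>\<alpha>\<close> is continuous on the set of right-dense points; what remains are
  countably many single points and countably many gaps, on each of which the function is
  constant.\<close>

lemma renorm_measurable:
  fixes \<phi> :: "real \<Rightarrow> 'c::euclidean_space"
  assumes rd: "rd_continuous T \<alpha>"
    and on: "\<And>t. t \<in> T \<Longrightarrow> \<phi> (s t) = \<alpha> t" and off: "\<And>t. t \<notin> T \<Longrightarrow> \<phi> (s t) = \<beta> (prev t)"
  shows "\<phi> \<in> borel_measurable borel"
proof -
  let ?\<psi> = "\<lambda>t. \<phi> (s t)"
  define C where "C = insert (T - scattered) ((\<lambda>t. {t}) ` scattered \<union> (\<lambda>t. {t<..<sigma T t}) ` scattered)"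
  have "?\<psi> \<in> borel_measurable borel"
  proof (rule measurable_piecewise_restrict[of C])
    show "countable C" unfolding C_def by (intro countable_insert countable_Un countable_image countable_scattered)
    have "scattered \<in> sets borel" by (rule sets.countable[OF _ countable_scattered]) simp
    then show "\<Omega> \<inter> space borel \<in> sets borel" if "\<Omega> \<in> C" for \<Omega>
      using that closed_T by (auto simp: C_def)
    show "space borel \<subseteq> \<Union> C"
    proof
      fix x :: real
      show "x \<in> \<Union> C"
      proof (cases "x \<in> T")
        case True
        then show ?thesis by (cases "x \<in> scattered") (auto simp: C_def)
      next
        case False
        then have "prev x \<in> scattered" "x \<in> {prev x<..<sigma T (prev x)}"
          using gap_bounds[OF False] prev_in_T by (auto simp: scattered_def)
        then show ?thesis by (auto simp: C_def)
      qed
    qed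
    fix \<Omega> assume "\<Omega> \<in> C"
    then consider "\<Omega> = T - scattered" | t where "\<Omega> = {t}" | t where "t \<in> scattered" "\<Omega> = {t<..<sigma T t}"
      by (auto simp: C_def)
    then show "?\<psi> \<in> measurable (restrict_space borel \<Omega>) borel"
    proof cases
      case 1
      have "continuous_on \<Omega> \<alpha>" unfolding continuous_on_eq_continuous_within
      proof
        fix t assume t: "t \<in> \<Omega>"
        then have "t \<in> T" "right_dense T t" using 1 mu_ge_0[of t] by (auto simp: scattered_def right_dense_def)
        then have "continuous (at t within T) \<alpha>" using rd by (auto simp: rd_continuous_def)
        then show "continuous (at t within \<Omega>) \<alpha>" by (rule continuous_within_subset) (use 1 in auto)
      qed
      then have "continuous_on \<Omega> ?\<psi>" by (rule continuous_on_eq) (use 1 on in auto)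
      then show ?thesis by (rule borel_measurable_continuous_on_restrict)
    next
      case 2
      have "(\<lambda>_. \<phi> (s t)) \<in> measurable (restrict_space borel \<Omega>) borel" by simp
      then show ?thesis by (rule measurable_cong[THEN iffD1, rotated]) (use 2 in \<open>auto simp: space_restrict_space\<close>)
    next
      case 3
      have "(\<lambda>_. \<beta> t) \<in> measurable (restrict_space borel \<Omega>) borel" by simp
      then show ?thesis
      proof (rule measurable_cong[THEN iffD1, rotated])
        fix x assume "x \<in> space (restrict_space borel \<Omega>)"
        then have x: "t < x" "x < sigma T t" using 3(2) by (auto simp: space_restrict_space)
        have "x \<notin> T" using no_gap_points[of x t] x by auto
        moreover have "prev x = t" using 3(1) x by (intro prev_eqI) (auto simp: scattered_def)
        ultimately show "\<beta> t = ?\<psi> x" using off by simp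
      qed
    qed
  qed
  then have "(\<lambda>u. ?\<psi> (\<kappa> u)) \<in> borel_measurable borel"
    using borel_measurable_continuous_onI[OF continuous_\<kappa>] by (rule measurable_compose[rotated])
  then show ?thesis by simp
qed

text \<open>Left ends of gaps of length at least \<open>\<delta>\<close> are at least
  \<open>\<delta>\<close> apart, so they have distinct integer parts after division by
  \<open>\<delta>\<close>.\<close>

lemma finite_large_gaps: assumes "\<delta> > 0" shows "finite {\<tau> \<in> T. p \<le> \<tau> \<and> \<tau> \<le> q \<and> mu T \<tau> \<ge> \<delta>}" (is "finite ?S")
proof (rule finite_imageD)
  show "finite ((\<lambda>\<tau>. \<lfloor>\<tau> / \<delta>\<rfloor>) ` ?S)"
  proof (rule finite_subset)
    show "(\<lambda>\<tau>. \<lfloor>\<tau> / \<delta>\<rfloor>) ` ?S \<subseteq> {\<lfloor>p / \<delta>\<rfloor>..\<lfloor>q / \<delta>\<rfloor>}"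
      using assms by (auto intro!: floor_mono divide_right_mono)
  qed simp
  have lt: "\<lfloor>a / \<delta>\<rfloor> < \<lfloor>b / \<delta>\<rfloor>" if "a \<in> ?S" "b \<in> ?S" "a < b" for a b
  proof -
    have "a + \<delta> \<le> b" using sigma_le[of b a] that by (auto simp: mu_def)
    then have "(a + \<delta>) / \<delta> \<le> b / \<delta>" using assms by (intro divide_right_mono) auto
    then have "a / \<delta> + 1 \<le> b / \<delta>" using assms by (simp add: add_divide_distrib)
    then show ?thesis by linarith
  qed
  show "inj_on (\<lambda>\<tau>. \<lfloor>\<tau> / \<delta>\<rfloor>) ?S"
  proof (rule inj_onI, rule ccontr)
    fix a b assume ab: "a \<in> ?S" "b \<in> ?S" "\<lfloor>a / \<delta>\<rfloor> = \<lfloor>b / \<delta>\<rfloor>" "a \<noteq> b"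
    then show False using lt[of a b] lt[of b a] by (cases "a < b") auto
  qed
qed

text \<open>On short gaps the value stays within a fixed distance of \<open>\<alpha>\<close>; a
  bounded interval meets only finitely many other gaps, each carrying a single value.\<close>

lemma renorm_bounded:
  fixes \<phi> :: "real \<Rightarrow> 'c::real_normed_vector"
  assumes on: "\<And>t. t \<in> T \<Longrightarrow> \<phi> (s t) = \<alpha> t" and off: "\<And>t. t \<notin> T \<Longrightarrow> \<phi> (s t) = \<beta> (prev t)"
    and \<alpha>: "\<And>t. t \<in> T \<Longrightarrow> norm (\<alpha> t) \<le> K"
    and \<beta>: "\<delta> > 0" "\<And>\<tau>. \<tau> \<in> T \<Longrightarrow> 0 < mu T \<tau> \<Longrightarrow> mu T \<tau> < \<delta> \<Longrightarrow> norm (\<beta> \<tau> - \<alpha> \<tau>) \<le> C * mu T \<tau>"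
  shows "\<exists>B\<ge>0. \<forall>u\<in>{a..b}. norm (\<phi> u) \<le> B"
proof -
  \<comment> \<open>The gap around \<open>\<kappa> a\<close> may begin before
    \<open>\<kappa> a\<close>, hence the lower end \<open>prev (\<kappa> a)\<close>.\<close>
  define S where "S = {\<tau> \<in> T. prev (\<kappa> a) \<le> \<tau> \<and> \<tau> \<le> \<kappa> b \<and> mu T \<tau> \<ge> \<delta>}"
  have fin: "finite S" unfolding S_def by (rule finite_large_gaps[OF \<beta>(1)])
  define B where "B = \<bar>K\<bar> + \<bar>C\<bar> * \<delta> + (\<Sum>\<tau>\<in>S. norm (\<beta> \<tau>))"
  have pos: "0 \<le> \<bar>C\<bar> * \<delta>" "0 \<le> (\<Sum>\<tau>\<in>S. norm (\<beta> \<tau>))" using \<beta>(1) by (auto intro: sum_nonneg)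
  have "norm (\<phi> u) \<le> B" if u: "u \<in> {a..b}" for u
  proof (cases "\<kappa> u \<in> T")
    case True
    have "norm (\<phi> u) \<le> K" using on[OF True] \<alpha>[OF True] by simp
    then show ?thesis using pos unfolding B_def by linarith
  next
    case False
    let ?\<tau> = "prev (\<kappa> u)"
    have \<phi>: "\<phi> u = \<beta> ?\<tau>" using off[OF False] by simp
    note g = gap_bounds[OF False]
    show ?thesis
    proof (cases "mu T ?\<tau> < \<delta>")
      case True
      have "norm (\<beta> ?\<tau> - \<alpha> ?\<tau>) \<le> C * mu T ?\<tau>" using \<beta>(2)[OF prev_in_T g(3) True] .
      also have "\<dots> \<le> \<bar>C\<bar> * mu T ?\<tau>" using g(3) by (intro mult_right_mono) auto
      also have "\<dots> \<le> \<bar>C\<bar> * \<delta>" using True by (intro mult_left_mono) auto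
      finally have "norm (\<beta> ?\<tau>) \<le> norm (\<alpha> ?\<tau>) + \<bar>C\<bar> * \<delta>"
        using norm_triangle_sub[of "\<beta> ?\<tau>" "\<alpha> ?\<tau>"] by linarith
      then show ?thesis using \<alpha>[OF prev_in_T, of "\<kappa> u"] pos unfolding \<phi> B_def by linarith
    next
      case False
      have "prev (\<kappa> a) \<le> ?\<tau>" using u by (intro prev_ge prev_in_T order_trans[OF prev_le]) auto
      moreover have "?\<tau> \<le> \<kappa> b" using u by (intro order_trans[OF prev_le]) auto
      ultimately have "?\<tau> \<in> S" using False prev_in_T by (auto simp: S_def)
      then have "norm (\<beta> ?\<tau>) \<le> (\<Sum>\<tau>\<in>S. norm (\<beta> \<tau>))" using fin by (intro member_le_sum) auto
      then show ?thesis using pos unfolding \<phi> B_def by linarith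
    qed
  qed
  moreover have "B \<ge> 0" using pos by (simp add: B_def)
  ultimately show ?thesis by blast
qed

text \<open>Points \<open>u\<close> between \<open>s t\<close> and \<open>s r\<close> as \<open>r\<close> approaches \<open>t\<close> within \<open>T\<close>; a gap contained in such an
  interval is short, which is not the case for arbitrary \<open>u\<close> near \<open>s t\<close>.\<close>

definition renorm_near :: "real \<Rightarrow> real filter" where
  "renorm_near t = (INF \<delta>\<in>{0<..}. principal (\<Union>r\<in>T \<inter> ball t \<delta>. closed_segment (s r) (s t)))"

lemma eventually_renorm_near:
  "eventually P (renorm_near t) \<longleftrightarrow> (\<exists>\<delta>>0. \<forall>r\<in>T. \<bar>r - t\<bar> < \<delta> \<longrightarrow> (\<forall>u\<in>closed_segment (s r) (s t). P u))"
proof -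
  have "eventually P (renorm_near t) \<longleftrightarrow> (\<exists>\<delta>\<in>{0<..}. eventually P (principal (\<Union>r\<in>T \<inter> ball t \<delta>. closed_segment (s r) (s t))))"
    unfolding renorm_near_def
  proof (rule eventually_INF_base)
    fix a b :: real assume "a \<in> {0<..}" "b \<in> {0<..}"
    then show "\<exists>x\<in>{0<..}. principal (\<Union>r\<in>T \<inter> ball t x. closed_segment (s r) (s t))
        \<le> inf (principal (\<Union>r\<in>T \<inter> ball t a. closed_segment (s r) (s t))) (principal (\<Union>r\<in>T \<inter> ball t b. closed_segment (s r) (s t)))"
      by (intro bexI[of _ "min a b"]) auto
  qed auto
  moreover have "eventually P (principal (\<Union>r\<in>T \<inter> ball t \<delta>. closed_segment (s r) (s t))) \<longleftrightarrow>
      (\<forall>r\<in>T. \<bar>r - t\<bar> < \<delta> \<longrightarrow> (\<forall>u\<in>closed_segment (s r) (s t). P u))" for \<delta>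
    unfolding eventually_principal by (auto simp: dist_real_def abs_minus_commute)
  ultimately show ?thesis by (simp only: Bex_def greaterThan_iff)
qed

lemma renorm_near_tendsto_id: "((\<lambda>u. u) \<longlongrightarrow> s t) (renorm_near t)"
proof (rule tendstoI)
  fix e :: real assume "e > 0"
  then obtain \<delta> where \<delta>: "\<delta> > 0" "\<And>r. dist r t < \<delta> \<Longrightarrow> dist (s r) (s t) < e"
    using continuous_s unfolding continuous_on_iff by (metis UNIV_I)
  show "\<forall>\<^sub>F u in renorm_near t. dist u (s t) < e"
    unfolding eventually_renorm_near
  proof (intro exI[of _ \<delta>] conjI ballI impI \<delta>(1))
    fix r u assume "r \<in> T" "\<bar>r - t\<bar> < \<delta>" "u \<in> closed_segment (s r) (s t)"
    then have "dist u (s t) \<le> dist (s r) (s t)" "dist (s r) (s t) < e"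
      using dist_in_closed_segment[of u "s r" "s t"] \<delta>(2)[of r] by (auto simp: dist_real_def dist_commute)
    then show "dist u (s t) < e" by simp
  qed
qed

lemma renorm_near_tendsto:
  fixes \<phi> :: "real \<Rightarrow> 'c::real_normed_vector"
  assumes on: "\<And>t. t \<in> T \<Longrightarrow> \<phi> (s t) = \<alpha> t" and off: "\<And>t. t \<notin> T \<Longrightarrow> \<phi> (s t) = \<beta> (prev t)"
    and rd: "rd_continuous T \<alpha>"
    and \<beta>: "\<delta>0 > 0" "\<And>\<tau>. \<tau> \<in> T \<Longrightarrow> 0 < mu T \<tau> \<Longrightarrow> mu T \<tau> < \<delta>0 \<Longrightarrow> norm (\<beta> \<tau> - \<alpha> \<tau>) \<le> C * mu T \<tau>"
    and t: "t \<in> T" "mu T t = 0"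
  shows "(\<phi> \<longlongrightarrow> \<alpha> t) (renorm_near t)"
proof (rule tendstoI)
  fix e :: real assume e: "e > 0"
  have "continuous (at t within T) \<alpha>" using rd t by (simp add: rd_continuous_def right_dense_def)
  then obtain \<delta>1 where \<delta>1: "\<delta>1 > 0" "\<And>v. v \<in> T \<Longrightarrow> dist v t < \<delta>1 \<Longrightarrow> dist (\<alpha> v) (\<alpha> t) < e / 2"
    using e unfolding continuous_within_eps_delta by (metis half_gt_zero)
  define \<delta> where "\<delta> = min \<delta>1 (min \<delta>0 (e / 2 / (\<bar>C\<bar> + 1)))"
  have "\<delta> > 0" using \<delta>1 \<beta>(1) e by (simp add: \<delta>_def)
  show "\<forall>\<^sub>F u in renorm_near t. dist (\<phi> u) (\<alpha> t) < e"
    unfolding eventually_renorm_near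
  proof (intro exI[of _ \<delta>] conjI ballI impI \<open>\<delta> > 0\<close>)
    fix r u assume r: "r \<in> T" "\<bar>r - t\<bar> < \<delta>" and u: "u \<in> closed_segment (s r) (s t)"
    define v where "v = \<kappa> u"
    have us: "u = s v" by (simp add: v_def)
    have v: "min r t \<le> v" "v \<le> max r t"
      using u unfolding us by (auto simp: closed_segment_eq_real_ivl split: if_splits)
    show "dist (\<phi> u) (\<alpha> t) < e"
    proof (cases "v \<in> T")
      case True
      have "dist v t < \<delta>1" using v r by (auto simp: dist_real_def \<delta>_def min_def max_def split: if_splits)
      then show ?thesis using \<delta>1(2)[OF True] on[OF True] e us by simp
    next
      case False
      let ?\<tau> = "prev v"
      note g = gap_bounds[OF False]
      \<comment> \<open>\<open>r\<close> and \<open>t\<close> belong to \<open>T\<close>, so a gap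
        that meets the interval between them is contained in it and is shorter than
        \<open>\<delta>\<close>.\<close>
      have "min r t \<le> ?\<tau>" using v r t by (intro prev_ge) (auto simp: min_def)
      moreover have "sigma T ?\<tau> \<le> max r t"
        using v r t no_gap_points[of "max r t" ?\<tau>] g by (auto simp: max_def split: if_splits)
      ultimately have b: "\<bar>?\<tau> - t\<bar> < \<delta>" "mu T ?\<tau> < \<delta>"
        using r g by (auto simp: mu_def min_def max_def split: if_splits)
      have "dist (\<alpha> ?\<tau>) (\<alpha> t) < e / 2" using b by (intro \<delta>1 prev_in_T) (auto simp: dist_real_def \<delta>_def)
      moreover have "norm (\<beta> ?\<tau> - \<alpha> ?\<tau>) < e / 2"
      proof -
        have "norm (\<beta> ?\<tau> - \<alpha> ?\<tau>) \<le> C * mu T ?\<tau>" using b by (intro \<beta>(2) prev_in_T g(3)) (auto simp: \<delta>_def)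
        also have "\<dots> \<le> (\<bar>C\<bar> + 1) * mu T ?\<tau>" using g(3) by (intro mult_right_mono) auto
        also have "\<dots> < (\<bar>C\<bar> + 1) * (e / 2 / (\<bar>C\<bar> + 1))"
          using b by (intro mult_strict_left_mono) (auto simp: \<delta>_def)
        also have "\<dots> = e / 2"
        proof -
          have "x * (e / 2 / x) = e / 2" if "x \<noteq> 0" for x using that by simp
          from this[of "\<bar>C\<bar> + 1"] show ?thesis by linarith
        qed
        finally show ?thesis .
      qed
      ultimately have "dist (\<beta> ?\<tau>) (\<alpha> t) < e"
        using dist_triangle[of "\<beta> ?\<tau>" "\<alpha> t" "\<alpha> ?\<tau>"] by (simp add: dist_norm)
      then show ?thesis using off[OF False] us by simp
    qed
  qed
qed

end

subsection \<open>The renormalized equation\<close>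

lemma norm_matrix_le_sum: "norm (M :: complex^'n^'m) \<le> (\<Sum>i\<in>UNIV. \<Sum>j\<in>UNIV. norm (M $ i $ j))"
proof -
  have "norm M \<le> (\<Sum>i\<in>UNIV. norm (M $ i))" unfolding norm_vec_def by (rule L2_set_le_sum) simp
  also have "\<dots> \<le> (\<Sum>i\<in>UNIV. \<Sum>j\<in>UNIV. norm (M $ i $ j))"
    by (rule sum_mono) (unfold norm_vec_def[of "M $ _"], rule L2_set_le_sum, simp)
  finally show ?thesis .
qed

lemma cmat_nth [simp]: "cmat M $ i $ j = of_real (M $ i $ j)"
  by (simp add: cmat_def map_matrix_def)

lemma cvec_nth [simp]: "cvec x $ i = of_real (x $ i)"
  by (simp add: cvec_def)

lemma cmat_mult: "cmat (M ** N) = cmat M ** cmat N"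
  by (simp add: vec_eq_iff matrix_matrix_mult_def)

lemma cmat_mat1 [simp]: "cmat (mat 1) = mat 1"
  by (simp add: vec_eq_iff mat_def)

lemma cmat_mult_vec: "cvec (M *v x) = cmat M *v cvec x"
  by (simp add: vec_eq_iff matrix_vector_mult_def)

lemma cvec_add: "cvec (x + y) = cvec x + cvec y"
  by (simp add: vec_eq_iff)

lemma cmat_inj: "cmat M = cmat N \<Longrightarrow> M = N"
  by (simp add: vec_eq_iff)

lemma bounded_linear_cmat: "bounded_linear cmat"
  unfolding linear_conv_bounded_linear[symmetric]
  by (rule linearI) (simp_all add: vec_eq_iff scaleR_conv_of_real[where 'a=complex])

lemma bounded_linear_cvec: "bounded_linear cvec"
  unfolding linear_conv_bounded_linear[symmetric]
  by (rule linearI) (simp_all add: vec_eq_iff scaleR_conv_of_real[where 'a=complex])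

lemma invertible_cmat:
  assumes "invertible (mat 1 + m *\<^sub>R M)"
  shows "invertible (mat 1 + m *\<^sub>R cmat M)"
proof -
  interpret bounded_linear cmat by (rule bounded_linear_cmat)
  have e: "mat 1 + m *\<^sub>R cmat M = cmat (mat 1 + m *\<^sub>R M)" by (simp add: add scaleR)
  obtain N where "(mat 1 + m *\<^sub>R M) ** N = mat 1" "N ** (mat 1 + m *\<^sub>R M) = mat 1"
    using assms by (auto simp: invertible_def)
  then have "cmat (mat 1 + m *\<^sub>R M) ** cmat N = mat 1" "cmat N ** cmat (mat 1 + m *\<^sub>R M) = mat 1"
    by (simp_all add: cmat_mult[symmetric])
  then show ?thesis unfolding e invertible_def by blast
qed

lemma rd_continuous_bounded_linear:
  assumes "bounded_linear h" "rd_continuous T x"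
  shows "rd_continuous T (\<lambda>t. h (x t))"
  unfolding rd_continuous_def
proof (intro conjI ballI impI)
  fix t assume "t \<in> T" "right_dense T t"
  then show "continuous (at t within T) (\<lambda>t. h (x t))"
    using assms by (auto simp: rd_continuous_def intro: bounded_linear.continuous)
next
  fix t assume "t \<in> T" "left_dense T t"
  then obtain l where "(x \<longlongrightarrow> l) (at t within T \<inter> {..<t})" using assms(2) by (auto simp: rd_continuous_def)
  then have "((\<lambda>t. h (x t)) \<longlongrightarrow> h l) (at t within T \<inter> {..<t})" by (rule bounded_linear.tendsto[OF assms(1)])
  then show "\<exists>l. ((\<lambda>t. h (x t)) \<longlongrightarrow> l) (at t within T \<inter> {..<t})" by blast
qed

lemma bounded_bilinear_matrix_mult: "bounded_bilinear ((**) :: complex^'n^'n \<Rightarrow> complex^'n^'n \<Rightarrow> complex^'n^'n)"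
  unfolding bilinear_conv_bounded_bilinear[symmetric] bilinear_def
  by (auto intro!: linearI simp: matrix_add_ldistrib matrix_add_rdistrib scaleR_matrix_mult_left scaleR_matrix_mult_right)

lemma bounded_bilinear_matrix_vector_mult: "bounded_bilinear ((*v) :: complex^'n^'n \<Rightarrow> complex^'n \<Rightarrow> complex^'n)"
  unfolding bilinear_conv_bounded_bilinear[symmetric] bilinear_def
  by (auto intro!: linearI simp: vec_eq_iff matrix_vector_mult_def sum.distrib distrib_left distrib_right scaleR_sum_right)

text \<open>With \<open>A\<close> and with \<open>f\<close> in the role of \<open>x\<close>, this
  turns closeness of \<open>N\<close> to the identity into closeness of both coefficients to their
  values on \<open>T\<close>.\<close>

lemma bounded_bilinear_gap:
  assumes "bounded_bilinear op" "bounded (x ` T)" "\<delta> > 0" "C \<ge> 0"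
    and "\<And>\<tau>. \<tau> \<in> T \<Longrightarrow> 0 < mu T \<tau> \<Longrightarrow> mu T \<tau> < \<delta> \<Longrightarrow> norm (N \<tau> - e) \<le> C * mu T \<tau>"
  shows "\<exists>C'. \<forall>\<tau>. \<tau> \<in> T \<longrightarrow> 0 < mu T \<tau> \<longrightarrow> mu T \<tau> < \<delta> \<longrightarrow> norm (op (N \<tau>) (x \<tau>) - op e (x \<tau>)) \<le> C' * mu T \<tau>"
proof -
  interpret bounded_bilinear op by fact
  obtain K where K: "K > 0" "\<And>t. t \<in> T \<Longrightarrow> norm (x t) \<le> K" using assms(2) unfolding bounded_pos by auto
  obtain L where L: "L > 0" "\<And>P y. norm (op P y) \<le> norm P * norm y * L" using pos_bounded by blast
  have "norm (op (N \<tau>) (x \<tau>) - op e (x \<tau>)) \<le> (C * K * L) * mu T \<tau>"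
    if \<tau>: "\<tau> \<in> T" "0 < mu T \<tau>" "mu T \<tau> < \<delta>" for \<tau>
  proof -
    have "norm (op (N \<tau>) (x \<tau>) - op e (x \<tau>)) = norm (op (N \<tau> - e) (x \<tau>))" by (simp add: diff_left)
    also have "\<dots> \<le> norm (N \<tau> - e) * norm (x \<tau>) * L" by (rule L(2))
    also have "\<dots> \<le> (C * mu T \<tau>) * K * L"
      using assms(5)[OF \<tau>] K(2)[OF \<tau>(1)] K(1) L(1) assms(4) \<tau>(2) by (intro mult_right_mono mult_mono) auto
    finally show ?thesis by (simp add: mult_ac)
  qed
  then show ?thesis by blast
qed

text \<open>The two instances are left multiplication of vectors, for the inhomogeneous equation,
  and of matrices, for the fundamental matrices.\<close>

locale matrix_action = bounded_bilinear act
  for act :: "complex^'n^'n \<Rightarrow> 'a::euclidean_space \<Rightarrow> 'a" +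
  assumes act_one: "act (mat 1) x = x" and act_mult: "act (P ** Q) x = act P (act Q x)"

locale renorm_ode = time_scale_set T + matrix_action act
  for T :: "real set" and act :: "complex^'n^'n \<Rightarrow> 'a::euclidean_space \<Rightarrow> 'a" +
  fixes A :: "real \<Rightarrow> real^'n^'n" and f :: "real \<Rightarrow> 'a" and d :: side
    and B :: "real \<Rightarrow> complex^'n^'n" and c :: "real \<Rightarrow> 'a"
  assumes A_bounded: "bounded (A ` T)" and A_rd: "rd_continuous T A" and A_regressive: "regressive T A"
    and f_bounded: "bounded (f ` T)" and f_rd: "rd_continuous T f"
    and B_on: "\<And>t. t \<in> T \<Longrightarrow> B (s t) = cmat (A t)" and c_on: "\<And>t. t \<in> T \<Longrightarrow> c (s t) = f t"
    and B_off: "\<And>t. t \<notin> T \<Longrightarrow>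
      B (s t) = matrix_Ln d (mu T (prev t)) (cmat (A (prev t))) /\<^sub>R ln (1 + mu T (prev t))"
    and c_off: "\<And>t. t \<notin> T \<Longrightarrow>
      c (s t) = act (inverse_matrix_Ln d (mu T (prev t)) (cmat (A (prev t))) /\<^sub>R ln (1 + mu T (prev t))) (f (prev t))"
begin

text \<open>On the gap after \<open>\<tau>\<close> this one factor produces both coefficients from
  the values at \<open>\<tau>\<close>: \<open>B\<close> is \<open>N\<close> times \<open>A\<close>,
  and \<open>c\<close> is \<open>N\<close> acting on \<open>f\<close>.\<close>

definition N :: "real \<Rightarrow> complex^'n^'n" where
  "N \<tau> = inverse_matrix_Ln d (mu T \<tau>) (cmat (A \<tau>)) /\<^sub>R ln (1 + mu T \<tau>)"

definition F :: "real \<Rightarrow> 'a \<Rightarrow> 'a" where "F u x = act (B u) x + c u"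

definition H :: "real \<Rightarrow> 'a \<Rightarrow> 'a" where "H t x = act (cmat (A t)) x + f t"

lemma inv: "t \<in> T \<Longrightarrow> invertible (mat 1 + mu T t *\<^sub>R cmat (A t))"
  using A_regressive by (intro invertible_cmat) (auto simp: regressive_def)

lemma matrix_Ln_factor:
  assumes "t \<in> T" "mu T t > 0"
  shows "matrix_Ln d (mu T t) (cmat (A t)) /\<^sub>R ln (1 + mu T t) = N t ** cmat (A t)"
  using gap_flow[OF assms(2) inv[OF assms(1)], of d]
  by (metis N_def scaleR_matrix_mult_left)

lemma B_off': "t \<notin> T \<Longrightarrow> B (s t) = N (prev t) ** cmat (A (prev t))"
  using B_off matrix_Ln_factor[OF prev_in_T gap_bounds(3)] by simp

lemma c_off': "t \<notin> T \<Longrightarrow> c (s t) = act (N (prev t)) (f (prev t))"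
  using c_off by (simp add: N_def)

text \<open>The numerator is \<open>m E + O(m^2)\<close> and the denominator
  \<open>ln (1 + m)\<close> is \<open>m + O(m^2)\<close>, with constants that depend only on the
  dimension and the bound of \<open>A\<close>.\<close>

lemma N_near_one:
  obtains \<delta> C where "\<delta> > 0" "C \<ge> 0"
    "\<And>\<tau>. \<tau> \<in> T \<Longrightarrow> 0 < mu T \<tau> \<Longrightarrow> mu T \<tau> < \<delta> \<Longrightarrow> norm (N \<tau> - mat 1) \<le> C * mu T \<tau>"
proof -
  obtain K where K: "K > 0" "\<And>t. t \<in> T \<Longrightarrow> norm (A t) \<le> K"
    using A_bounded unfolding bounded_pos by auto
  define n where "n = real CARD('n)"
  define R where "R = n * K"
  have n: "n > 0" by (simp add: n_def)
  have R: "R > 0" using K(1) n by (simp add: R_def)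
  \<comment> \<open>Each of the \<open>n^2\<close> entries errs by at most \<open>2 R m^2\<close>;
    dividing by \<open>ln (1 + m) \<ge> m / 2\<close> gives \<open>4 n^2 R m\<close>. The norm of
    the identity comes with \<open>m / ln (1 + m) - 1 \<le> m\<close>.\<close>
  define C where "C = 4 * n * n * R + norm (mat 1 :: complex^'n^'n)"
  show ?thesis
  proof (rule that[of "min 1 (1 / (2 * R))" C])
    show "0 < min 1 (1 / (2 * R))" using R by simp
    show "C \<ge> 0" using R n by (simp add: C_def)
    fix \<tau> assume \<tau>: "\<tau> \<in> T" "0 < mu T \<tau>" "mu T \<tau> < min 1 (1 / (2 * R))"
    define m where "m = mu T \<tau>"
    define l where "l = ln (1 + m)"
    define M where "M = inverse_matrix_Ln d m (cmat (A \<tau>))"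
    have m: "0 < m" "m < 1" "m * R \<le> 1 / 2" using \<tau> R by (auto simp: m_def field_simps)
    have l: "l > 0" using m by (simp add: l_def)
    have lm: "m / (1 + m) \<le> l" using ln_mu_lower[of \<tau>] by (simp add: l_def m_def)
    have "norm (A \<tau> $ i $ j) \<le> K" for i j
      using order_trans[OF component_le_norm_cart order_trans[OF Finite_Cartesian_Product.norm_nth_le K(2)[OF \<tau>(1)]], of "i" j] by simp
    then have entry: "norm (cmat (A \<tau>) $ i $ j) \<le> K" for i j by simp
    have "norm (M - mat (of_real m)) \<le> (\<Sum>i\<in>(UNIV::'n set). \<Sum>j\<in>(UNIV::'n set). 2 * R * m\<^sup>2)"
      unfolding M_def R_def n_def using inverse_matrix_Ln_small[OF entry K(1) m(1) m(3)[unfolded R_def n_def], of d] inv[OF \<tau>(1)]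
      by (intro order_trans[OF norm_matrix_le_sum] sum_mono) (simp add: m_def)
    then have M: "norm (M - mat (of_real m)) \<le> n * n * (2 * R * m\<^sup>2)" by (simp add: n_def)
    have mat: "mat (of_real m) = m *\<^sub>R (mat 1 :: complex^'n^'n)"
      by (simp add: vec_eq_iff mat_def scaleR_conv_of_real[where 'a=complex])
    have "N \<tau> - mat 1 = (1 / l) *\<^sub>R (M - mat (of_real m)) + (m / l - 1) *\<^sub>R mat 1"
      using l by (simp add: N_def M_def[symmetric] m_def[symmetric] l_def[symmetric] mat algebra_simps divide_inverse)
    then have "norm (N \<tau> - mat 1) \<le> norm ((1 / l) *\<^sub>R (M - mat (of_real m))) + norm ((m / l - 1) *\<^sub>R (mat 1 :: complex^'n^'n))"
      using norm_triangle_ineq by metis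
    also have "norm ((1 / l) *\<^sub>R (M - mat (of_real m))) \<le> (2 / m) * (n * n * (2 * R * m\<^sup>2))"
    proof -
      have "m \<le> l * (1 + m)" using lm m by (simp add: field_simps)
      also have "\<dots> \<le> l * 2" using l m by (intro mult_left_mono) auto
      finally have "1 / l \<le> 2 / m" using l m by (simp add: field_simps)
      then have "(1 / l) * norm (M - mat (of_real m)) \<le> (2 / m) * (n * n * (2 * R * m\<^sup>2))"
        using M m by (intro mult_mono) auto
      then show ?thesis using l by simp
    qed
    also have "(2 / m) * (n * n * (2 * R * m\<^sup>2)) = 4 * n * n * R * m" using m by (simp add: power2_eq_square)
    also have "norm ((m / l - 1) *\<^sub>R (mat 1 :: complex^'n^'n)) \<le> m * norm (mat 1 :: complex^'n^'n)"
    proof -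
      have "l \<le> m" using m by (simp add: l_def ln_add_one_self_le_self)
      then have "0 \<le> m / l - 1" using l by (simp add: field_simps)
      moreover have "m / l - 1 \<le> m" using lm l m by (simp add: field_simps)
      ultimately show ?thesis by (simp add: mult_right_mono)
    qed
    finally show "norm (N \<tau> - mat 1) \<le> C * mu T \<tau>" by (simp add: C_def m_def algebra_simps)
  qed
qed

lemma cmatA_bounded: "bounded ((\<lambda>t. cmat (A t)) ` T)"
  using bounded_linear_image[OF A_bounded bounded_linear_cmat] by (simp add: image_image)

lemma gap_estimates:
  obtains \<delta> C C' where "\<delta> > 0"
    "\<And>\<tau>. \<tau> \<in> T \<Longrightarrow> 0 < mu T \<tau> \<Longrightarrow> mu T \<tau> < \<delta> \<Longrightarrow> norm (N \<tau> ** cmat (A \<tau>) - cmat (A \<tau>)) \<le> C * mu T \<tau>"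
    "\<And>\<tau>. \<tau> \<in> T \<Longrightarrow> 0 < mu T \<tau> \<Longrightarrow> mu T \<tau> < \<delta> \<Longrightarrow> norm (act (N \<tau>) (f \<tau>) - f \<tau>) \<le> C' * mu T \<tau>"
proof -
  obtain \<delta> C where N: "\<delta> > 0" "C \<ge> 0"
    "\<And>\<tau>. \<tau> \<in> T \<Longrightarrow> 0 < mu T \<tau> \<Longrightarrow> mu T \<tau> < \<delta> \<Longrightarrow> norm (N \<tau> - mat 1) \<le> C * mu T \<tau>"
    using N_near_one by blast
  have "\<exists>C'. \<forall>\<tau>. \<tau> \<in> T \<longrightarrow> 0 < mu T \<tau> \<longrightarrow> mu T \<tau> < \<delta> \<longrightarrow> norm (N \<tau> ** cmat (A \<tau>) - mat 1 ** cmat (A \<tau>)) \<le> C' * mu T \<tau>"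
    by (rule bounded_bilinear_gap[OF bounded_bilinear_matrix_mult cmatA_bounded N])
  moreover have "\<exists>C'. \<forall>\<tau>. \<tau> \<in> T \<longrightarrow> 0 < mu T \<tau> \<longrightarrow> mu T \<tau> < \<delta> \<longrightarrow> norm (act (N \<tau>) (f \<tau>) - act (mat 1) (f \<tau>)) \<le> C' * mu T \<tau>"
    by (rule bounded_bilinear_gap[OF bounded_bilinear_axioms f_bounded N])
  ultimately show ?thesis using that[OF N(1)] by (auto simp: act_one)
qed

lemma cmatA_rd: "rd_continuous T (\<lambda>t. cmat (A t))"
  by (rule rd_continuous_bounded_linear[OF bounded_linear_cmat A_rd])

lemma B_measurable: "B \<in> borel_measurable borel" and c_measurable: "c \<in> borel_measurable borel"
  by (rule renorm_measurable[OF cmatA_rd B_on B_off'], assumption+)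
     (rule renorm_measurable[OF f_rd c_on c_off'], assumption+)

lemma B_bounded: "\<exists>K\<ge>0. \<forall>u\<in>{a..b}. norm (B u) \<le> K" and c_bounded: "\<exists>K\<ge>0. \<forall>u\<in>{a..b}. norm (c u) \<le> K"
proof -
  obtain \<delta> C C' where g: "\<delta> > 0"
    "\<And>\<tau>. \<tau> \<in> T \<Longrightarrow> 0 < mu T \<tau> \<Longrightarrow> mu T \<tau> < \<delta> \<Longrightarrow> norm (N \<tau> ** cmat (A \<tau>) - cmat (A \<tau>)) \<le> C * mu T \<tau>"
    "\<And>\<tau>. \<tau> \<in> T \<Longrightarrow> 0 < mu T \<tau> \<Longrightarrow> mu T \<tau> < \<delta> \<Longrightarrow> norm (act (N \<tau>) (f \<tau>) - f \<tau>) \<le> C' * mu T \<tau>"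
    using gap_estimates by metis
  obtain K where K: "\<And>t. t \<in> T \<Longrightarrow> norm (cmat (A t)) \<le> K" using cmatA_bounded unfolding bounded_iff by auto
  show "\<exists>K\<ge>0. \<forall>u\<in>{a..b}. norm (B u) \<le> K" by (rule renorm_bounded[OF B_on B_off' K g(1,2)])
  obtain K' where K': "\<And>t. t \<in> T \<Longrightarrow> norm (f t) \<le> K'" using f_bounded unfolding bounded_iff by auto
  show "\<exists>K\<ge>0. \<forall>u\<in>{a..b}. norm (c u) \<le> K" by (rule renorm_bounded[OF c_on c_off' K' g(1,3)])
qed

lemma caratheodory_F: "caratheodory F"
proof (rule caratheodory.intro)
  fix x :: "real \<Rightarrow> 'a" assume "continuous_on UNIV x"
  then have "x \<in> borel_measurable borel" by (rule borel_measurable_continuous_onI)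
  moreover have "continuous_on UNIV (\<lambda>p. act (fst p) (snd p))"
    by (rule bounded_bilinear.continuous_on[OF bounded_bilinear_axioms]) (auto intro: continuous_intros)
  ultimately have "(\<lambda>u. act (B u) (x u)) \<in> borel_measurable borel"
    by (rule borel_measurable_continuous_Pair[OF B_measurable])
  then show "(\<lambda>u. F u (x u)) \<in> borel_measurable borel" unfolding F_def using c_measurable by simp
next
  fix a b
  obtain K where K: "K \<ge> 0" "\<forall>u\<in>{a..b}. norm (B u) \<le> K" using B_bounded by blast
  obtain L where L: "L > 0" "\<And>P y. norm (act P y) \<le> norm P * norm y * L" using pos_bounded by blast
  have "norm (F u x - F u y) \<le> K * L * norm (x - y)" if u: "u \<in> {a..b}" for u x y
  proof -
    have "F u x - F u y = act (B u) (x - y)" by (simp add: F_def diff_right)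
    then have "norm (F u x - F u y) \<le> norm (B u) * norm (x - y) * L" by (simp only: L(2))
    also have "\<dots> \<le> K * norm (x - y) * L" using K u L(1) by (intro mult_right_mono) auto
    finally show ?thesis by (simp add: mult_ac)
  qed
  then show "\<exists>K\<ge>0. \<forall>u\<in>{a..b}. \<forall>x y. norm (F u x - F u y) \<le> K * norm (x - y)"
    using K(1) L(1) by (intro exI[of _ "K * L"]) auto
  show "\<exists>C\<ge>0. \<forall>u\<in>{a..b}. norm (F u 0) \<le> C" using c_bounded by (simp add: F_def zero_right)
qed

interpretation ode: caratheodory F by (rule caratheodory_F)

text \<open>The comparison function \<open>y\<close> runs \<open>gap_flow\<close> in the time of
  \<open>s\<close>. It solves the equation with the constant coefficients of the gap, hence
  coincides with \<open>\<Psi>\<close> at the right end, where \<open>G 1\<close> is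
  \<open>\<mu> E\<close>.\<close>

lemma solution_across_gap:
  assumes sol: "ode_solution F \<Psi>" and t: "t \<in> T" "mu T t > 0"
  shows "\<Psi> (s (sigma T t)) = \<Psi> (s t) + mu T t *\<^sub>R H t (\<Psi> (s t))"
proof -
  define l where "l = ln (1 + mu T t)"
  define p where "p = s t"
  have l: "l > 0" using t by (simp add: l_def)
  have q: "s (sigma T t) = p + l" using renorm_gap[OF t] by (simp add: p_def l_def)
  obtain G where G: "G 0 = 0" "G 1 = mat (of_real (mu T t))"
    "\<And>v. (G has_vector_derivative (matrix_Ln d (mu T t) (cmat (A t)) ** G v + inverse_matrix_Ln d (mu T t) (cmat (A t)))) (at v)"
    using gap_flow[OF t(2) inv[OF t(1)], of d] by metis
  define B0 where "B0 = N t ** cmat (A t)"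
  define c0 where "c0 = act (N t) (f t)"
  define z where "z = H t (\<Psi> p)"
  \<comment> \<open>With \<open>z = A \<Psi>(p) + f\<close> and \<open>B0 = N A\<close>, the flow
    \<open>G\<close> gives \<open>y' = B0 y + c0\<close>: the term \<open>N z\<close> supplies both
    \<open>B0 \<Psi>(p)\<close> and \<open>c0\<close>.\<close>
  define y where "y u = \<Psi> p + act (G ((u - p) / l)) z" for u
  have L: "matrix_Ln d (mu T t) (cmat (A t)) = l *\<^sub>R B0"
  proof -
    have "matrix_Ln d (mu T t) (cmat (A t)) = l *\<^sub>R (matrix_Ln d (mu T t) (cmat (A t)) /\<^sub>R l)" using l by simp
    then show ?thesis using matrix_Ln_factor[OF t] by (simp only: B0_def l_def[symmetric])
  qed
  have M: "inverse_matrix_Ln d (mu T t) (cmat (A t)) = l *\<^sub>R N t"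
    using l by (simp add: N_def l_def[symmetric])
  have y': "(y has_vector_derivative (act B0 (y u) + c0)) (at u)" for u
  proof -
    have "((\<lambda>u. G ((u - p) / l)) has_vector_derivative (1 / l) *\<^sub>R (l *\<^sub>R B0 ** G ((u - p) / l) + l *\<^sub>R N t)) (at u)"
    proof -
      have "((\<lambda>u. (u - p) / l) has_vector_derivative 1 / l) (at u)"
        unfolding has_real_derivative_iff_has_vector_derivative[symmetric] using l by (auto intro!: derivative_eq_intros)
      from vector_diff_chain_at[OF this G(3)[unfolded L M]] show ?thesis by (simp add: o_def)
    qed
    moreover have "(1 / l) *\<^sub>R (l *\<^sub>R B0 ** G ((u - p) / l) + l *\<^sub>R N t) = B0 ** G ((u - p) / l) + N t"
      using l by (simp add: scaleR_matrix_mult_left scaleR_add_right)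
    ultimately have "((\<lambda>u. G ((u - p) / l)) has_vector_derivative (B0 ** G ((u - p) / l) + N t)) (at u)" by simp
    then have "((\<lambda>u. act (G ((u - p) / l)) z) has_vector_derivative act (B0 ** G ((u - p) / l) + N t) z) (at u)"
      by (rule bounded_linear.has_vector_derivative[OF bounded_linear_left])
    then have "(y has_vector_derivative act (B0 ** G ((u - p) / l) + N t) z) (at u)"
      unfolding y_def by (auto intro!: derivative_eq_intros)
    moreover have "act (B0 ** G ((u - p) / l) + N t) z = act B0 (y u) + c0"
      by (simp add: y_def add_left add_right act_mult z_def H_def c0_def B0_def)
    ultimately show ?thesis by simp
  qed
  have field: "F u x = act B0 x + c0" if "p < u" "u < p + l" for u x
  proof -
    have k: "t < \<kappa> u" "\<kappa> u < sigma T t" using that q s_less[of t "\<kappa> u"] s_less[of "\<kappa> u" "sigma T t"] by (simp_all add: p_def)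
    then have "\<kappa> u \<notin> T" using no_gap_points[of "\<kappa> u" t] by auto
    moreover have "prev (\<kappa> u) = t" using k by (intro prev_eqI t(1)) auto
    ultimately show ?thesis using B_off'[of "\<kappa> u"] c_off'[of "\<kappa> u"] by (simp add: F_def B0_def c0_def)
  qed
  obtain K where K: "K > 0" "\<And>x. norm (act B0 x) \<le> norm B0 * norm x * K" using pos_bounded by blast
  have y_cont: "continuous_on UNIV y"
    using y' by (meson continuous_at_imp_continuous_on has_vector_derivative_continuous)
  have cont: "continuous_on UNIV (\<lambda>u. \<Psi> u - y u)"
    by (intro continuous_intros ode.solution_continuous[OF sol] y_cont)
  have "\<Psi> (p + l) - y (p + l) = 0"
  proof (rule zero_propagation_forward[of "{p..p+l}" p "p + l" "norm B0 * K" "\<lambda>u. \<Psi> u - y u"])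
    show "continuous_on {p..p + l} (\<lambda>u. \<Psi> u - y u)" by (rule continuous_on_subset[OF cont]) simp
    show "\<Psi> p - y p = 0" by (simp add: y_def G(1) zero_left)
  next
    fix a b M assume ab: "p \<le> a" "a \<le> b" "b \<le> p + l"
      and M: "\<And>u. u \<in> {p..p + l} \<Longrightarrow> a \<le> u \<Longrightarrow> u \<le> b \<Longrightarrow> norm (\<Psi> u - y u) \<le> M"
    have "((\<lambda>u. F u (\<Psi> u)) has_integral (\<Psi> b - \<Psi> a)) {a..b}"
      using sol ab(2) ode.field_integrable(2)[OF ode.solution_continuous[OF sol], of a b]
      by (simp add: ode_solution_def has_integral_integrable_integral)
    \<comment> \<open>The two ends of the gap come from points of \<open>T\<close>, where the
      coefficients may take other values; they form a null set.\<close>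
    then have "((\<lambda>u. act B0 (\<Psi> u) + c0) has_integral (\<Psi> b - \<Psi> a)) {a..b}"
      by (rule has_integral_spike[of "{p, p + l}", rotated 2]) (use field ab in auto)
    moreover have "((\<lambda>u. act B0 (y u) + c0) has_integral (y b - y a)) {a..b}"
      using ab(2) y' by (intro fundamental_theorem_of_calculus) (auto intro: has_vector_derivative_at_within)
    ultimately have "((\<lambda>u. (act B0 (\<Psi> u) + c0) - (act B0 (y u) + c0)) has_integral ((\<Psi> b - \<Psi> a) - (y b - y a))) {a..b}"
      by (rule has_integral_diff)
    then have I: "((\<lambda>u. act B0 (\<Psi> u - y u)) has_integral ((\<Psi> b - \<Psi> a) - (y b - y a))) {a..b}"
      by (simp add: diff_right)
    have "norm ((\<Psi> b - \<Psi> a) - (y b - y a)) \<le> norm B0 * K * M * (b - a)"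
    proof -
      have "norm (integral {a..b} (\<lambda>u. act B0 (\<Psi> u - y u))) \<le> integral {a..b} (\<lambda>_. norm B0 * K * M)"
      proof (rule integral_norm_bound_integral)
        fix u assume u: "u \<in> {a..b}"
        have "norm (act B0 (\<Psi> u - y u)) \<le> norm B0 * norm (\<Psi> u - y u) * K" by (rule K(2))
        also have "\<dots> \<le> norm B0 * M * K" using M[of u] u ab K(1) by (intro mult_right_mono mult_left_mono) auto
        finally show "norm (act B0 (\<Psi> u - y u)) \<le> norm B0 * K * M" by (simp add: mult_ac)
      qed (use I in \<open>auto simp: has_integral_integrable\<close>)
      then show ?thesis using ab(2) integral_unique[OF I] by (simp add: mult_ac)
    qed
    moreover have "(\<Psi> b - y b) - (\<Psi> a - y a) = (\<Psi> b - \<Psi> a) - (y b - y a)" by simp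
    ultimately show "norm ((\<Psi> b - y b) - (\<Psi> a - y a)) \<le> norm B0 * K * M * (b - a)" by (simp only:)
  next
    fix a b assume ab: "a \<in> {p..p + l}" "b \<in> {p..p + l}" "a < b" and none: "{p..p + l} \<inter> {a<..<b} = {}"
    from ab(3) obtain z where z: "a < z" "z < b" using dense by blast
    then have "z \<in> {p..p + l}" "z \<in> {a<..<b}" using ab by simp_all
    then have False using none by blast
    then show "\<Psi> b - y b = 0" ..
  qed (use l K(1) in auto)
  moreover have "y (p + l) = \<Psi> p + mu T t *\<^sub>R z"
  proof -
    have "mat (of_real (mu T t)) = mu T t *\<^sub>R (mat 1 :: complex^'n^'n)"
      by (simp add: vec_eq_iff mat_def scaleR_conv_of_real[where 'a=complex])
    then show ?thesis using l by (simp add: y_def G(2) scaleR_left act_one)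
  qed
  ultimately show ?thesis by (simp add: q z_def p_def[symmetric])
qed

text \<open>As functions on the line \<open>B\<close> and \<open>c\<close> may jump at
  \<open>s t\<close> for a right-dense \<open>t\<close>, namely when a gap ends there; along
  \<open>renorm_near t\<close> they converge to their values at \<open>s t\<close>.\<close>

lemma restrict_solution:
  assumes sol: "ode_solution F \<Psi>"
  shows "ts_solution T H (\<lambda>t. \<Psi> (s t))"
proof (rule ode_restrict_ts_solution[where F = F and H = H and \<Psi> = \<Psi>, OF sol ode.solution_continuous[OF sol] continuous_s])
  show "\<Psi> (s (sigma T t)) = \<Psi> (s t) + mu T t *\<^sub>R H t (\<Psi> (s t))" if "t \<in> T" "mu T t > 0" for t
    using that by (rule solution_across_gap[OF sol])
next
  fix t e :: real assume t: "t \<in> T" "mu T t = 0" and e: "e > 0"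
  obtain \<delta> C C' where g: "\<delta> > 0"
    "\<And>\<tau>. \<tau> \<in> T \<Longrightarrow> 0 < mu T \<tau> \<Longrightarrow> mu T \<tau> < \<delta> \<Longrightarrow> norm (N \<tau> ** cmat (A \<tau>) - cmat (A \<tau>)) \<le> C * mu T \<tau>"
    "\<And>\<tau>. \<tau> \<in> T \<Longrightarrow> 0 < mu T \<tau> \<Longrightarrow> mu T \<tau> < \<delta> \<Longrightarrow> norm (act (N \<tau>) (f \<tau>) - f \<tau>) \<le> C' * mu T \<tau>"
    using gap_estimates by metis
  have B: "(B \<longlongrightarrow> cmat (A t)) (renorm_near t)" by (rule renorm_near_tendsto[OF B_on B_off' cmatA_rd g(1,2) t])
  have c: "(c \<longlongrightarrow> f t) (renorm_near t)" by (rule renorm_near_tendsto[OF c_on c_off' f_rd g(1,3) t])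
  have "isCont \<Psi> (s t)" using ode.solution_continuous[OF sol] by (simp add: continuous_on_eq_continuous_at)
  then have \<Psi>: "(\<Psi> \<longlongrightarrow> \<Psi> (s t)) (renorm_near t)" by (rule isCont_tendsto_compose[OF _ renorm_near_tendsto_id])
  have "((\<lambda>u. F u (\<Psi> u)) \<longlongrightarrow> H t (\<Psi> (s t))) (renorm_near t)"
    unfolding F_def H_def by (intro tendsto_add tendsto B c \<Psi>)
  from tendstoD[OF this e] have "\<forall>\<^sub>F u in renorm_near t. norm (F u (\<Psi> u) - H t (\<Psi> (s t))) \<le> e"
    by eventually_elim (simp add: dist_norm)
  then show "\<exists>\<delta>>0. \<forall>r\<in>T. \<bar>r - t\<bar> < \<delta> \<longrightarrow> (\<forall>u\<in>closed_segment (s r) (s t). norm (F u (\<Psi> u) - H t (\<Psi> (s t))) \<le> e)"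
    unfolding eventually_renorm_near .
qed

lemma ts_solution_unique:
  assumes "ts_solution T H x" "ts_solution T H y" "\<tau> \<in> T" "x \<tau> = y \<tau>" "t \<in> T"
  shows "x t = y t"
proof -
  obtain K where K: "K > 0" "\<And>t. t \<in> T \<Longrightarrow> norm (cmat (A t)) \<le> K" using cmatA_bounded unfolding bounded_pos by auto
  obtain L where L: "L > 0" "\<And>P y. norm (act P y) \<le> norm P * norm y * L" using pos_bounded by blast
  have "x t - y t = 0"
  proof (rule ts_linear_unique[of "\<lambda>t. x t - y t" "\<lambda>t. act (cmat (A t))" "K * L" \<tau>])
    fix t assume t: "t \<in> T"
    have "has_delta_derivative T (\<lambda>t. x t - y t) (H t (x t) - H t (y t)) t"
      using assms(1,2) t by (intro has_delta_derivative_diff) (auto simp: ts_solution_def)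
    then show "has_delta_derivative T (\<lambda>t. x t - y t) (act (cmat (A t)) (x t - y t)) t"
      by (simp add: H_def diff_right)
  next
    fix t v assume t: "t \<in> T"
    have "norm (act (cmat (A t)) v) \<le> norm (cmat (A t)) * norm v * L" by (rule L(2))
    also have "\<dots> \<le> K * norm v * L" using K(2)[OF t] L(1) by (intro mult_right_mono) auto
    finally show "norm (act (cmat (A t)) v) \<le> K * L * norm v" by (simp add: mult_ac)
  next
    fix t v assume t: "t \<in> T" and z: "v + mu T t *\<^sub>R act (cmat (A t)) v = 0"
    obtain P where P: "P ** (mat 1 + mu T t *\<^sub>R cmat (A t)) = mat 1" using inv[OF t] by (auto simp: invertible_def)
    have "v = act (P ** (mat 1 + mu T t *\<^sub>R cmat (A t))) v" by (simp add: P act_one)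
    also have "\<dots> = act P (v + mu T t *\<^sub>R act (cmat (A t)) v)" by (simp add: act_mult add_left scaleR_left act_one)
    finally show "v = 0" by (simp add: z zero_right)
  qed (use K L assms in auto)
  then show ?thesis by simp
qed

end

lemma matrix_action_matrix: "matrix_action ((**) :: complex^'n^'n \<Rightarrow> complex^'n^'n \<Rightarrow> complex^'n^'n)"
  by (intro matrix_action.intro matrix_action_axioms.intro bounded_bilinear_matrix_mult)
     (simp_all add: matrix_mul_assoc)

lemma matrix_action_vector: "matrix_action ((*v) :: complex^'n^'n \<Rightarrow> complex^'n \<Rightarrow> complex^'n)"
  by (intro matrix_action.intro matrix_action_axioms.intro bounded_bilinear_matrix_vector_mult)
     (simp_all add: matrix_vector_mul_assoc)

lemma bounded_linear_Re_matrix: "bounded_linear (\<lambda>M :: complex^'n^'m. (\<chi> i j. Re (M $ i $ j)))"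
  unfolding linear_conv_bounded_linear[symmetric]
  by (rule linearI) (simp_all add: vec_eq_iff)

text \<open>Both assertions follow one scheme: an initial value problem is solved for the
  differential equation, restricted to \<open>T\<close>, and identified by uniqueness for the
  dynamic equation. For the fundamental matrices it runs with matrices as states and zero
  inhomogeneity.\<close>

theorem lemma1:
  fixes T :: "real set"
    and A :: "real \<Rightarrow> real^'n^'n" and f :: "real \<Rightarrow> real^'n"
    and B :: "real \<Rightarrow> complex^'n^'n" and g :: "real \<Rightarrow> complex^'n"
    and d :: side
  defines "s \<equiv> renorm T"
  assumes "time_scale T"
    and "bounded (A ` T)" and "rd_continuous T A" and "regressive T A"
    and "bounded (f ` T)" and "rd_continuous T f"
    and "\<And>t. t \<in> T \<Longrightarrow> B (s t) = cmat (A t)"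
    and "\<And>t. t \<in> T \<Longrightarrow> g (s t) = cvec (f t)"
    and "\<And>t \<theta>. t \<notin> T \<Longrightarrow> \<theta> = Sup {\<tau> \<in> T. \<tau> \<le> t} \<Longrightarrow>
           B (s t) = matrix_Ln d (mu T \<theta>) (cmat (A \<theta>)) /\<^sub>R ln (1 + mu T \<theta>)"
    and "\<And>t \<theta>. t \<notin> T \<Longrightarrow> \<theta> = Sup {\<tau> \<in> T. \<tau> \<le> t} \<Longrightarrow>
           g (s t) = (inverse_matrix_Ln d (mu T \<theta>) (cmat (A \<theta>)) /\<^sub>R ln (1 + mu T \<theta>))
                       *v cvec (f \<theta>)"
  shows "(\<forall>t\<in>T. \<forall>\<tau>\<in>T. cmat (ts_cauchy_matrix T A t \<tau>) = ode_cauchy_matrix B (s t) (s \<tau>)) \<and>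
         (\<forall>\<phi>. ts_solution T (\<lambda>t x. A t *v x + f t) \<phi> \<longrightarrow>
            (\<exists>\<psi>. ode_solution (\<lambda>t x. B t *v x + g t) \<psi> \<and>
                 (\<forall>t\<in>T. cvec (\<phi> t) = \<psi> (s t))))"
proof -
  interpret time_scale_set T by standard fact
  have prev: "Sup {\<tau> \<in> T. \<tau> \<le> t} = prev t" for t by (simp add: prev_def)
  have f_bounded: "bounded ((\<lambda>t. cvec (f t)) ` T)"
    using bounded_linear_image[OF assms(6) bounded_linear_cvec] by (simp add: image_image)
  have f_rd: "rd_continuous T (\<lambda>t. cvec (f t))" by (rule rd_continuous_bounded_linear[OF bounded_linear_cvec assms(7)])
  interpret v: renorm_ode T "(*v)" A "\<lambda>t. cvec (f t)" d B g
    by (rule renorm_ode.intro[OF time_scale_set_axioms matrix_action_vector], rule renorm_ode_axioms.intro)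
       (use assms prev f_bounded f_rd in auto)
  have zero_bounded: "bounded ((\<lambda>_. 0 :: complex^'n^'n) ` T)" by (rule bounded_subset[of "{0}"]) auto
  have zero_rd: "rd_continuous T (\<lambda>_. 0 :: complex^'n^'n)" by (auto simp: rd_continuous_def)
  interpret m: renorm_ode T "(**)" A "\<lambda>_. 0 :: complex^'n^'n" d B "\<lambda>_. 0"
    by (rule renorm_ode.intro[OF time_scale_set_axioms matrix_action_matrix], rule renorm_ode_axioms.intro)
       (use assms prev zero_bounded zero_rd in auto)
  interpret vo: caratheodory v.F by (rule v.caratheodory_F)
  interpret mo: caratheodory m.F by (rule m.caratheodory_F)
  have mF: "(\<lambda>u Y. B u ** Y) = m.F" and mH: "m.H = (\<lambda>t Y. cmat (A t) ** Y)"
    and vF: "(\<lambda>u x. B u *v x + g u) = v.F" and vH: "v.H = (\<lambda>t x. cmat (A t) *v x + cvec (f t))"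
    by (simp_all add: m.F_def m.H_def v.F_def v.H_def fun_eq_iff)
  have cauchy: "cmat (ts_cauchy_matrix T A t \<tau>) = ode_cauchy_matrix B (s t) (s \<tau>)" if t: "t \<in> T" and \<tau>: "\<tau> \<in> T" for t \<tau>
  proof -
    obtain X where X: "ode_solution m.F X" "X (s \<tau>) = mat 1" using mo.solution_exists by blast
    have "ode_cauchy_matrix B (s t) (s \<tau>) = X (s t)"
      unfolding ode_cauchy_matrix_def mF
    proof (rule the_equality)
      fix M assume "\<exists>Y. ode_solution m.F Y \<and> Y (s \<tau>) = mat 1 \<and> M = Y (s t)"
      then show "M = X (s t)" using mo.solution_unique X by metis
    qed (use X in blast)
    moreover have Z: "ts_solution T m.H (\<lambda>t. X (renorm T t))" by (rule m.restrict_solution[OF X(1)])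
    \<comment> \<open>The coefficients on \<open>T\<close> are real, so the real part of the
      restriction solves the real dynamic equation; this is the existence behind
      \<open>ts_cauchy_matrix\<close>. Uniqueness in the complex setting shows that the imaginary
      part vanishes on \<open>T\<close>.\<close>
    define R where "R t = (\<chi> i j. Re (X (s t) $ i $ j))" for t
    have R: "ts_solution T (\<lambda>u Y. A u ** Y) R" unfolding ts_solution_def
    proof
      fix u assume "u \<in> T"
      then have "has_delta_derivative T (\<lambda>t. X (s t)) (cmat (A u) ** X (s u)) u"
        using Z by (simp add: ts_solution_def mH s_def)
      from has_delta_derivative_bounded_linear[OF bounded_linear_Re_matrix this]
      show "has_delta_derivative T R (A u ** R u) u"
        by (simp add: R_def[abs_def] matrix_matrix_mult_def)
    qed
    have R1: "R \<tau> = mat 1" by (simp add: R_def X(2) vec_eq_iff mat_def)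
    have uniq: "cmat (Y t) = X (s t)" if Y: "ts_solution T (\<lambda>u Y. A u ** Y) Y" "Y \<tau> = mat 1" for Y
    proof -
      have "ts_solution T m.H (\<lambda>t. cmat (Y t))" unfolding ts_solution_def
      proof
        fix u assume "u \<in> T"
        then have "has_delta_derivative T Y (A u ** Y u) u" using Y(1) by (simp add: ts_solution_def)
        from has_delta_derivative_bounded_linear[OF bounded_linear_cmat this]
        show "has_delta_derivative T (\<lambda>t. cmat (Y t)) (m.H u (cmat (Y u))) u" by (simp add: mH cmat_mult)
      qed
      from m.ts_solution_unique[OF this Z \<tau> _ t] show ?thesis using X(2) Y(2) by (simp add: s_def)
    qed
    have "ts_cauchy_matrix T A t \<tau> = R t"
      unfolding ts_cauchy_matrix_def
    proof (rule the_equality)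
      fix M assume "\<exists>Y. ts_solution T (\<lambda>u Y. A u ** Y) Y \<and> Y \<tau> = mat 1 \<and> M = Y t"
      then show "M = R t" using uniq uniq[OF R R1] cmat_inj by metis
    qed (use R R1 in blast)
    ultimately show ?thesis using uniq[OF R R1] by simp
  qed
  have "\<exists>\<psi>. ode_solution v.F \<psi> \<and> (\<forall>t\<in>T. cvec (\<phi> t) = \<psi> (s t))"
    if \<phi>: "ts_solution T (\<lambda>t x. A t *v x + f t) \<phi>" for \<phi>
  proof -
    \<comment> \<open>The initial time is \<open>0\<close>, a point that \<open>T\<close> is known
      to contain.\<close>
    obtain \<psi> where \<psi>: "ode_solution v.F \<psi>" "\<psi> (s 0) = cvec (\<phi> 0)" using vo.solution_exists by blast
    have "ts_solution T v.H (\<lambda>t. cvec (\<phi> t))" unfolding ts_solution_def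
    proof
      fix u assume "u \<in> T"
      then have "has_delta_derivative T \<phi> (A u *v \<phi> u + f u) u" using \<phi> by (simp add: ts_solution_def)
      from has_delta_derivative_bounded_linear[OF bounded_linear_cvec this]
      show "has_delta_derivative T (\<lambda>t. cvec (\<phi> t)) (v.H u (cvec (\<phi> u))) u"
        by (simp add: vH cmat_mult_vec cvec_add)
    qed
    from v.ts_solution_unique[OF this v.restrict_solution[OF \<psi>(1)] zero_in_T]
    have "cvec (\<phi> t) = \<psi> (s t)" if "t \<in> T" for t using \<psi>(2) that by (simp add: s_def)
    then show ?thesis using \<psi>(1) by blast
  qed
  then show ?thesis using cauchy unfolding vF by blast
qed

end
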